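(* Let $q$ be a positive integer, $\nu=1/q$, and $H=\mathbb{Z}^2\times\mathrm{U}(1)_f$ (lattice translations and fermion-number conservation, no time reversal). Let $mH^{(\nu)}_{\mathrm{GSD}}$ (respectively $mH^{(\nu)}_{\mathcal{D}}$) be the set of those $\mathcal{C}\in\mathrm{SET}_{H,\nu}$ for which the number of anyons $|\mathcal{C}|$ (respectively the total quantum dimension $\mathcal{D}_{\mathcal{C}}$) is minimal among all elements of $\mathrm{SET}_{H,\nu}$. Then every element of $mH^{(\nu)}_{\mathrm{GSD}}$ and every element of $mH^{(\nu)}_{\mathcal{D}}$ is Abelian, with exactly $2q$ anyons if $q$ is odd and exactly $4q$ anyons if $q$ is even (the fundamental fermion being counted as an anyon).
   Context: A fermionic topological order (TO) $\mathcal{C}$ is a unitary braided fusion category (with its canonical ribbon structure) with finitely many simple objects, called anyons, whose only anyons braiding trivially with all anyons are $1$ (the vacuum) and $c$ (the fundamental fermion), where $c\times c=1$ and $\theta_c=\pi$. Here $e^{i\theta_x}$ is the twist (topological spin) of $x$; $d_x$ is its quantum dimension; $x$ is Abelian if $d_x=1$, and $\mathcal{C}$ is Abelian if all its anyons are; if $x$ or $y$ is Abelian, the full braiding of $x$ around $y$ is a phase $e^{i\theta_{x,y}}$. $|\mathcal{C}|$ is the number of anyons and $\mathcal{D}_{\mathcal{C}}=\sqrt{\sum_x d_x^2}$. An element of $\mathrm{SET}_{H,\nu}$ is a fermionic TO $\mathcal{C}$ together with the following data. (1) Charges $Q_x\in\mathbb{R}/2\mathbb{Z}$ for each anyon with $Q_z=Q_x+Q_y$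 whenever $z$ occurs in $x\times y$, $Q_1=0$ and $Q_c=1$. (2) An Abelian anyon $v$ (the vison) with $\theta_{v,x}=2\pi Q_x$ mod $2\pi$ for all anyons $x$, and a real number $\sigma_H$ (Hall conductance) with $\theta_v=\pi\sigma_H$ mod $2\pi$ and $Q_v=\sigma_H$ mod $2$. (3) An Abelian anyon $a$ (the background anyon) with $Q_a=\nu$ mod $2$. (4) Translations: an action of $\mathbb{Z}^2$ on the anyons by permutations preserving fusion rules, topological spins, $c$, and charges. *)

theory Defs
  imports Complex_Main "HOL-Library.Real_Mod"
begin

section \<open>Unitary braided fusion categories\<close>

text \<open>Small categories with objects in \<open>'o\<close> and arrows in \<open>'m\<close>. Everything is relative to the
  carriers \<open>Ob\<close> and \<open>Hom\<close>; the values of the operations outside them are irrelevant. Composition is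
  written in applicative order. The coherence arrows are
  \<open>assoc X Y Z : (X \<otimes> Y) \<otimes> Z \<rightarrow> X \<otimes> (Y \<otimes> Z)\<close>, \<open>lunit X : I \<otimes> X \<rightarrow> X\<close>, \<open>runit X : X \<otimes> I \<rightarrow> X\<close>,
  \<open>braid X Y : X \<otimes> Y \<rightarrow> Y \<otimes> X\<close>, where \<open>I\<close> is \<open>tunit\<close>.\<close>

record ('o, 'm) cat =
  Ob :: "'o set"
  Hom :: "'o \<Rightarrow> 'o \<Rightarrow> 'm set"
  ident :: "'o \<Rightarrow> 'm"
  comp :: "'m \<Rightarrow> 'm \<Rightarrow> 'm"  (infixr \<open>\<cdot>\<index>\<close> 65)
  hzero :: "'o \<Rightarrow> 'o \<Rightarrow> 'm"
  hadd :: "'m \<Rightarrow> 'm \<Rightarrow> 'm"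
  hscale :: "complex \<Rightarrow> 'm \<Rightarrow> 'm"
  adj :: "'m \<Rightarrow> 'm"
  tunit :: "'o"
  tens :: "'o \<Rightarrow> 'o \<Rightarrow> 'o"  (infixr \<open>\<otimes>\<index>\<close> 70)
  tensA :: "'m \<Rightarrow> 'm \<Rightarrow> 'm"  (infixr \<open>\<odot>\<index>\<close> 70)
  assoc :: "'o \<Rightarrow> 'o \<Rightarrow> 'o \<Rightarrow> 'm"
  lunit :: "'o \<Rightarrow> 'm"
  runit :: "'o \<Rightarrow> 'm"
  braid :: "'o \<Rightarrow> 'o \<Rightarrow> 'm"

definition isomorphic :: "('o, 'm) cat \<Rightarrow> 'o \<Rightarrow> 'o \<Rightarrow> bool" where
  "isomorphic C X Y \<longleftrightarrow>
     (\<exists>f \<in> Hom C X Y. \<exists>g \<in> Hom C Y X. comp C g f = ident C X \<and> comp C f g = ident C Y)"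

definition unitary :: "('o, 'm) cat \<Rightarrow> 'o \<Rightarrow> 'o \<Rightarrow> 'm \<Rightarrow> bool" where
  "unitary C X Y u \<longleftrightarrow>
     u \<in> Hom C X Y \<and> comp C (adj C u) u = ident C X \<and> comp C u (adj C u) = ident C Y"

text \<open>Over an algebraically closed field an object of a semisimple category is simple iff its
  endomorphisms are the scalars; this is the usual definition for \<open>*\<close>-categories.\<close>

definition simple :: "('o, 'm) cat \<Rightarrow> 'o \<Rightarrow> bool" where
  "simple C X \<longleftrightarrow> X \<in> Ob C \<and> ident C X \<noteq> hzero C X X \<and>
     Hom C X X = {hscale C k (ident C X) | k. True}"

primrec hsum :: "('o, 'm) cat \<Rightarrow> 'o \<Rightarrow> 'o \<Rightarrow> (nat \<Rightarrow> 'm) \<Rightarrow> nat \<Rightarrow> 'm" where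
  "hsum C X Y f 0 = hzero C X Y"
| "hsum C X Y f (Suc n) = hadd C (hsum C X Y f n) (f n)"

text \<open>\<open>Z\<close> is the orthogonal direct sum of \<open>S 0, \<dots>, S (n - 1)\<close>, with isometric inclusions \<open>p i\<close>;
  for \<open>n = 0\<close> this says that \<open>Z\<close> is a zero object.\<close>

definition direct_sum ::
    "('o, 'm) cat \<Rightarrow> nat \<Rightarrow> (nat \<Rightarrow> 'o) \<Rightarrow> (nat \<Rightarrow> 'm) \<Rightarrow> 'o \<Rightarrow> bool" where
  "direct_sum C n S p Z \<longleftrightarrow> Z \<in> Ob C \<and>
     (\<forall>i<n. S i \<in> Ob C \<and> p i \<in> Hom C (S i) Z) \<and>
     (\<forall>i<n. \<forall>j<n. comp C (adj C (p i)) (p j) =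
        (if i = j then ident C (S i) else hzero C (S j) (S i))) \<and>
     hsum C Z Z (\<lambda>i. comp C (p i) (adj C (p i))) n = ident C Z"

locale category =
  fixes C :: "('o, 'm) cat" (structure)
  assumes hom_disjoint: "\<lbrakk>X \<in> Ob C; Y \<in> Ob C; X' \<in> Ob C; Y' \<in> Ob C;
      f \<in> Hom C X Y; f \<in> Hom C X' Y'\<rbrakk> \<Longrightarrow> X = X' \<and> Y = Y'"
    and ident_in: "X \<in> Ob C \<Longrightarrow> ident C X \<in> Hom C X X"
    and comp_in: "\<lbrakk>X \<in> Ob C; Y \<in> Ob C; Z \<in> Ob C; f \<in> Hom C X Y; g \<in> Hom C Y Z\<rbrakk>
      \<Longrightarrow> g \<cdot> f \<in> Hom C X Z"
    and comp_ident: "\<lbrakk>X \<in> Ob C; Y \<in> Ob C; f \<in> Hom C X Y\<rbrakk>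
      \<Longrightarrow> f \<cdot> ident C X = f \<and> ident C Y \<cdot> f = f"
    and comp_assoc: "\<lbrakk>W \<in> Ob C; X \<in> Ob C; Y \<in> Ob C; Z \<in> Ob C;
      f \<in> Hom C W X; g \<in> Hom C X Y; h \<in> Hom C Y Z\<rbrakk> \<Longrightarrow> (h \<cdot> g) \<cdot> f = h \<cdot> (g \<cdot> f)"

locale linear_category = category +
  assumes hzero_in: "\<lbrakk>X \<in> Ob C; Y \<in> Ob C\<rbrakk> \<Longrightarrow> hzero C X Y \<in> Hom C X Y"
    and hadd_in: "\<lbrakk>X \<in> Ob C; Y \<in> Ob C; f \<in> Hom C X Y; g \<in> Hom C X Y\<rbrakk>
      \<Longrightarrow> hadd C f g \<in> Hom C X Y"
    and hscale_in: "\<lbrakk>X \<in> Ob C; Y \<in> Ob C; f \<in> Hom C X Y\<rbrakk> \<Longrightarrow> hscale C k f \<in> Hom C X Y"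
    and hadd_assoc: "\<lbrakk>X \<in> Ob C; Y \<in> Ob C; f \<in> Hom C X Y; g \<in> Hom C X Y; h \<in> Hom C X Y\<rbrakk>
      \<Longrightarrow> hadd C (hadd C f g) h = hadd C f (hadd C g h)"
    and hadd_comm: "\<lbrakk>X \<in> Ob C; Y \<in> Ob C; f \<in> Hom C X Y; g \<in> Hom C X Y\<rbrakk>
      \<Longrightarrow> hadd C f g = hadd C g f"
    and hadd_zero: "\<lbrakk>X \<in> Ob C; Y \<in> Ob C; f \<in> Hom C X Y\<rbrakk> \<Longrightarrow> hadd C f (hzero C X Y) = f"
    and hadd_neg: "\<lbrakk>X \<in> Ob C; Y \<in> Ob C; f \<in> Hom C X Y\<rbrakk>
      \<Longrightarrow> hadd C f (hscale C (- 1) f) = hzero C X Y"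
    and hscale_one: "\<lbrakk>X \<in> Ob C; Y \<in> Ob C; f \<in> Hom C X Y\<rbrakk> \<Longrightarrow> hscale C 1 f = f"
    and hscale_mult: "\<lbrakk>X \<in> Ob C; Y \<in> Ob C; f \<in> Hom C X Y\<rbrakk>
      \<Longrightarrow> hscale C (k * l) f = hscale C k (hscale C l f)"
    and hscale_add_left: "\<lbrakk>X \<in> Ob C; Y \<in> Ob C; f \<in> Hom C X Y\<rbrakk>
      \<Longrightarrow> hscale C (k + l) f = hadd C (hscale C k f) (hscale C l f)"
    and hscale_add_right: "\<lbrakk>X \<in> Ob C; Y \<in> Ob C; f \<in> Hom C X Y; g \<in> Hom C X Y\<rbrakk>
      \<Longrightarrow> hscale C k (hadd C f g) = hadd C (hscale C k f) (hscale C k g)"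
    and comp_add_right: "\<lbrakk>X \<in> Ob C; Y \<in> Ob C; Z \<in> Ob C;
      f \<in> Hom C X Y; f' \<in> Hom C X Y; g \<in> Hom C Y Z\<rbrakk>
      \<Longrightarrow> g \<cdot> hadd C f f' = hadd C (g \<cdot> f) (g \<cdot> f')"
    and comp_add_left: "\<lbrakk>X \<in> Ob C; Y \<in> Ob C; Z \<in> Ob C;
      f \<in> Hom C X Y; g \<in> Hom C Y Z; g' \<in> Hom C Y Z\<rbrakk>
      \<Longrightarrow> hadd C g g' \<cdot> f = hadd C (g \<cdot> f) (g' \<cdot> f)"
    and comp_scale: "\<lbrakk>X \<in> Ob C; Y \<in> Ob C; Z \<in> Ob C; f \<in> Hom C X Y; g \<in> Hom C Y Z\<rbrakk>
      \<Longrightarrow> g \<cdot> hscale C k f = hscale C k (g \<cdot> f) \<and> hscale C k g \<cdot> f = hscale C k (g \<cdot> f)"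

text \<open>A positive \<open>*\<close>-structure. Because orthogonal direct sums exist (see
  \<open>unitary_braided_fusion_category\<close>), the condition \<open>adj_positive\<close> does force \<open>f\<^sup>* f\<close> to be a
  positive endomorphism.\<close>

locale star_category = linear_category +
  assumes adj_in: "\<lbrakk>X \<in> Ob C; Y \<in> Ob C; f \<in> Hom C X Y\<rbrakk> \<Longrightarrow> adj C f \<in> Hom C Y X"
    and adj_adj: "\<lbrakk>X \<in> Ob C; Y \<in> Ob C; f \<in> Hom C X Y\<rbrakk> \<Longrightarrow> adj C (adj C f) = f"
    and adj_comp: "\<lbrakk>X \<in> Ob C; Y \<in> Ob C; Z \<in> Ob C; f \<in> Hom C X Y; g \<in> Hom C Y Z\<rbrakk>
      \<Longrightarrow> adj C (g \<cdot> f) = adj C f \<cdot> adj C g"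
    and adj_add: "\<lbrakk>X \<in> Ob C; Y \<in> Ob C; f \<in> Hom C X Y; g \<in> Hom C X Y\<rbrakk>
      \<Longrightarrow> adj C (hadd C f g) = hadd C (adj C f) (adj C g)"
    and adj_scale: "\<lbrakk>X \<in> Ob C; Y \<in> Ob C; f \<in> Hom C X Y\<rbrakk>
      \<Longrightarrow> adj C (hscale C k f) = hscale C (cnj k) (adj C f)"
    and adj_positive: "\<lbrakk>X \<in> Ob C; Y \<in> Ob C; f \<in> Hom C X Y; adj C f \<cdot> f = hzero C X X\<rbrakk>
      \<Longrightarrow> f = hzero C X Y"

locale unitary_monoidal_category = star_category +
  assumes tunit_in: "tunit C \<in> Ob C"
    and tens_in: "\<lbrakk>X \<in> Ob C; Y \<in> Ob C\<rbrakk> \<Longrightarrow> X \<otimes> Y \<in> Ob C"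
    and tensA_in: "\<lbrakk>X \<in> Ob C; Y \<in> Ob C; X' \<in> Ob C; Y' \<in> Ob C;
      f \<in> Hom C X Y; f' \<in> Hom C X' Y'\<rbrakk> \<Longrightarrow> f \<odot> f' \<in> Hom C (X \<otimes> X') (Y \<otimes> Y')"
    and tensA_ident: "\<lbrakk>X \<in> Ob C; Y \<in> Ob C\<rbrakk> \<Longrightarrow> ident C X \<odot> ident C Y = ident C (X \<otimes> Y)"
    and tensA_comp: "\<lbrakk>X \<in> Ob C; Y \<in> Ob C; Z \<in> Ob C; X' \<in> Ob C; Y' \<in> Ob C; Z' \<in> Ob C;
      f \<in> Hom C X Y; g \<in> Hom C Y Z; f' \<in> Hom C X' Y'; g' \<in> Hom C Y' Z'\<rbrakk>
      \<Longrightarrow> (g \<cdot> f) \<odot> (g' \<cdot> f') = (g \<odot> g') \<cdot> (f \<odot> f')"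
    and tensA_add_left: "\<lbrakk>X \<in> Ob C; Y \<in> Ob C; X' \<in> Ob C; Y' \<in> Ob C;
      f \<in> Hom C X Y; g \<in> Hom C X Y; f' \<in> Hom C X' Y'\<rbrakk>
      \<Longrightarrow> hadd C f g \<odot> f' = hadd C (f \<odot> f') (g \<odot> f')"
    and tensA_add_right: "\<lbrakk>X \<in> Ob C; Y \<in> Ob C; X' \<in> Ob C; Y' \<in> Ob C;
      f \<in> Hom C X Y; f' \<in> Hom C X' Y'; g' \<in> Hom C X' Y'\<rbrakk>
      \<Longrightarrow> f \<odot> hadd C f' g' = hadd C (f \<odot> f') (f \<odot> g')"
    and tensA_scale: "\<lbrakk>X \<in> Ob C; Y \<in> Ob C; X' \<in> Ob C; Y' \<in> Ob C;
      f \<in> Hom C X Y; f' \<in> Hom C X' Y'\<rbrakk>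
      \<Longrightarrow> hscale C k f \<odot> f' = hscale C k (f \<odot> f') \<and> f \<odot> hscale C k f' = hscale C k (f \<odot> f')"
    and tensA_adj: "\<lbrakk>X \<in> Ob C; Y \<in> Ob C; X' \<in> Ob C; Y' \<in> Ob C;
      f \<in> Hom C X Y; f' \<in> Hom C X' Y'\<rbrakk> \<Longrightarrow> adj C (f \<odot> f') = adj C f \<odot> adj C f'"
    and assoc_unitary: "\<lbrakk>X \<in> Ob C; Y \<in> Ob C; Z \<in> Ob C\<rbrakk>
      \<Longrightarrow> unitary C ((X \<otimes> Y) \<otimes> Z) (X \<otimes> (Y \<otimes> Z)) (assoc C X Y Z)"
    and assoc_natural: "\<lbrakk>X \<in> Ob C; Y \<in> Ob C; Z \<in> Ob C; X' \<in> Ob C; Y' \<in> Ob C; Z' \<in> Ob C;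
      f \<in> Hom C X X'; g \<in> Hom C Y Y'; h \<in> Hom C Z Z'\<rbrakk>
      \<Longrightarrow> assoc C X' Y' Z' \<cdot> ((f \<odot> g) \<odot> h) = (f \<odot> (g \<odot> h)) \<cdot> assoc C X Y Z"
    and lunit_unitary: "X \<in> Ob C \<Longrightarrow> unitary C (tunit C \<otimes> X) X (lunit C X)"
    and lunit_natural: "\<lbrakk>X \<in> Ob C; Y \<in> Ob C; f \<in> Hom C X Y\<rbrakk>
      \<Longrightarrow> lunit C Y \<cdot> (ident C (tunit C) \<odot> f) = f \<cdot> lunit C X"
    and runit_unitary: "X \<in> Ob C \<Longrightarrow> unitary C (X \<otimes> tunit C) X (runit C X)"
    and runit_natural: "\<lbrakk>X \<in> Ob C; Y \<in> Ob C; f \<in> Hom C X Y\<rbrakk>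
      \<Longrightarrow> runit C Y \<cdot> (f \<odot> ident C (tunit C)) = f \<cdot> runit C X"
    and pentagon: "\<lbrakk>W \<in> Ob C; X \<in> Ob C; Y \<in> Ob C; Z \<in> Ob C\<rbrakk>
      \<Longrightarrow> assoc C W X (Y \<otimes> Z) \<cdot> assoc C (W \<otimes> X) Y Z =
          (ident C W \<odot> assoc C X Y Z) \<cdot> assoc C W (X \<otimes> Y) Z \<cdot> (assoc C W X Y \<odot> ident C Z)"
    and triangle: "\<lbrakk>X \<in> Ob C; Y \<in> Ob C\<rbrakk>
      \<Longrightarrow> (ident C X \<odot> lunit C Y) \<cdot> assoc C X (tunit C) Y = runit C X \<odot> ident C Y"

locale unitary_braided_category = unitary_monoidal_category +
  assumes braid_unitary: "\<lbrakk>X \<in> Ob C; Y \<in> Ob C\<rbrakk> \<Longrightarrow> unitary C (X \<otimes> Y) (Y \<otimes> X) (braid C X Y)"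
    and braid_natural: "\<lbrakk>X \<in> Ob C; Y \<in> Ob C; X' \<in> Ob C; Y' \<in> Ob C;
      f \<in> Hom C X X'; g \<in> Hom C Y Y'\<rbrakk>
      \<Longrightarrow> braid C X' Y' \<cdot> (f \<odot> g) = (g \<odot> f) \<cdot> braid C X Y"
    and hexagon: "\<lbrakk>X \<in> Ob C; Y \<in> Ob C; Z \<in> Ob C\<rbrakk>
      \<Longrightarrow> assoc C Y Z X \<cdot> braid C X (Y \<otimes> Z) \<cdot> assoc C X Y Z =
          (ident C Y \<odot> braid C X Z) \<cdot> assoc C Y X Z \<cdot> (braid C X Y \<odot> ident C Z)"
    and hexagon_inv: "\<lbrakk>X \<in> Ob C; Y \<in> Ob C; Z \<in> Ob C\<rbrakk>
      \<Longrightarrow> adj C (assoc C Z X Y) \<cdot> braid C (X \<otimes> Y) Z \<cdot> adj C (assoc C X Y Z) =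
          (braid C X Z \<odot> ident C Y) \<cdot> adj C (assoc C X Z Y) \<cdot> (ident C X \<odot> braid C Y Z)"

text \<open>\<open>dual_pair C X X' r s\<close>: the object \<open>X'\<close> is a dual of \<open>X\<close>, with evaluation
  \<open>r\<^sup>* : X' \<otimes> X \<rightarrow> I\<close> and coevaluation \<open>s : I \<rightarrow> X \<otimes> X'\<close>. The equations are the two zigzag
  identities (the first one in adjoint form); by taking adjoints, \<open>X'\<close> is both a left and a right
  dual.\<close>

definition dual_pair :: "('o, 'm) cat \<Rightarrow> 'o \<Rightarrow> 'o \<Rightarrow> 'm \<Rightarrow> 'm \<Rightarrow> bool" where
  "dual_pair C X X' r s \<longleftrightarrow> X \<in> Ob C \<and> X' \<in> Ob C \<and>
     r \<in> Hom C (tunit C) (tens C X' X) \<and> s \<in> Hom C (tunit C) (tens C X X') \<and>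
     lunit C X \<cdot>\<^bsub>C\<^esub> (adj C s \<odot>\<^bsub>C\<^esub> ident C X) \<cdot>\<^bsub>C\<^esub> adj C (assoc C X X' X) \<cdot>\<^bsub>C\<^esub>
       (ident C X \<odot>\<^bsub>C\<^esub> r) \<cdot>\<^bsub>C\<^esub> adj C (runit C X) = ident C X \<and>
     lunit C X' \<cdot>\<^bsub>C\<^esub> (adj C r \<odot>\<^bsub>C\<^esub> ident C X') \<cdot>\<^bsub>C\<^esub> adj C (assoc C X' X X') \<cdot>\<^bsub>C\<^esub>
       (ident C X' \<odot>\<^bsub>C\<^esub> s) \<cdot>\<^bsub>C\<^esub> adj C (runit C X') = ident C X'"

definition anyon_rel :: "('o, 'm) cat \<Rightarrow> ('o \<times> 'o) set" where
  "anyon_rel C = {(X, Y). simple C X \<and> simple C Y \<and> isomorphic C X Y}"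

definition anyons :: "('o, 'm) cat \<Rightarrow> 'o set set" where
  "anyons C = {X. simple C X} // anyon_rel C"

locale unitary_braided_fusion_category = unitary_braided_category +
  assumes zero_object: "\<exists>Z S p. direct_sum C 0 S p Z"
    and binary_sums: "\<lbrakk>X \<in> Ob C; Y \<in> Ob C\<rbrakk>
      \<Longrightarrow> \<exists>Z S p. S 0 = X \<and> S 1 = Y \<and> direct_sum C 2 S p Z"
    and semisimple: "X \<in> Ob C \<Longrightarrow> \<exists>n S p. (\<forall>i<n. simple C (S i)) \<and> direct_sum C n S p X"
    and finite_anyons: "finite (anyons C)"
    and tunit_simple: "simple C (tunit C)"
    and rigid: "X \<in> Ob C \<Longrightarrow> \<exists>X' r s. dual_pair C X X' r s"

section \<open>Anyons\<close>

text \<open>The canonical ribbon structure. For simple \<open>X\<close>, the duality data of the unitary spherical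
  structure are the balanced ones, \<open>r\<^sup>* r = s\<^sup>* s\<close>. The common value is the quantum
  dimension, and the twist is the partial trace of \<open>braid X X\<close> over the second strand.\<close>

definition standard_dual :: "('o, 'm) cat \<Rightarrow> 'o \<Rightarrow> 'o \<Rightarrow> 'm \<Rightarrow> 'm \<Rightarrow> bool" where
  "standard_dual C X X' r s \<longleftrightarrow>
     dual_pair C X X' r s \<and> comp C (adj C r) r = comp C (adj C s) s"

definition obj_dim :: "('o, 'm) cat \<Rightarrow> 'o \<Rightarrow> real" where
  "obj_dim C X = (THE d. \<exists>X' r s. standard_dual C X X' r s \<and>
     comp C (adj C s) s = hscale C (complex_of_real d) (ident C (tunit C)))"

definition obj_twist :: "('o, 'm) cat \<Rightarrow> 'o \<Rightarrow> complex" where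
  "obj_twist C X = (THE t. \<exists>X' r s. standard_dual C X X' r s \<and>
     runit C X \<cdot>\<^bsub>C\<^esub> (ident C X \<odot>\<^bsub>C\<^esub> adj C s) \<cdot>\<^bsub>C\<^esub> assoc C X X X' \<cdot>\<^bsub>C\<^esub>
       (braid C X X \<odot>\<^bsub>C\<^esub> ident C X') \<cdot>\<^bsub>C\<^esub>
       adj C (assoc C X X X') \<cdot>\<^bsub>C\<^esub> (ident C X \<odot>\<^bsub>C\<^esub> s) \<cdot>\<^bsub>C\<^esub> adj C (runit C X)
     = hscale C t (ident C X))"

definition hom_dim :: "('o, 'm) cat \<Rightarrow> 'o \<Rightarrow> 'o \<Rightarrow> nat" where
  "hom_dim C X Y = (LEAST n. \<exists>b. (\<forall>i<n. b i \<in> Hom C X Y) \<and>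
     (\<forall>f \<in> Hom C X Y. \<exists>k. f = hsum C X Y (\<lambda>i. hscale C (k i) (b i)) n))"

text \<open>Anyons are isomorphism classes of simple objects; the following notions are invariant under
  isomorphism and are evaluated on a representative.\<close>

definition rep :: "'o set \<Rightarrow> 'o" where
  "rep x = (SOME X. X \<in> x)"

definition vacuum :: "('o, 'm) cat \<Rightarrow> 'o set" where
  "vacuum C = anyon_rel C `` {tunit C}"

definition qdim :: "('o, 'm) cat \<Rightarrow> 'o set \<Rightarrow> real" where
  "qdim C x = obj_dim C (rep x)"

text \<open>\<open>twist C x\<close> is the phase \<open>exp (i \<theta>\<^sub>x)\<close>.\<close>

definition twist :: "('o, 'm) cat \<Rightarrow> 'o set \<Rightarrow> complex" where
  "twist C x = obj_twist C (rep x)"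

definition fusion_mult :: "('o, 'm) cat \<Rightarrow> 'o set \<Rightarrow> 'o set \<Rightarrow> 'o set \<Rightarrow> nat" where
  "fusion_mult C x y z = hom_dim C (rep z) (tens C (rep x) (rep y))"

definition occurs :: "('o, 'm) cat \<Rightarrow> 'o set \<Rightarrow> 'o set \<Rightarrow> 'o set \<Rightarrow> bool" where
  "occurs C z x y \<longleftrightarrow> (\<exists>f \<in> Hom C (rep z) (tens C (rep x) (rep y)).
     f \<noteq> hzero C (rep z) (tens C (rep x) (rep y)))"

text \<open>The full braiding of \<open>x\<close> around \<open>y\<close> is the phase \<open>w\<close> (which is \<open>exp (i \<theta>\<^bsub>x,y\<^esub>)\<close>).\<close>

definition full_braiding :: "('o, 'm) cat \<Rightarrow> 'o set \<Rightarrow> 'o set \<Rightarrow> complex \<Rightarrow> bool" where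
  "full_braiding C x y w \<longleftrightarrow>
     comp C (braid C (rep y) (rep x)) (braid C (rep x) (rep y)) =
     hscale C w (ident C (tens C (rep x) (rep y)))"

definition abelian_anyon :: "('o, 'm) cat \<Rightarrow> 'o set \<Rightarrow> bool" where
  "abelian_anyon C x \<longleftrightarrow> x \<in> anyons C \<and> qdim C x = 1"

definition abelian_cat :: "('o, 'm) cat \<Rightarrow> bool" where
  "abelian_cat C \<longleftrightarrow> (\<forall>x \<in> anyons C. abelian_anyon C x)"

definition num_anyons :: "('o, 'm) cat \<Rightarrow> nat" where
  "num_anyons C = card (anyons C)"

definition total_qdim :: "('o, 'm) cat \<Rightarrow> real" where
  "total_qdim C = sqrt (\<Sum>x \<in> anyons C. (qdim C x)\<^sup>2)"

section \<open>Fermionic topological orders with symmetry\<close>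

text \<open>Here \<open>c\<close> is the fundamental fermion; \<open>\<theta>\<^sub>c = \<pi>\<close> reads \<open>twist C c = -1\<close>.\<close>

definition fermionic_TO :: "('o, 'm) cat \<Rightarrow> 'o set \<Rightarrow> bool" where
  "fermionic_TO C c \<longleftrightarrow> unitary_braided_fusion_category C \<and>
     {x \<in> anyons C. \<forall>y \<in> anyons C. full_braiding C x y 1} = {vacuum C, c} \<and>
     isomorphic C (tens C (rep c) (rep c)) (tunit C) \<and>
     twist C c = cis pi"

text \<open>Charges are represented by reals and compared modulo 2. The group \<open>\<int>\<^sup>2\<close> of lattice
  translations is \<open>int \<times> int\<close>.\<close>

record ('o, 'm) enriched_TO =
  TO :: "('o, 'm) cat"
  fermion :: "'o set"
  charge :: "'o set \<Rightarrow> real"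
  vison :: "'o set"
  hall :: real
  background :: "'o set"
  translation :: "int \<times> int \<Rightarrow> 'o set \<Rightarrow> 'o set"

definition charge_assignment :: "('o, 'm) enriched_TO \<Rightarrow> bool" where
  "charge_assignment S \<longleftrightarrow>
     (\<forall>x \<in> anyons (TO S). \<forall>y \<in> anyons (TO S). \<forall>z \<in> anyons (TO S). occurs (TO S) z x y \<longrightarrow>
        [charge S z = charge S x + charge S y] (rmod 2)) \<and>
     [charge S (vacuum (TO S)) = 0] (rmod 2) \<and>
     [charge S (fermion S) = 1] (rmod 2)"

definition vison_data :: "('o, 'm) enriched_TO \<Rightarrow> bool" where
  "vison_data S \<longleftrightarrow> abelian_anyon (TO S) (vison S) \<and>
     (\<forall>x \<in> anyons (TO S). full_braiding (TO S) (vison S) x (cis (2 * pi * charge S x))) \<and>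
     twist (TO S) (vison S) = cis (pi * hall S) \<and>
     [charge S (vison S) = hall S] (rmod 2)"

definition background_data :: "real \<Rightarrow> ('o, 'm) enriched_TO \<Rightarrow> bool" where
  "background_data \<nu> S \<longleftrightarrow> abelian_anyon (TO S) (background S) \<and>
     [charge S (background S) = \<nu>] (rmod 2)"

definition translation_action :: "('o, 'm) enriched_TO \<Rightarrow> bool" where
  "translation_action S \<longleftrightarrow>
     (\<forall>g. bij_betw (translation S g) (anyons (TO S)) (anyons (TO S))) \<and>
     (\<forall>x \<in> anyons (TO S). translation S (0, 0) x = x) \<and>
     (\<forall>m n m' n'. \<forall>x \<in> anyons (TO S).
        translation S (m + m', n + n') x = translation S (m, n) (translation S (m', n') x)) \<and>
     (\<forall>g. \<forall>x \<in> anyons (TO S). \<forall>y \<in> anyons (TO S). \<forall>z \<in> anyons (TO S).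
        fusion_mult (TO S) (translation S g x) (translation S g y) (translation S g z) =
        fusion_mult (TO S) x y z) \<and>
     (\<forall>g. \<forall>x \<in> anyons (TO S). twist (TO S) (translation S g x) = twist (TO S) x \<and>
        [charge S (translation S g x) = charge S x] (rmod 2)) \<and>
     (\<forall>g. translation S g (fermion S) = fermion S)"

text \<open>\<open>SET \<nu>\<close> is \<open>SET\<^bsub>H,\<nu>\<^esub>\<close> for \<open>H = \<int>\<^sup>2 \<times> U(1)\<^sub>f\<close>.\<close>

definition SET :: "real \<Rightarrow> ('o, 'm) enriched_TO set" where
  "SET \<nu> = {S. fermionic_TO (TO S) (fermion S) \<and> charge_assignment S \<and> vison_data S \<and>
     background_data \<nu> S \<and> translation_action S}"

text \<open>Minimality over all elements of \<open>SET\<^bsub>H,\<nu>\<^esub>\<close> cannot quantify over types, so the elements of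
  arbitrary types \<open>'o\<close>, \<open>'m\<close> are compared with those in one universe that contains a copy of every
  unitary braided fusion category up to equivalence: enumerate the anyons by natural numbers, take
  as objects the finite lists of labels (formal direct sums of simple objects), and as arrows the
  complex matrices (together with their source and target) whose entries vanish between different
  labels. The quantities \<open>num_anyons\<close> and \<open>total_qdim\<close> are invariant under equivalence.\<close>

type_synonym ref_obj = "nat list"
type_synonym ref_arr = "nat list \<times> (nat \<Rightarrow> nat \<Rightarrow> complex) \<times> nat list"

definition mH_GSD :: "real \<Rightarrow> ('o, 'm) enriched_TO set" where
  "mH_GSD \<nu> = {S \<in> SET \<nu>. \<forall>S' \<in> (SET \<nu> :: (ref_obj, ref_arr) enriched_TO set).
     num_anyons (TO S) \<le> num_anyons (TO S')}"

definition mH_D :: "real \<Rightarrow> ('o, 'm) enriched_TO set" where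
  "mH_D \<nu> = {S \<in> SET \<nu>. \<forall>S' \<in> (SET \<nu> :: (ref_obj, ref_arr) enriched_TO set).
     total_qdim (TO S) \<le> total_qdim (TO S')}"

end

theory Submission
  imports Defs "HOL-Library.Nat_Bijection" "HOL-Library.Product_Plus"
begin

text \<open>Lower bound: anyons of quantum dimension 1 are exactly the invertible ones. The charges of the
  powers \<open>a\<^sup>k\<close> of the background anyon are \<open>k / q\<close> modulo 2, so \<open>a\<^sup>k\<close> for \<open>k < 2q\<close> are \<open>2q\<close>
  different invertible anyons. If \<open>q\<close> is even, the fermion is not \<open>a\<^sup>q\<close>: if \<open>b\<close> is invertible
  with self-braiding \<open>t\<close>, then \<open>t\<^sup>4\<close> is both the twist of \<open>b \<otimes> b\<close> and its full braiding with
  \<open>b\<close>, and for the transparent fermion the former is \<open>-1\<close> and the latter is 1. Hence the \<open>c a\<^sup>k\<close>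
  are \<open>2q\<close> further invertible anyons. Since all quantum dimensions are positive, the same
  numbers bound \<open>\<D>\<^sup>2\<close>, and in case of equality every anyon is invertible.

  Sharpness: the bounds are attained by pointed categories with fusion group \<open>\<int>\<^sub>N \<times> \<int>\<^sub>2\<close>, where
  \<open>N = q\<close> for odd \<open>q\<close> and \<open>N = 2q\<close> for even \<open>q\<close>.\<close>

section \<open>Typed arrows\<close>

text \<open>\<open>abelian_anyon\<close> is a condition on a number, whereas the count needs
  products: \<open>invertible_if_dim_1\<close> makes the background anyon invertible, and
  \<open>dim_1_if_invertible\<close> turns its powers back into Abelian anyons. For odd q the power
  a^q may be the fermion itself, as happens in the example built below; this is why the bound is
  only 2q there. Membership in \<open>mH_GSD\<close> or \<open>mH_D\<close> gives an upper bound
  only by comparison with an element of the reference universe, so an explicit category has to be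
  built there. The obstacle is even q. The generator of the cyclic group of order 2q then has twist
  exp(i pi / 2q), of order 4q, while a bicharacter on that group takes only 2q-th roots of unity as
  values; no braiding with trivial associators and the finite group as labels can have this twist.
  The cover by pairs of integers does carry the bicharacter. Labels are therefore pairs of integers,
  and labels that differ by a lattice vector are joined by isomorphisms instead of being
  identified.\<close>

text \<open>Hom sets are disjoint, so an arrow determines its domain \<open>dm\<close> and its codomain \<open>cd\<close>. Phrasing
  the laws with these lets the simplifier discharge all typing conditions.\<close>

context category
begin

definition arr :: "'m \<Rightarrow> bool" where
  "arr f \<longleftrightarrow> (\<exists>X \<in> Ob C. \<exists>Y \<in> Ob C. f \<in> Hom C X Y)"

definition dm :: "'m \<Rightarrow> 'o" where
  "dm f = (THE X. X \<in> Ob C \<and> (\<exists>Y \<in> Ob C. f \<in> Hom C X Y))"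

definition cd :: "'m \<Rightarrow> 'o" where
  "cd f = (THE Y. Y \<in> Ob C \<and> (\<exists>X \<in> Ob C. f \<in> Hom C X Y))"

definition hom :: "'m \<Rightarrow> 'o \<Rightarrow> 'o \<Rightarrow> bool" where
  "hom f X Y \<longleftrightarrow> arr f \<and> dm f = X \<and> cd f = Y"

lemma homI:
  assumes "f \<in> Hom C X Y" "X \<in> Ob C" "Y \<in> Ob C"
  shows "hom f X Y"
proof -
  have "dm f = X" unfolding dm_def
    by (rule the_equality) (use assms hom_disjoint in blast)+
  moreover have "cd f = Y" unfolding cd_def
    by (rule the_equality) (use assms hom_disjoint in blast)+
  ultimately show ?thesis using assms unfolding hom_def arr_def by blast
qed

lemma homD:
  assumes "hom f X Y"
  shows "f \<in> Hom C X Y" "X \<in> Ob C" "Y \<in> Ob C"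
proof -
  from assms obtain X' Y' where *: "X' \<in> Ob C" "Y' \<in> Ob C" "f \<in> Hom C X' Y'"
    unfolding hom_def arr_def by blast
  then have "hom f X' Y'" by (intro homI)
  with assms have "X' = X" "Y' = Y" by (auto simp: hom_def)
  with * show "f \<in> Hom C X Y" "X \<in> Ob C" "Y \<in> Ob C" by auto
qed

lemma hom_iff: "hom f X Y \<longleftrightarrow> f \<in> Hom C X Y \<and> X \<in> Ob C \<and> Y \<in> Ob C"
  using homI homD by blast

lemma arr_hom: "arr f \<Longrightarrow> hom f (dm f) (cd f)"
  by (simp add: hom_def)

lemma arr_Ob [simp]: "arr f \<Longrightarrow> dm f \<in> Ob C" "arr f \<Longrightarrow> cd f \<in> Ob C"
  using homD arr_hom by blast+

lemma hom_simps: "hom f X Y \<Longrightarrow> arr f" "hom f X Y \<Longrightarrow> dm f = X" "hom f X Y \<Longrightarrow> cd f = Y"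
  "hom f X Y \<Longrightarrow> X \<in> Ob C" "hom f X Y \<Longrightarrow> Y \<in> Ob C"
  using homD by (auto simp: hom_def)

lemma homI2: "arr f \<Longrightarrow> dm f = X \<Longrightarrow> cd f = Y \<Longrightarrow> hom f X Y"
  by (simp add: hom_def)

lemma ident_typed [simp]:
  assumes "X \<in> Ob C"
  shows "arr (ident C X)" "dm (ident C X) = X" "cd (ident C X) = X"
  using homI[OF ident_in] assms by (auto simp: hom_def)

lemma comp_typed [simp]:
  assumes "arr f" "arr g" "cd f = dm g"
  shows "arr (g \<cdot> f)" "dm (g \<cdot> f) = dm f" "cd (g \<cdot> f) = cd g"
proof -
  have "hom (g \<cdot> f) (dm f) (cd g)"
    using homI[OF comp_in[of "dm f" "dm g" "cd g" f g]] homD[OF arr_hom[OF assms(1)]]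
      homD[OF arr_hom[OF assms(2)]] assms by auto
  then show "arr (g \<cdot> f)" "dm (g \<cdot> f) = dm f" "cd (g \<cdot> f) = cd g" by (auto simp: hom_def)
qed

lemma comp_id [simp]:
  assumes "arr f"
  shows "dm f = X \<Longrightarrow> f \<cdot> ident C X = f" "cd f = X \<Longrightarrow> ident C X \<cdot> f = f"
  using comp_ident[of "dm f" "cd f" f] homD[OF arr_hom[OF assms]] by auto

lemma assoc_comp [simp]:
  assumes "arr f" "arr g" "arr h" "cd f = dm g" "cd g = dm h"
  shows "(h \<cdot> g) \<cdot> f = h \<cdot> (g \<cdot> f)"
  using comp_assoc[of "dm f" "dm g" "dm h" "cd h" f g h] assms
    homD(1)[OF arr_hom[OF assms(1)]] homD(1)[OF arr_hom[OF assms(2)]]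
    homD(1)[OF arr_hom[OF assms(3)]] by simp

end

section \<open>Linear structure on typed arrows\<close>

context linear_category
begin

lemma hzero_typed [simp]:
  assumes "X \<in> Ob C" "Y \<in> Ob C"
  shows "arr (hzero C X Y)" "dm (hzero C X Y) = X" "cd (hzero C X Y) = Y"
  using homI[OF hzero_in] assms by (auto simp: hom_def)

lemma hscale_typed [simp]:
  assumes "arr f"
  shows "arr (hscale C k f)" "dm (hscale C k f) = dm f" "cd (hscale C k f) = cd f"
  using homI[OF hscale_in] homD[OF arr_hom[OF assms]] by (auto simp: hom_def)

lemma hadd_typed [simp]:
  assumes "arr f" "arr g" "dm f = dm g" "cd f = cd g"
  shows "arr (hadd C f g)" "dm (hadd C f g) = dm g" "cd (hadd C f g) = cd g"
  using homI[OF hadd_in] homD[OF arr_hom[OF assms(1)]] homD[OF arr_hom[OF assms(2)]] assms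
  by (auto simp: hom_def)

lemma scale_comp [simp]:
  assumes "arr f" "arr g" "cd f = dm g"
  shows "g \<cdot> hscale C k f = hscale C k (g \<cdot> f)" "hscale C k g \<cdot> f = hscale C k (g \<cdot> f)"
  using comp_scale[of "dm f" "dm g" "cd g" f g k] assms homD[OF arr_hom[OF assms(1)]]
    homD[OF arr_hom[OF assms(2)]] by auto

lemma add_comp:
  assumes "arr f" "arr f'" "arr g" "cd f = dm g" "dm f' = dm f" "cd f' = cd f"
  shows "g \<cdot> hadd C f f' = hadd C (g \<cdot> f) (g \<cdot> f')"
  using comp_add_right[of "dm f" "dm g" "cd g" f f' g] assms homD[OF arr_hom[OF assms(1)]]
    homD[OF arr_hom[OF assms(2)]] homD[OF arr_hom[OF assms(3)]] by auto

lemma comp_add: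
  assumes "arr f" "arr g" "arr g'" "cd f = dm g" "dm g' = dm g" "cd g' = cd g"
  shows "hadd C g g' \<cdot> f = hadd C (g \<cdot> f) (g' \<cdot> f)"
  using comp_add_left[of "dm f" "dm g" "cd g" f g g'] assms homD[OF arr_hom[OF assms(1)]]
    homD[OF arr_hom[OF assms(2)]] homD[OF arr_hom[OF assms(3)]] by auto

lemma scale_scale [simp]: "arr f \<Longrightarrow> hscale C k (hscale C l f) = hscale C (k * l) f"
  using hscale_mult[of "dm f" "cd f" f] homD[OF arr_hom] by metis

lemma scale_one [simp]: "arr f \<Longrightarrow> hscale C 1 f = f"
  using hscale_one homD[OF arr_hom] by metis

text \<open>No axiom mentions the scalar 0; it is split as 1 + (-1), and \<open>hadd_neg\<close>
  applies.\<close>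

lemma scale_0:
  assumes "arr f" shows "hscale C 0 f = hzero C (dm f) (cd f)"
proof -
  note h = homD[OF arr_hom[OF assms]]
  have "hscale C (1 + (-1)) f = hadd C (hscale C 1 f) (hscale C (-1) f)"
    by (rule hscale_add_left[OF h(2,3,1)])
  then show ?thesis using hadd_neg[OF h(2,3,1)] assms by simp
qed

lemma zero_as_scale:
  assumes "X \<in> Ob C" "Y \<in> Ob C"
  shows "hzero C X Y = hscale C 0 (hzero C X Y)"
  using scale_0[of "hzero C X Y"] assms by simp

lemma scale_zero [simp]:
  assumes "X \<in> Ob C" "Y \<in> Ob C"
  shows "hscale C k (hzero C X Y) = hzero C X Y"
  using assms scale_scale[of "hzero C X Y" k 0] zero_as_scale by simp

lemma zero_comp [simp]:
  assumes "X \<in> Ob C" "arr f"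
  shows "cd f = X \<Longrightarrow> Y \<in> Ob C \<Longrightarrow> hzero C X Y \<cdot> f = hzero C (dm f) Y"
    and "dm f = X \<Longrightarrow> Y \<in> Ob C \<Longrightarrow> f \<cdot> hzero C Y X = hzero C Y (cd f)"
proof -
  assume *: "cd f = X" "Y \<in> Ob C"
  have "hzero C X Y \<cdot> f = hscale C 0 (hzero C X Y) \<cdot> f" using zero_as_scale assms * by simp
  also have "\<dots> = hzero C (dm f) Y" using * assms by (subst scale_comp) (auto simp: scale_0)
  finally show "hzero C X Y \<cdot> f = hzero C (dm f) Y" .
next
  assume *: "dm f = X" "Y \<in> Ob C"
  have "f \<cdot> hzero C Y X = f \<cdot> hscale C 0 (hzero C Y X)" using zero_as_scale assms * by simp
  also have "\<dots> = hzero C Y (cd f)" using * assms by (subst scale_comp) (auto simp: scale_0)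
  finally show "f \<cdot> hzero C Y X = hzero C Y (cd f)" .
qed

lemma scale_add_left:
  assumes "arr f" shows "hadd C (hscale C k f) (hscale C l f) = hscale C (k + l) f"
  using hscale_add_left homD[OF arr_hom[OF assms]] by simp

lemma diff_zero_imp_eq:
  assumes "arr f" "arr g" "dm f = dm g" "cd f = cd g"
    and "hadd C f (hscale C (-1) g) = hzero C (dm g) (cd g)"
  shows "f = g"
proof -
  note hf = homD[OF arr_hom[OF assms(1)]] and hg = homD[OF arr_hom[OF assms(2)]]
  have hng: "hscale C (-1) g \<in> Hom C (dm g) (cd g)" using hscale_in[OF hg(2,3,1)] .
  have f: "f \<in> Hom C (dm g) (cd g)" using hf assms by simp
  have "f = hadd C f (hadd C (hscale C (-1) g) g)"
    using hadd_comm[OF hg(2,3) hng hg(1)] hadd_neg[OF hg(2,3,1)] hadd_zero[OF hg(2,3) f] by simp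
  also have "\<dots> = hadd C (hzero C (dm g) (cd g)) g"
    using hadd_assoc[OF hg(2,3) f hng hg(1)] assms(5) by simp
  also have "\<dots> = g" using hadd_comm[OF hg(2,3) hg(1)] hzero_in[OF hg(2,3)] hadd_zero[OF hg(2,3,1)]
      by simp
  finally show ?thesis .
qed

lemma add_zero [simp]:
  assumes "arr f" "dm f = X" "cd f = Y"
  shows "hadd C f (hzero C X Y) = f" "hadd C (hzero C X Y) f = f"
  using homD[OF arr_hom[OF assms(1)]] assms hadd_zero[of X Y f] hadd_comm[of X Y "hzero C X Y" f]
    hzero_in[of X Y] by auto

lemma scale_eq_zero:
  assumes "arr f" "hscale C k f = hzero C (dm f) (cd f)" "k \<noteq> 0"
  shows "f = hzero C (dm f) (cd f)"
proof -
  have "f = hscale C (inverse k) (hscale C k f)"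
    using assms(1,3) by simp
  also have "\<dots> = hzero C (dm f) (cd f)"
    unfolding assms(2) using assms(1) by simp
  finally show ?thesis .
qed

lemma scale_inj:
  assumes "arr f" "f \<noteq> hzero C (dm f) (cd f)" "hscale C k f = hscale C l f"
  shows "k = l"
proof (rule ccontr)
  assume "k \<noteq> l"
  have "hscale C (k + (-1) * l) f = hadd C (hscale C k f) (hscale C (-1) (hscale C l f))"
    using assms(1) scale_add_left[OF assms(1), of k "(-1)*l"] by simp
  also have "\<dots> = hadd C (hscale C l f) (hscale C (-1) (hscale C l f))" using assms by simp
  also have "\<dots> = hzero C (dm f) (cd f)" using scale_add_left[OF assms(1), of l "-l"] assms(1) by
      (simp add: scale_0)
  finally show False using scale_eq_zero[OF assms(1), of "k + (-1) * l"] assms(2) \<open>k \<noteq> l\<close> by auto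
qed

end

section \<open>Adjoints and positivity\<close>

context star_category
begin

lemma adj_typed [simp]:
  assumes "arr f"
  shows "arr (adj C f)" "dm (adj C f) = cd f" "cd (adj C f) = dm f"
  using homI[OF adj_in] homD[OF arr_hom[OF assms]] by (auto simp: hom_def)

lemma adj_adj' [simp]: "arr f \<Longrightarrow> adj C (adj C f) = f"
  using adj_adj homD[OF arr_hom] by metis

lemma adj_comp' [simp]:
  assumes "arr f" "arr g" "cd f = dm g"
  shows "adj C (g \<cdot> f) = adj C f \<cdot> adj C g"
  using adj_comp[of "dm f" "dm g" "cd g" f g] assms homD[OF arr_hom[OF assms(1)]]
    homD[OF arr_hom[OF assms(2)]] by auto

lemma adj_scale' [simp]: "arr f \<Longrightarrow> adj C (hscale C k f) = hscale C (cnj k) (adj C f)"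
  using adj_scale homD[OF arr_hom] by metis

lemma adj_add':
  assumes "arr f" "arr g" "dm f = dm g" "cd f = cd g"
  shows "adj C (hadd C f g) = hadd C (adj C f) (adj C g)"
  using adj_add[of "dm g" "cd g" f g] homD[OF arr_hom[OF assms(1)]]
    homD[OF arr_hom[OF assms(2)]] assms by auto

lemma adj_zero [simp]:
  assumes "X \<in> Ob C" "Y \<in> Ob C"
  shows "adj C (hzero C X Y) = hzero C Y X"
proof -
  have "adj C (hzero C X Y) = adj C (hscale C 0 (hzero C X Y))" using zero_as_scale assms by simp
  also have "\<dots> = hscale C 0 (adj C (hzero C X Y))" using assms by (subst adj_scale') auto
  also have "\<dots> = hzero C Y X" using assms by (simp add: scale_0)
  finally show ?thesis .
qed

lemma adj_ident [simp]:
  assumes "X \<in> Ob C"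
  shows "adj C (ident C X) = ident C X"
proof -
  have "adj C (ident C X) = ident C X \<cdot> adj C (ident C X)" using assms by simp
  also have "\<dots> = adj C (adj C (ident C X)) \<cdot> adj C (ident C X)" using assms by simp
  also have "\<dots> = adj C (ident C X \<cdot> adj C (ident C X))" using assms by (subst adj_comp') auto
  also have "\<dots> = ident C X" using assms by simp
  finally show ?thesis .
qed

lemma adj_comp_zero:
  assumes "arr f" "adj C f \<cdot> f = hzero C (dm f) (dm f)"
  shows "f = hzero C (dm f) (cd f)"
  using adj_positive[OF homD(2,3,1)[OF arr_hom[OF assms(1)]] assms(2)] .

text \<open>All four inner products equal h, so the difference f - g has norm h - h - h + h = 0, and
  positivity of the adjoint makes it vanish.\<close>

lemma eq_by_gram:
  assumes "arr f" "arr g" "dm f = dm g" "cd f = cd g"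
    and "adj C f \<cdot> f = h" "adj C f \<cdot> g = h" "adj C g \<cdot> f = h" "adj C g \<cdot> g = h"
  shows "f = g"
proof (rule diff_zero_imp_eq)
  let ?d = "hadd C f (hscale C (-1) g)"
  have h: "arr h" "dm h = dm g" "cd h = dm g" unfolding assms(8)[symmetric] using assms(1-4) by auto
  have "adj C ?d \<cdot> ?d = hadd C (hadd C h (hscale C (-1) h)) (hscale C (-1) (hadd C h (hscale C
      (-1) h)))"
    using assms(1-4) by (simp add: adj_add' add_comp comp_add assms(5-8) h)
  also have "\<dots> = hzero C (dm g) (dm g)"
    using scale_add_left[OF h(1), of 1 "-1"] h arr_Ob(1)[OF assms(2)] hadd_zero[OF _ _ hzero_in]
    by (simp add: scale_0)
  finally have "?d = hzero C (dm ?d) (cd ?d)"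
    using assms(1-4) by (intro adj_comp_zero) auto
  then show "?d = hzero C (dm g) (cd g)" using assms(1-4) by simp
qed (use assms(1-4) in auto)

end

section \<open>Coherence of the tensor product\<close>

context unitary_monoidal_category
begin

lemma tunit_Ob [simp]: "tunit C \<in> Ob C"
  by (rule tunit_in)

lemma tens_Ob [simp]: "X \<in> Ob C \<Longrightarrow> Y \<in> Ob C \<Longrightarrow> X \<otimes> Y \<in> Ob C"
  by (rule tens_in)

lemma tensA_typed [simp]:
  assumes "arr f" "arr g"
  shows "arr (f \<odot> g)" "dm (f \<odot> g) = dm f \<otimes> dm g" "cd (f \<odot> g) = cd f \<otimes> cd g"
  using homI[OF tensA_in[of "dm f" "cd f" "dm g" "cd g" f g]] homD[OF arr_hom[OF assms(1)]]
    homD[OF arr_hom[OF assms(2)]] by (auto simp: hom_def)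

lemma tens_ident [simp]: "X \<in> Ob C \<Longrightarrow> Y \<in> Ob C \<Longrightarrow> ident C X \<odot> ident C Y = ident C (X \<otimes> Y)"
  by (rule tensA_ident)

lemma interchange [simp]:
  assumes "arr f" "arr g" "arr f'" "arr g'" "cd f = dm g" "cd f' = dm g'"
  shows "(g \<odot> g') \<cdot> (f \<odot> f') = (g \<cdot> f) \<odot> (g' \<cdot> f')"
  using tensA_comp[of "dm f" "dm g" "cd g" "dm f'" "dm g'" "cd g'" f g f' g'] assms
    homD[OF arr_hom[OF assms(1)]] homD[OF arr_hom[OF assms(2)]]
    homD[OF arr_hom[OF assms(3)]] homD[OF arr_hom[OF assms(4)]] by simp

text \<open>Composites are normalised to right-nested form. There two adjacent tensor products are
  followed by a tail h, a pattern that \<open>interchange\<close> alone does not match.\<close>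

lemma interchange_assoc [simp]:
  assumes "arr f" "arr g" "arr f'" "arr g'" "cd f = dm g" "cd f' = dm g'"
    "arr h" "cd h = dm f \<otimes> dm f'"
  shows "(g \<odot> g') \<cdot> (f \<odot> f') \<cdot> h = ((g \<cdot> f) \<odot> (g' \<cdot> f')) \<cdot> h"
  using interchange[OF assms(1-6)] assoc_comp[of h "f \<odot> f'" "g \<odot> g'"] assms
  by (simp del: interchange assoc_comp)

lemma tens_scale [simp]:
  assumes "arr f" "arr g"
  shows "hscale C k f \<odot> g = hscale C k (f \<odot> g)" "f \<odot> hscale C k g = hscale C k (f \<odot> g)"
  using tensA_scale[of "dm f" "cd f" "dm g" "cd g" f g k] homD[OF arr_hom[OF assms(1)]]
    homD[OF arr_hom[OF assms(2)]] by auto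

lemma tens_zero [simp]:
  assumes "arr f" "X \<in> Ob C" "Y \<in> Ob C"
  shows "f \<odot> hzero C X Y = hzero C (dm f \<otimes> X) (cd f \<otimes> Y)"
    "hzero C X Y \<odot> f = hzero C (X \<otimes> dm f) (Y \<otimes> cd f)"
proof -
  have "f \<odot> hscale C 0 (hzero C X Y) = hzero C (dm f \<otimes> X) (cd f \<otimes> Y)"
    using assms by (subst tens_scale) (auto simp: scale_0)
  then show "f \<odot> hzero C X Y = hzero C (dm f \<otimes> X) (cd f \<otimes> Y)" using assms by simp
  have "hscale C 0 (hzero C X Y) \<odot> f = hzero C (X \<otimes> dm f) (Y \<otimes> cd f)"
    using assms by (subst tens_scale) (auto simp: scale_0)
  then show "hzero C X Y \<odot> f = hzero C (X \<otimes> dm f) (Y \<otimes> cd f)" using assms by simp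
qed

lemma tens_adj [simp]:
  assumes "arr f" "arr g"
  shows "adj C (f \<odot> g) = adj C f \<odot> adj C g"
  using tensA_adj[of "dm f" "cd f" "dm g" "cd g" f g] homD[OF arr_hom[OF assms(1)]]
    homD[OF arr_hom[OF assms(2)]] by auto

lemma unitaryD:
  assumes "unitary C X Y u" "X \<in> Ob C" "Y \<in> Ob C"
  shows "arr u" "dm u = X" "cd u = Y" "adj C u \<cdot> u = ident C X" "u \<cdot> adj C u = ident C Y"
    "arr g \<Longrightarrow> cd g = X \<Longrightarrow> adj C u \<cdot> u \<cdot> g = g"
    "arr g \<Longrightarrow> cd g = Y \<Longrightarrow> u \<cdot> adj C u \<cdot> g = g"
proof -
  show *: "arr u" "dm u = X" "cd u = Y" "adj C u \<cdot> u = ident C X" "u \<cdot> adj C u = ident C Y"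
    using assms homI[of u X Y] by (auto simp: hom_def unitary_def)
  show "adj C u \<cdot> u \<cdot> g = g" if "arr g" "cd g = X"
    using that * assoc_comp[of g u "adj C u"] by simp
  show "u \<cdot> adj C u \<cdot> g = g" if "arr g" "cd g = Y"
    using that * assoc_comp[of g "adj C u" u] by simp
qed

lemma assoc_arr [simp]:
  assumes "X \<in> Ob C" "Y \<in> Ob C" "Z \<in> Ob C"
  shows "arr (assoc C X Y Z)" "dm (assoc C X Y Z) = (X \<otimes> Y) \<otimes> Z" "cd (assoc C X Y Z) = X \<otimes> (Y \<otimes> Z)"
    "adj C (assoc C X Y Z) \<cdot> assoc C X Y Z = ident C ((X \<otimes> Y) \<otimes> Z)"
    "assoc C X Y Z \<cdot> adj C (assoc C X Y Z) = ident C (X \<otimes> (Y \<otimes> Z))"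
    "arr g \<Longrightarrow> cd g = (X \<otimes> Y) \<otimes> Z \<Longrightarrow> adj C (assoc C X Y Z) \<cdot> assoc C X Y Z \<cdot> g = g"
    "arr g \<Longrightarrow> cd g = X \<otimes> (Y \<otimes> Z) \<Longrightarrow> assoc C X Y Z \<cdot> adj C (assoc C X Y Z) \<cdot> g = g"
  using unitaryD[OF assoc_unitary[OF assms]] assms by simp_all

lemma lunit_arr [simp]:
  assumes "X \<in> Ob C"
  shows "arr (lunit C X)" "dm (lunit C X) = tunit C \<otimes> X" "cd (lunit C X) = X"
    "adj C (lunit C X) \<cdot> lunit C X = ident C (tunit C \<otimes> X)"
    "lunit C X \<cdot> adj C (lunit C X) = ident C X"
    "arr g \<Longrightarrow> cd g = tunit C \<otimes> X \<Longrightarrow> adj C (lunit C X) \<cdot> lunit C X \<cdot> g = g"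
    "arr g \<Longrightarrow> cd g = X \<Longrightarrow> lunit C X \<cdot> adj C (lunit C X) \<cdot> g = g"
  using unitaryD[OF lunit_unitary[OF assms]] assms by simp_all

lemma runit_arr [simp]:
  assumes "X \<in> Ob C"
  shows "arr (runit C X)" "dm (runit C X) = X \<otimes> tunit C" "cd (runit C X) = X"
    "adj C (runit C X) \<cdot> runit C X = ident C (X \<otimes> tunit C)"
    "runit C X \<cdot> adj C (runit C X) = ident C X"
    "arr g \<Longrightarrow> cd g = X \<otimes> tunit C \<Longrightarrow> adj C (runit C X) \<cdot> runit C X \<cdot> g = g"
    "arr g \<Longrightarrow> cd g = X \<Longrightarrow> runit C X \<cdot> adj C (runit C X) \<cdot> g = g"
  using unitaryD[OF runit_unitary[OF assms]] assms by simp_all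

lemma assoc_nat:
  assumes "arr f" "arr g" "arr h"
  shows "assoc C (cd f) (cd g) (cd h) \<cdot> ((f \<odot> g) \<odot> h) = (f \<odot> (g \<odot> h)) \<cdot> assoc C (dm f) (dm g) (dm
      h)"
  using assoc_natural assms homD[OF arr_hom[OF assms(1)]] homD[OF arr_hom[OF assms(2)]]
    homD[OF arr_hom[OF assms(3)]] by simp

lemma lunit_nat: "arr f \<Longrightarrow> lunit C (cd f) \<cdot> (ident C (tunit C) \<odot> f) = f \<cdot> lunit C (dm f)"
  using lunit_natural homD[OF arr_hom] by simp

lemma runit_nat: "arr f \<Longrightarrow> runit C (cd f) \<cdot> (f \<odot> ident C (tunit C)) = f \<cdot> runit C (dm f)"
  using runit_natural homD[OF arr_hom] by simp

lemma cancel_right: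
  assumes "arr f" "arr g" "arr u" "dm f = cd u" "dm g = cd u"
    "u \<cdot> adj C u = ident C (cd u)" "f \<cdot> u = g \<cdot> u"
  shows "f = g"
proof -
  have "f = f \<cdot> (u \<cdot> adj C u)" unfolding assms(6) using assms(1-5) by simp
  also have "\<dots> = (f \<cdot> u) \<cdot> adj C u" using assms(1-5) by simp
  also have "\<dots> = g \<cdot> (u \<cdot> adj C u)" unfolding assms(7) using assms(1-5) by simp
  also have "\<dots> = g" unfolding assms(6) using assms(1-5) by simp
  finally show ?thesis .
qed

text \<open>Naturality of the left unitor expresses f through its tensor product with the unit, and
  the unitor can be cancelled.\<close>

lemma tens_unit_faithful_left:
  assumes "arr f" "arr g" "dm f = dm g" "cd f = cd g"
    "ident C (tunit C) \<odot> f = ident C (tunit C) \<odot> g"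
  shows "f = g"
proof (rule cancel_right[of _ _ "lunit C (dm g)"])
  have "f \<cdot> lunit C (dm f) = g \<cdot> lunit C (dm g)"
    using lunit_nat[OF assms(1)] lunit_nat[OF assms(2)] assms(4,5) by simp
  then show "f \<cdot> lunit C (dm g) = g \<cdot> lunit C (dm g)" using assms(3) by simp
qed (use assms(1-4) in auto)

lemma tens_unit_faithful_right:
  assumes "arr f" "arr g" "dm f = dm g" "cd f = cd g"
    "f \<odot> ident C (tunit C) = g \<odot> ident C (tunit C)"
  shows "f = g"
proof (rule cancel_right[of _ _ "runit C (dm g)"])
  have "f \<cdot> runit C (dm f) = g \<cdot> runit C (dm g)"
    using runit_nat[OF assms(1)] runit_nat[OF assms(2)] assms(4,5) by simp
  then show "f \<cdot> runit C (dm g) = g \<cdot> runit C (dm g)" using assms(3) by simp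
qed (use assms(1-4) in auto)

text \<open>Kelly's observation: this triangle follows from \<open>pentagon\<close> and
  \<open>triangle\<close>. By faithfulness it suffices to compare both sides tensored with the unit
  I. There the pentagon for I, I, X, Y reduces the claim to \<open>triangle\<close> for the pairs
  (I, X \<otimes> Y) and (I, X).\<close>

lemma lunit_tens:
  assumes "X \<in> Ob C" "Y \<in> Ob C"
  shows "lunit C (X \<otimes> Y) \<cdot> assoc C (tunit C) X Y = lunit C X \<odot> ident C Y"
proof (rule tens_unit_faithful_left)
  let ?I = "tunit C"
  \<comment> \<open>The last two arrows of the three-arrow side of the pentagon; as a composite of
    unitaries it can be cancelled.\<close>
  let ?u = "assoc C ?I (?I \<otimes> X) Y \<cdot> (assoc C ?I ?I X \<odot> ident C Y)"
  show "ident C ?I \<odot> (lunit C (X \<otimes> Y) \<cdot> assoc C ?I X Y) = ident C ?I \<odot> (lunit C X \<odot> ident C Y)"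
  proof (rule cancel_right[of _ _ ?u])
    have "(ident C ?I \<odot> (lunit C (X \<otimes> Y) \<cdot> assoc C ?I X Y)) \<cdot> ?u =
       (ident C ?I \<odot> lunit C (X \<otimes> Y)) \<cdot> ((ident C ?I \<odot> assoc C ?I X Y) \<cdot> ?u)"
      using assms by simp
    also have "\<dots> = (ident C ?I \<odot> lunit C (X \<otimes> Y)) \<cdot> (assoc C ?I ?I (X \<otimes> Y) \<cdot> assoc C (?I \<otimes> ?I) X Y)"
      using pentagon[of ?I ?I X Y] assms by simp
    also have "\<dots> = ((ident C ?I \<odot> lunit C (X \<otimes> Y)) \<cdot> assoc C ?I ?I (X \<otimes> Y)) \<cdot> assoc C (?I \<otimes> ?I) X Y"
      using assms by simp
    also have "\<dots> = (runit C ?I \<odot> (ident C X \<odot> ident C Y)) \<cdot> assoc C (?I \<otimes> ?I) X Y"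
      using triangle[of ?I "X \<otimes> Y"] assms by simp
    also have "\<dots> = assoc C ?I X Y \<cdot> ((runit C ?I \<odot> ident C X) \<odot> ident C Y)"
      using assoc_nat[of "runit C ?I" "ident C X" "ident C Y"] assms by simp
    also have "\<dots> = assoc C ?I X Y \<cdot> (((ident C ?I \<odot> lunit C X) \<cdot> assoc C ?I ?I X) \<odot> ident C Y)"
      using triangle[of ?I X] assms by simp
    also have "\<dots> = (assoc C ?I X Y \<cdot> ((ident C ?I \<odot> lunit C X) \<odot> ident C Y)) \<cdot> (assoc C ?I ?I X \<odot>
        ident C Y)"
      using assms by simp
    also have "\<dots> = ((ident C ?I \<odot> (lunit C X \<odot> ident C Y)) \<cdot> assoc C ?I (?I \<otimes> X) Y) \<cdot> (assoc C ?I
        ?I X \<odot> ident C Y)"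
      using assoc_nat[of "ident C ?I" "lunit C X" "ident C Y"] assms by simp
    also have "\<dots> = (ident C ?I \<odot> (lunit C X \<odot> ident C Y)) \<cdot> ?u"
      using assms by simp
    finally show "(ident C ?I \<odot> (lunit C (X \<otimes> Y) \<cdot> assoc C ?I X Y)) \<cdot> ?u = (ident C ?I \<odot> (lunit C
        X \<odot> ident C Y)) \<cdot> ?u" .
  qed (use assms in auto)
qed (use assms in auto)

section \<open>Duality\<close>

lemma dual_pairD:
  assumes "dual_pair C X X' r s"
  shows "X \<in> Ob C" "X' \<in> Ob C" "arr r" "dm r = tunit C" "cd r = X' \<otimes> X"
    "arr s" "dm s = tunit C" "cd s = X \<otimes> X'"
    "lunit C X \<cdot> (adj C s \<odot> ident C X) \<cdot> adj C (assoc C X X' X) \<cdot>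
       (ident C X \<odot> r) \<cdot> adj C (runit C X) = ident C X"
    "lunit C X' \<cdot> (adj C r \<odot> ident C X') \<cdot> adj C (assoc C X' X X') \<cdot>
       (ident C X' \<odot> s) \<cdot> adj C (runit C X') = ident C X'"
  using assms homI[of r "tunit C" "X' \<otimes> X"] homI[of s "tunit C" "X \<otimes> X'"]
  unfolding dual_pair_def by (auto simp: hom_def)

lemma dual_pair_sym: "dual_pair C X X' r s \<Longrightarrow> dual_pair C X' X s r"
  unfolding dual_pair_def by simp

lemma dual_pair_zigzag_adj:
  assumes "dual_pair C X X' r s"
  shows "runit C X \<cdot> (ident C X \<odot> adj C r) \<cdot> assoc C X X' X \<cdot> (s \<odot> ident C X) \<cdot> adj C (lunit C X)
    = ident C X"
proof -
  note d = dual_pairD[OF assms]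
  have "adj C (lunit C X \<cdot> (adj C s \<odot> ident C X) \<cdot> adj C (assoc C X X' X) \<cdot>
       (ident C X \<odot> r) \<cdot> adj C (runit C X)) = ident C X"
    unfolding d(9) using d(1) by simp
  then show ?thesis using d(1-8) by simp
qed

text \<open>By \<open>transpose_inverse\<close>, transposition is one half of the adjunction between \<open>X' \<otimes> -\<close> and \<open>X \<otimes>
  -\<close>.\<close>

definition transpose where
  "transpose X' r X Y t =
     lunit C Y \<cdot> (adj C r \<odot> ident C Y) \<cdot> adj C (assoc C X' X Y) \<cdot> (ident C X' \<odot> t)"

lemma transpose_typed [simp]:
  assumes "arr r" "dm r = tunit C" "cd r = X' \<otimes> X" "arr t" "cd t = X \<otimes> Y"
    "X \<in> Ob C" "X' \<in> Ob C" "Y \<in> Ob C"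
  shows "arr (transpose X' r X Y t)" "dm (transpose X' r X Y t) = X' \<otimes> dm t"
    "cd (transpose X' r X Y t) = Y"
  using assms unfolding transpose_def by auto

text \<open>Once t is slid to the innermost position, what stands in front of it is the adjoint
  zigzag of X tensored with Y. Fact 3 (from the pentagon) and fact 7 (from
  \<open>lunit_tens\<close>) rebracket so that the zigzag acts on X alone.\<close>

lemma transpose_inverse:
  assumes dp: "dual_pair C X X' r s" and t: "arr t" "cd t = X \<otimes> Y" and Y: "Y \<in> Ob C"
  shows "(ident C X \<odot> transpose X' r X Y t) \<cdot> assoc C X X' (dm t) \<cdot> (s \<odot> ident C (dm t)) \<cdot>
    adj C (lunit C (dm t)) = t"
proof -
  note d = dual_pairD[OF dp]
  note [simp] = d(1-8) t Y
  let ?A = "dm t" and ?I = "tunit C"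
  have [simp]: "?A \<in> Ob C" using t by simp
  have 1: "(ident C X \<odot> (ident C X' \<odot> t)) \<cdot> assoc C X X' ?A = assoc C X X' (X \<otimes> Y) \<cdot> (ident C (X \<otimes>
      X') \<odot> t)"
    using assoc_nat[of "ident C X" "ident C X'" t] by simp
  have 2: "t \<cdot> lunit C ?A = lunit C (X \<otimes> Y) \<cdot> (ident C ?I \<odot> t)"
    using lunit_nat[of t] by simp
  have 22: "(ident C ?I \<odot> t) \<cdot> adj C (lunit C ?A) = adj C (lunit C (X \<otimes> Y)) \<cdot> t"
  proof -
    have "(ident C ?I \<odot> t) \<cdot> adj C (lunit C ?A) =
      adj C (lunit C (X \<otimes> Y)) \<cdot> (lunit C (X \<otimes> Y) \<cdot> (ident C ?I \<odot> t)) \<cdot> adj C (lunit C ?A)" by simp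
    also have "\<dots> = adj C (lunit C (X \<otimes> Y)) \<cdot> t" unfolding 2[symmetric] by simp
    finally show ?thesis .
  qed
  have 3: "(ident C X \<odot> adj C (assoc C X' X Y)) \<cdot> assoc C X X' (X \<otimes> Y) =
    assoc C X (X' \<otimes> X) Y \<cdot> (assoc C X X' X \<odot> ident C Y) \<cdot> adj C (assoc C (X \<otimes> X') X Y)"
  proof -
    have "(ident C X \<odot> adj C (assoc C X' X Y)) \<cdot> assoc C X X' (X \<otimes> Y) =
      (ident C X \<odot> adj C (assoc C X' X Y)) \<cdot> (assoc C X X' (X \<otimes> Y) \<cdot> assoc C (X \<otimes> X') X Y) \<cdot> adj C
          (assoc C (X \<otimes> X') X Y)"
      by simp
    also have "\<dots> = assoc C X (X' \<otimes> X) Y \<cdot> (assoc C X X' X \<odot> ident C Y) \<cdot> adj C (assoc C (X \<otimes> X') X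
        Y)"
      unfolding pentagon[OF d(1,2,1) Y] by simp
    finally show ?thesis .
  qed
  have 4: "(ident C X \<odot> (adj C r \<odot> ident C Y)) \<cdot> assoc C X (X' \<otimes> X) Y =
      assoc C X ?I Y \<cdot> ((ident C X \<odot> adj C r) \<odot> ident C Y)"
    using assoc_nat[of "ident C X" "adj C r" "ident C Y"] by simp
  have 5: "(ident C X \<odot> lunit C Y) \<cdot> assoc C X ?I Y = runit C X \<odot> ident C Y"
    using triangle by simp
  have 6: "adj C (assoc C (X \<otimes> X') X Y) \<cdot> (s \<odot> ident C (X \<otimes> Y)) =
      ((s \<odot> ident C X) \<odot> ident C Y) \<cdot> adj C (assoc C ?I X Y)"
  proof -
    have "adj C (assoc C (X \<otimes> X') X Y) \<cdot> (s \<odot> ident C (X \<otimes> Y)) =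
      adj C (assoc C (X \<otimes> X') X Y) \<cdot> ((s \<odot> (ident C X \<odot> ident C Y)) \<cdot> assoc C ?I X Y) \<cdot> adj C
          (assoc C ?I X Y)"
      by simp
    also have "\<dots> = adj C (assoc C (X \<otimes> X') X Y) \<cdot> (assoc C (X \<otimes> X') X Y \<cdot> ((s \<odot> ident C X) \<odot> ident
        C Y)) \<cdot> adj C (assoc C ?I X Y)"
      using assoc_nat[of s "ident C X" "ident C Y"] by simp
    also have "\<dots> = ((s \<odot> ident C X) \<odot> ident C Y) \<cdot> adj C (assoc C ?I X Y)"
      by simp
    finally show ?thesis .
  qed
  have 7: "adj C (assoc C ?I X Y) \<cdot> adj C (lunit C (X \<otimes> Y)) = adj C (lunit C X) \<odot> ident C Y"
    using arg_cong[OF lunit_tens[OF d(1) Y], of "adj C"] by simp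
  have "(ident C X \<odot> transpose X' r X Y t) =
     (ident C X \<odot> lunit C Y) \<cdot> (ident C X \<odot> (adj C r \<odot> ident C Y)) \<cdot>
     (ident C X \<odot> adj C (assoc C X' X Y)) \<cdot> (ident C X \<odot> (ident C X' \<odot> t))"
    unfolding transpose_def by simp
  then have "(ident C X \<odot> transpose X' r X Y t) \<cdot> assoc C X X' ?A \<cdot> (s \<odot> ident C ?A) \<cdot> adj C
      (lunit C ?A)
    = (ident C X \<odot> lunit C Y) \<cdot> (ident C X \<odot> (adj C r \<odot> ident C Y)) \<cdot>
     (ident C X \<odot> adj C (assoc C X' X Y)) \<cdot> ((ident C X \<odot> (ident C X' \<odot> t)) \<cdot> assoc C X X' ?A) \<cdot>
     (s \<odot> ident C ?A) \<cdot> adj C (lunit C ?A)" by simp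
  also have "\<dots> = (ident C X \<odot> lunit C Y) \<cdot> (ident C X \<odot> (adj C r \<odot> ident C Y)) \<cdot>
     ((ident C X \<odot> adj C (assoc C X' X Y)) \<cdot> assoc C X X' (X \<otimes> Y)) \<cdot>
     (s \<odot> ident C (X \<otimes> Y)) \<cdot> ((ident C ?I \<odot> t) \<cdot> adj C (lunit C ?A))"
    unfolding 1 by simp
  also have "\<dots> = (ident C X \<odot> lunit C Y) \<cdot> ((ident C X \<odot> (adj C r \<odot> ident C Y)) \<cdot>
     assoc C X (X' \<otimes> X) Y) \<cdot> (assoc C X X' X \<odot> ident C Y) \<cdot> (adj C (assoc C (X \<otimes> X') X Y) \<cdot>
     (s \<odot> ident C (X \<otimes> Y))) \<cdot> adj C (lunit C (X \<otimes> Y)) \<cdot> t"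
    unfolding 3 22 by simp
  also have "\<dots> = ((ident C X \<odot> lunit C Y) \<cdot> assoc C X ?I Y) \<cdot> ((ident C X \<odot> adj C r) \<odot> ident C Y) \<cdot>
      (assoc C X X' X \<odot> ident C Y) \<cdot> ((s \<odot> ident C X) \<odot> ident C Y) \<cdot>
      (adj C (assoc C ?I X Y) \<cdot> adj C (lunit C (X \<otimes> Y))) \<cdot> t"
    unfolding 4 6 by simp
  also have "\<dots> = ((runit C X \<cdot> (ident C X \<odot> adj C r) \<cdot> assoc C X X' X \<cdot> (s \<odot> ident C X) \<cdot> adj C
      (lunit C X)) \<odot> ident C Y) \<cdot> t"
    unfolding 5 7 by simp
  also have "\<dots> = t" unfolding dual_pair_zigzag_adj[OF dp] by simp
  finally show ?thesis .
qed

lemma transpose_inj: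
  assumes "dual_pair C X X' r s" "arr t" "cd t = X \<otimes> Y" "Y \<in> Ob C"
    "arr u" "cd u = X \<otimes> Y" "dm u = dm t" "transpose X' r X Y t = transpose X' r X Y u"
  shows "t = u"
  using transpose_inverse[OF assms(1-4)] transpose_inverse[OF assms(1,5,6,4), unfolded assms(7)
      assms(8)[symmetric]]
  by (rule trans[OF sym])

text \<open>The vector obtained by applying f to the second factor of s is the name of f. Sliding f
  past the associator and the evaluation leaves the zigzag identity of X', so f is recovered from
  its name.\<close>

lemma zigzag_naming:
  assumes dp: "dual_pair C X X' r s" and f: "arr f" "dm f = X'"
  shows "lunit C (cd f) \<cdot> (adj C r \<odot> ident C (cd f)) \<cdot> adj C (assoc C X' X (cd f)) \<cdot>
    (ident C X' \<odot> ((ident C X \<odot> f) \<cdot> s)) \<cdot> adj C (runit C X') = f"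
proof -
  note d = dual_pairD[OF dp]
  note [simp] = d(1-8) f
  let ?I = "tunit C"
  have [simp]: "cd f \<in> Ob C" by simp
  have "(ident C X' \<odot> (ident C X \<odot> f)) = assoc C X' X (cd f) \<cdot> (ident C (X' \<otimes> X) \<odot> f) \<cdot> adj C
      (assoc C X' X X')"
  proof -
    have "(ident C X' \<odot> (ident C X \<odot> f)) = ((ident C X' \<odot> (ident C X \<odot> f)) \<cdot> assoc C X' X X') \<cdot>
        adj C (assoc C X' X X')"
      by simp
    also have "\<dots> = (assoc C X' X (cd f) \<cdot> ((ident C X' \<odot> ident C X) \<odot> f)) \<cdot> adj C (assoc C X' X X')"
      using assoc_nat[of "ident C X'" "ident C X" f] by simp
    finally show ?thesis by simp
  qed
  then have 1: "(ident C X' \<odot> ((ident C X \<odot> f) \<cdot> s)) =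
     assoc C X' X (cd f) \<cdot> (ident C (X' \<otimes> X) \<odot> f) \<cdot> adj C (assoc C X' X X') \<cdot> (ident C X' \<odot> s)"
    using interchange[of "ident C X'" "ident C X'" s "ident C X \<odot> f"] by simp
  have 2: "(lunit C (cd f) \<cdot> (adj C r \<odot> ident C (cd f))) \<cdot> (ident C (X' \<otimes> X) \<odot> f) =
      f \<cdot> lunit C X' \<cdot> (adj C r \<odot> ident C X')"
  proof -
    have "(lunit C (cd f) \<cdot> (adj C r \<odot> ident C (cd f))) \<cdot> (ident C (X' \<otimes> X) \<odot> f) =
      (lunit C (cd f) \<cdot> (ident C ?I \<odot> f)) \<cdot> (adj C r \<odot> ident C X')" by simp
    also have "\<dots> = f \<cdot> lunit C X' \<cdot> (adj C r \<odot> ident C X')" unfolding lunit_nat[OF f(1)] by simp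
    finally show ?thesis .
  qed
  have "lunit C (cd f) \<cdot> (adj C r \<odot> ident C (cd f)) \<cdot> adj C (assoc C X' X (cd f)) \<cdot>
    (ident C X' \<odot> ((ident C X \<odot> f) \<cdot> s)) \<cdot> adj C (runit C X') =
    ((lunit C (cd f) \<cdot> (adj C r \<odot> ident C (cd f))) \<cdot> (ident C (X' \<otimes> X) \<odot> f)) \<cdot> adj C (assoc C X' X
        X') \<cdot> (ident C X' \<odot> s)
     \<cdot> adj C (runit C X')" unfolding 1 by simp
  also have "\<dots> = f \<cdot> (lunit C X' \<cdot> (adj C r \<odot> ident C X') \<cdot> adj C (assoc C X' X X') \<cdot> (ident C X'
      \<odot> s)
     \<cdot> adj C (runit C X'))" unfolding 2 by simp
  also have "\<dots> = f" unfolding d(10) by simp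
  finally show ?thesis .
qed

lemma naming_inj:
  assumes dp: "dual_pair C X X' r s" and f: "arr f" "dm f = X'" "arr g" "dm g = X'" "cd f = cd g"
    and "(ident C X \<odot> f) \<cdot> s = (ident C X \<odot> g) \<cdot> s"
  shows "f = g"
  using zigzag_naming[OF dp f(1,2), unfolded assms(6,7)] zigzag_naming[OF dp f(3,4)] by (rule
      trans[OF sym])

section \<open>Isomorphism and invertible objects\<close>

definition iso where "iso X Y \<longleftrightarrow> X \<in> Ob C \<and> Y \<in> Ob C \<and> isomorphic C X Y"

lemma iso_iff: "iso X Y \<longleftrightarrow> (\<exists>f g. hom f X Y \<and> hom g Y X \<and> g \<cdot> f = ident C X \<and> f \<cdot> g = ident C Y)"
  unfolding iso_def isomorphic_def by (auto simp: hom_iff)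

lemma isoE:
  assumes "iso X Y"
  obtains f g where "arr f" "dm f = X" "cd f = Y" "arr g" "dm g = Y" "cd g = X"
    "g \<cdot> f = ident C X" "f \<cdot> g = ident C Y" "X \<in> Ob C" "Y \<in> Ob C"
  using assms unfolding iso_iff by (metis hom_simps)

lemma isoI:
  assumes "arr f" "dm f = X" "cd f = Y" "arr g" "dm g = Y" "cd g = X"
    "g \<cdot> f = ident C X" "f \<cdot> g = ident C Y"
  shows "iso X Y"
  using assms unfolding iso_iff hom_def by blast

lemma iso_Ob: "iso X Y \<Longrightarrow> X \<in> Ob C" "iso X Y \<Longrightarrow> Y \<in> Ob C"
  by (auto simp: iso_def)

lemma iso_refl: "X \<in> Ob C \<Longrightarrow> iso X X"
  by (rule isoI[of "ident C X" _ _ "ident C X"]) auto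

lemma iso_sym: "iso X Y \<Longrightarrow> iso Y X"
  by (auto simp: iso_iff)

lemma iso_trans [trans]:
  assumes "iso X Y" "iso Y Z" shows "iso X Z"
proof -
  obtain f g where fg: "arr f" "dm f = X" "cd f = Y" "arr g" "dm g = Y" "cd g = X"
    "g \<cdot> f = ident C X" "f \<cdot> g = ident C Y" "X \<in> Ob C" "Y \<in> Ob C" by (rule isoE[OF assms(1)])
  obtain h k where hk: "arr h" "dm h = Y" "cd h = Z" "arr k" "dm k = Z" "cd k = Y"
    "k \<cdot> h = ident C Y" "h \<cdot> k = ident C Z" "Y \<in> Ob C" "Z \<in> Ob C" by (rule isoE[OF assms(2)])
  have "(g \<cdot> k) \<cdot> (h \<cdot> f) = g \<cdot> (k \<cdot> h) \<cdot> f" using fg(1-6) hk(1-6) by simp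
  also have "\<dots> = ident C X" using fg(1-6,8-) unfolding hk(7) by (simp add: fg(7))
  finally have 1: "(g \<cdot> k) \<cdot> (h \<cdot> f) = ident C X" .
  have "(h \<cdot> f) \<cdot> (g \<cdot> k) = h \<cdot> (f \<cdot> g) \<cdot> k" using fg(1-6) hk(1-6) by simp
  also have "\<dots> = ident C Z" using hk(1-7,9-) unfolding fg(8) by (simp add: hk(8))
  finally have 2: "(h \<cdot> f) \<cdot> (g \<cdot> k) = ident C Z" .
  show ?thesis by (rule isoI[OF _ _ _ _ _ _ 1 2]) (use fg(1-6) hk(1-6) in auto)
qed

lemma iso_tens:
  assumes "iso X Y" "iso X' Y'" shows "iso (X \<otimes> X') (Y \<otimes> Y')"
proof -
  obtain f g where fg: "arr f" "dm f = X" "cd f = Y" "arr g" "dm g = Y" "cd g = X"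
    "g \<cdot> f = ident C X" "f \<cdot> g = ident C Y" "X \<in> Ob C" "Y \<in> Ob C" by (rule isoE[OF assms(1)])
  obtain h k where hk: "arr h" "dm h = X'" "cd h = Y'" "arr k" "dm k = Y'" "cd k = X'"
    "k \<cdot> h = ident C X'" "h \<cdot> k = ident C Y'" "X' \<in> Ob C" "Y' \<in> Ob C" by (rule isoE[OF assms(2)])
  show ?thesis by (rule isoI[of "f \<odot> h" _ _ "g \<odot> k"]) (use fg hk in simp_all)
qed

lemma unitary_iso:
  assumes "unitary C X Y u" "X \<in> Ob C" "Y \<in> Ob C" shows "iso X Y"
  using unitaryD[OF assms] assms(2,3) by (intro isoI[of u _ _ "adj C u"]) auto

lemma iso_assoc: "X \<in> Ob C \<Longrightarrow> Y \<in> Ob C \<Longrightarrow> Z \<in> Ob C \<Longrightarrow> iso ((X \<otimes> Y) \<otimes> Z) (X \<otimes> (Y \<otimes> Z))"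
  by (rule unitary_iso[OF assoc_unitary]) auto

lemma iso_lunit: "X \<in> Ob C \<Longrightarrow> iso (tunit C \<otimes> X) X"
  by (rule unitary_iso[OF lunit_unitary]) auto

lemma iso_runit: "X \<in> Ob C \<Longrightarrow> iso (X \<otimes> tunit C) X"
  by (rule unitary_iso[OF runit_unitary]) auto

lemma simpleD:
  assumes "simple C X"
  shows "X \<in> Ob C" "ident C X \<noteq> hzero C X X"
    "arr f \<Longrightarrow> dm f = X \<Longrightarrow> cd f = X \<Longrightarrow> \<exists>k. f = hscale C k (ident C X)"
  using assms homD(1)[OF arr_hom[of f]] unfolding simple_def by auto

lemma simpleI:
  assumes "X \<in> Ob C" "ident C X \<noteq> hzero C X X"
    "\<And>f. arr f \<Longrightarrow> dm f = X \<Longrightarrow> cd f = X \<Longrightarrow> \<exists>k. f = hscale C k (ident C X)"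
  shows "simple C X"
proof -
  have "f \<in> Hom C X X \<Longrightarrow> \<exists>k. f = hscale C k (ident C X)" for f
    using assms(3)[of f] homI[of f X X] assms(1) by (auto simp: hom_def)
  moreover have "hscale C k (ident C X) \<in> Hom C X X" for k
    using assms(1) hscale_in ident_in by blast
  ultimately show ?thesis using assms(1,2) unfolding simple_def by blast
qed

lemma simple_iso:
  assumes "simple C X" "iso X Y" shows "simple C Y"
proof -
  obtain u v where uv: "arr u" "dm u = X" "cd u = Y" "arr v" "dm v = Y" "cd v = X"
    "v \<cdot> u = ident C X" "u \<cdot> v = ident C Y" "X \<in> Ob C" "Y \<in> Ob C" by (rule isoE[OF assms(2)])
  show ?thesis
  proof (rule simpleI)
    show "ident C Y \<noteq> hzero C Y Y"
    proof
      assume "ident C Y = hzero C Y Y"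
      then have "v \<cdot> ident C Y \<cdot> u = hzero C X X" using uv(1-6,9,10) by simp
      then show False using simpleD(2)[OF assms(1)] uv by simp
    qed
    fix f assume f: "arr f" "dm f = Y" "cd f = Y"
    obtain k where k: "v \<cdot> f \<cdot> u = hscale C k (ident C X)"
      using simpleD(3)[OF assms(1), of "v \<cdot> f \<cdot> u"] f uv(1-6) by auto
    have "f = (u \<cdot> v) \<cdot> f \<cdot> (u \<cdot> v)" unfolding uv(8) using f by simp
    also have "\<dots> = u \<cdot> (v \<cdot> f \<cdot> u) \<cdot> v" using f uv(1-6) by simp
    also have "\<dots> = hscale C k (ident C Y)" unfolding k using uv by simp
    finally show "\<exists>k. f = hscale C k (ident C Y)" by blast
  qed (rule uv)
qed

text \<open>A one-sided inverse is enough, since the braiding will supply the other side.\<close>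

definition invertible where
  "invertible X \<longleftrightarrow> X \<in> Ob C \<and> (\<exists>Y \<in> Ob C. iso (X \<otimes> Y) (tunit C))"

lemma invertible_iso: "invertible X \<Longrightarrow> iso X Y \<Longrightarrow> invertible Y"
  unfolding invertible_def by (meson iso_Ob iso_refl iso_sym iso_tens iso_trans)

lemma invertible_unit: "invertible (tunit C)"
  unfolding invertible_def using iso_lunit[OF tunit_Ob] by auto

text \<open>Tensoring further with Z and conjugating by the isomorphism of Y \<otimes> Z with the
  unit turns the hypothesis into equality after tensoring with the unit, where faithfulness is
  known.\<close>

lemma tens_invertible_faithful:
  assumes f: "arr f" "arr g" "dm f = dm g" "cd f = cd g"
    and Y: "Y \<in> Ob C" "Z \<in> Ob C" "iso (Y \<otimes> Z) (tunit C)"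
    and eq: "f \<odot> ident C Y = g \<odot> ident C Y"
  shows "f = g"
proof (rule tens_unit_faithful_right[OF f])
  let ?I = "tunit C"
  obtain u v where uv: "arr u" "dm u = Y \<otimes> Z" "cd u = ?I" "arr v" "dm v = ?I" "cd v = Y \<otimes> Z"
    "v \<cdot> u = ident C (Y \<otimes> Z)" "u \<cdot> v = ident C ?I" by (rule isoE[OF Y(3)])
  have YZ: "h \<odot> ident C (Y \<otimes> Z) = assoc C (cd h) Y Z \<cdot> ((h \<odot> ident C Y) \<odot> ident C Z) \<cdot> adj C
      (assoc C (dm h) Y Z)"
    if "arr h" for h
  proof -
    have "h \<odot> ident C (Y \<otimes> Z) = ((h \<odot> (ident C Y \<odot> ident C Z)) \<cdot> assoc C (dm h) Y Z) \<cdot> adj C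
        (assoc C (dm h) Y Z)"
      using that Y by simp
    also have "\<dots> = (assoc C (cd h) Y Z \<cdot> ((h \<odot> ident C Y) \<odot> ident C Z)) \<cdot> adj C (assoc C (dm h) Y
        Z)"
      using assoc_nat[of h "ident C Y" "ident C Z"] that Y by simp
    finally show ?thesis using that Y by simp
  qed
  have I: "h \<odot> ident C ?I = (ident C (cd h) \<odot> u) \<cdot> (h \<odot> ident C (Y \<otimes> Z)) \<cdot> (ident C (dm h) \<odot> v)"
    if "arr h" for h
    using that uv Y by simp
  show "f \<odot> ident C ?I = g \<odot> ident C ?I"
    unfolding I[OF f(1)] I[OF f(2)] YZ[OF f(1)] YZ[OF f(2)] eq f(3,4) ..
qed

end

context unitary_braided_category
begin

lemma braid_arr [simp]:
  assumes "X \<in> Ob C" "Y \<in> Ob C"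
  shows "arr (braid C X Y)" "dm (braid C X Y) = X \<otimes> Y" "cd (braid C X Y) = Y \<otimes> X"
    "adj C (braid C X Y) \<cdot> braid C X Y = ident C (X \<otimes> Y)"
    "braid C X Y \<cdot> adj C (braid C X Y) = ident C (Y \<otimes> X)"
    "arr g \<Longrightarrow> cd g = X \<otimes> Y \<Longrightarrow> adj C (braid C X Y) \<cdot> braid C X Y \<cdot> g = g"
    "arr g \<Longrightarrow> cd g = Y \<otimes> X \<Longrightarrow> braid C X Y \<cdot> adj C (braid C X Y) \<cdot> g = g"
  using unitaryD[OF braid_unitary[OF assms]] assms by simp_all

lemma braid_nat:
  assumes "arr f" "arr g"
  shows "braid C (cd f) (cd g) \<cdot> (f \<odot> g) = (g \<odot> f) \<cdot> braid C (dm f) (dm g)"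
  using braid_natural homD[OF arr_hom[OF assms(1)]] homD[OF arr_hom[OF assms(2)]] by simp

lemma iso_braid: "X \<in> Ob C \<Longrightarrow> Y \<in> Ob C \<Longrightarrow> iso (X \<otimes> Y) (Y \<otimes> X)"
  by (rule unitary_iso[OF braid_unitary]) auto

lemma invertible_inverse:
  assumes "X \<in> Ob C" "Y \<in> Ob C" "iso (X \<otimes> Y) (tunit C)" shows "invertible Y"
  using assms iso_trans[OF iso_braid[of Y X]] unfolding invertible_def by blast

lemma invertible_tens:
  assumes "invertible X" "invertible X'" shows "invertible (X \<otimes> X')"
proof -
  from assms obtain Y Y' where Y: "X \<in> Ob C" "Y \<in> Ob C" "iso (X \<otimes> Y) (tunit C)"
    "X' \<in> Ob C" "Y' \<in> Ob C" "iso (X' \<otimes> Y') (tunit C)" unfolding invertible_def by blast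
  have "iso ((X \<otimes> X') \<otimes> (Y' \<otimes> Y)) (X \<otimes> (X' \<otimes> (Y' \<otimes> Y)))" using iso_assoc Y by simp
  also have "iso \<dots> (X \<otimes> ((X' \<otimes> Y') \<otimes> Y))"
    using Y by (intro iso_tens[OF iso_refl iso_sym[OF iso_assoc]]) auto
  also have "iso \<dots> (X \<otimes> (tunit C \<otimes> Y))"
    using Y by (intro iso_tens iso_refl) auto
  also have "iso \<dots> (X \<otimes> Y)"
    using Y by (intro iso_tens iso_refl iso_lunit) auto
  also note Y(3)
  finally show ?thesis using Y unfolding invertible_def by auto
qed

text \<open>Tensor with an inverse Z of Y: every W is isomorphic to (W \<otimes> Y) \<otimes>
  Z.\<close>

lemma iso_cancel_right:
  assumes "invertible Y" "iso (X \<otimes> Y) (X' \<otimes> Y)" "X \<in> Ob C" "X' \<in> Ob C"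
  shows "iso X X'"
proof -
  from assms(1) obtain Z where Z: "Y \<in> Ob C" "Z \<in> Ob C" "iso (Y \<otimes> Z) (tunit C)"
    unfolding invertible_def by blast
  have *: "iso W ((W \<otimes> Y) \<otimes> Z)" if W: "W \<in> Ob C" for W
  proof -
    have "iso ((W \<otimes> Y) \<otimes> Z) (W \<otimes> (Y \<otimes> Z))" using iso_assoc W Z by simp
    also have "iso \<dots> (W \<otimes> tunit C)" using W Z by (intro iso_tens iso_refl) auto
    also have "iso \<dots> W" using W by (rule iso_runit)
    finally show ?thesis by (rule iso_sym)
  qed
  have "iso ((X \<otimes> Y) \<otimes> Z) ((X' \<otimes> Y) \<otimes> Z)"
    by (rule iso_tens[OF assms(2) iso_refl[OF Z(2)]])
  from iso_trans[OF iso_trans[OF *[OF assms(3)] this] iso_sym[OF *[OF assms(4)]]]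
  show ?thesis .
qed

end

context unitary_braided_fusion_category
begin

text \<open>Tensoring with Y embeds the endomorphisms of X into those of X \<otimes> Y, which is
  isomorphic to the unit and hence simple. An endomorphism that becomes a scalar there was one
  before, by faithfulness.\<close>

lemma invertible_simple:
  assumes "invertible X" shows "simple C X"
proof -
  from assms obtain Y where Y: "X \<in> Ob C" "Y \<in> Ob C" "iso (X \<otimes> Y) (tunit C)"
    unfolding invertible_def by blast
  have YX: "iso (Y \<otimes> X) (tunit C)" using iso_trans[OF iso_braid] Y by blast
  have S: "simple C (X \<otimes> Y)" using simple_iso[OF tunit_simple iso_sym[OF Y(3)]] .
  show ?thesis
  proof (rule simpleI)
    show "ident C X \<noteq> hzero C X X"
    proof
      assume "ident C X = hzero C X X"
      then have "ident C X \<odot> ident C Y = hzero C (X \<otimes> Y) (X \<otimes> Y)" using Y by (simp del: tens_ident)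
      then show False using simpleD(2)[OF S] Y by simp
    qed
    fix f assume f: "arr f" "dm f = X" "cd f = X"
    obtain k where "f \<odot> ident C Y = hscale C k (ident C (X \<otimes> Y))"
      using simpleD(3)[OF S, of "f \<odot> ident C Y"] f Y by auto
    then have "f \<odot> ident C Y = hscale C k (ident C X) \<odot> ident C Y" using Y by simp
    from tens_invertible_faithful[OF _ _ _ _ Y(2) Y(1) YX this]
    have "f = hscale C k (ident C X)" using f Y by simp
    then show "\<exists>k. f = hscale C k (ident C X)" by blast
  qed (rule Y)
qed

text \<open>If \<open>f\<^sup>* f = k\<close> with \<open>k < 0\<close>, then the column with entries \<open>f\<close> and \<open>sqrt (- k)\<close> in a direct sum
  violates \<open>adj_positive\<close>.\<close>

lemma positive_scalar:
  assumes f: "arr f" "dm f = X" and X: "ident C X \<noteq> hzero C X X"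
    and k: "adj C f \<cdot> f = hscale C k (ident C X)"
  shows "\<exists>x\<ge>0. k = complex_of_real x"
proof -
  let ?B = "cd f"
  have Ob [simp]: "X \<in> Ob C" "?B \<in> Ob C" using f by auto
  note [simp] = f
  have "adj C (adj C f \<cdot> f) = adj C f \<cdot> f" by simp
  then have "hscale C (cnj k) (ident C X) = hscale C k (ident C X)" unfolding k by simp
  then have "cnj k = k" using scale_inj[of "ident C X"] X by simp
  then obtain x where x: "k = complex_of_real x" by (metis Reals_cases complex_is_Real_iff
      Reals_cnj_iff)
  have "x \<ge> 0"
  proof (rule ccontr)
    assume neg: "\<not> x \<ge> 0"
    obtain Z S p where Z: "S 0 = ?B" "S 1 = X" "direct_sum C 2 S p Z"
      using binary_sums[OF Ob(2) Ob(1)] by blast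
    have H: "hom (p 0) ?B Z" "hom (p 1) X Z"
      using Z unfolding direct_sum_def by (auto simp: hom_iff less_2_cases_iff)
    note p = hom_simps[OF H(1)] hom_simps[OF H(2)]
    note [simp] = p(1-3,5-8)
    have pp: "adj C (p 0) \<cdot> p 0 = ident C ?B" "adj C (p 1) \<cdot> p 1 = ident C X"
      "adj C (p 0) \<cdot> p 1 = hzero C X ?B" "adj C (p 1) \<cdot> p 0 = hzero C ?B X"
      using Z unfolding direct_sum_def by (auto simp: less_2_cases_iff)
    have pq: "adj C (p 0) \<cdot> p 0 \<cdot> f = f" "adj C (p 1) \<cdot> p 0 \<cdot> f = hzero C X X"
      using assoc_comp[of f "p 0" "adj C (p 0)"] assoc_comp[of f "p 0" "adj C (p 1)"] by (simp_all
          add: pp del: assoc_comp One_nat_def)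
    define m where "m = complex_of_real (sqrt (- x))"
    have m: "m * m = - k" "cnj m = m" "m \<noteq> 0" using neg unfolding m_def x by (auto simp flip:
        of_real_mult)
    let ?g = "hadd C (p 0 \<cdot> f) (hscale C m (p 1))"
    have "adj C ?g \<cdot> ?g = hadd C (hadd C (hscale C k (ident C X)) (hzero C X X))
       (hscale C m (hadd C (hzero C X X) (hscale C m (ident C X))))"
      by (simp del: One_nat_def add: adj_add' add_comp comp_add k pp pq m)
    also have "\<dots> = hzero C X X"
      using scale_add_left[of "ident C X" k "-k"]
      by (simp add: m scale_0)
    finally have "?g = hzero C X Z" using adj_comp_zero[of ?g] by (simp del: One_nat_def)
    then have "adj C (p 1) \<cdot> ?g = hzero C X X" by (simp del: One_nat_def)
    moreover have "adj C (p 1) \<cdot> ?g = hadd C (hzero C X X) (hscale C m (ident C X))"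
      by (simp del: One_nat_def add: add_comp pp pq)
    ultimately have "hscale C m (ident C X) = hzero C X X" by simp
    then show False using scale_eq_zero[of "ident C X" m] m X by simp
  qed
  then show ?thesis using x by blast
qed

text \<open>On a simple domain \<open>adj C f \<cdot> f\<close> is a scalar;
  \<open>positive_scalar\<close> makes it real and nonnegative, and \<open>adj_comp_zero\<close>
  excludes 0 for nonzero f.\<close>

lemma simple_norm:
  assumes "simple C X" "arr f" "dm f = X"
  shows "\<exists>x\<ge>0. adj C f \<cdot> f = hscale C (complex_of_real x) (ident C X) \<and>
    (f \<noteq> hzero C X (cd f) \<longrightarrow> x > 0)"
proof -
  obtain k where k: "adj C f \<cdot> f = hscale C k (ident C X)"
    using simpleD(3)[OF assms(1), of "adj C f \<cdot> f"] assms by auto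
  then obtain x where x: "x \<ge> 0" "k = complex_of_real x"
    using positive_scalar[OF assms(2,3) simpleD(2)[OF assms(1)] k] by blast
  have "f = hzero C X (cd f)" if "x = 0"
    using adj_comp_zero[OF assms(2)] assms k x that simpleD(1)[OF assms(1)] by (simp add: scale_0)
  then have "f \<noteq> hzero C X (cd f) \<longrightarrow> x > 0" using x(1) by (cases "x = 0") simp_all
  then show ?thesis using k x by blast
qed

section \<open>Quantum dimensions\<close>

text \<open>If r or s vanished, the zigzag identity of X would read
  \<open>hzero C X X = ident C X\<close>.\<close>

lemma dual_pair_nonzero:
  assumes "simple C X" "dual_pair C X X' r s"
  shows "r \<noteq> hzero C (tunit C) (X' \<otimes> X)" "s \<noteq> hzero C (tunit C) (X \<otimes> X')"
proof -
  note d = dual_pairD[OF assms(2)]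
  show "r \<noteq> hzero C (tunit C) (X' \<otimes> X)"
  proof
    assume r: "r = hzero C (tunit C) (X' \<otimes> X)"
    have "hzero C X X = ident C X" using d(9) d(1,2,6-8) unfolding r by simp
    then show False using simpleD(2)[OF assms(1)] by simp
  qed
  show "s \<noteq> hzero C (tunit C) (X \<otimes> X')"
  proof
    assume r: "s = hzero C (tunit C) (X \<otimes> X')"
    have "hzero C X X = ident C X" using d(9) d(1-5) unfolding r by simp
    then show False using simpleD(2)[OF assms(1)] by simp
  qed
qed

text \<open>Transposition along s embeds the arrows I \<rightarrow> X' \<otimes> X into the
  endomorphisms of X, which are scalars; by the zigzag identity r itself goes to the
  identity.\<close>

lemma hom_unit_dual_left:
  assumes X: "simple C X" and dp: "dual_pair C X X' r s"
    and t: "arr t" "dm t = tunit C" "cd t = X' \<otimes> X"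
  shows "\<exists>k. t = hscale C k r"
proof -
  note d = dual_pairD[OF dp]
  note [simp] = d(1-8) t
  have r: "transpose X s X' X r \<cdot> adj C (runit C X) = ident C X"
    unfolding transpose_def using d(9) by simp
  obtain k where k: "transpose X s X' X t \<cdot> adj C (runit C X) = hscale C k (ident C X)"
    using simpleD(3)[OF X, of "transpose X s X' X t \<cdot> adj C (runit C X)"] by auto
  have "transpose X s X' X (hscale C k r) = hscale C k (transpose X s X' X r)"
    unfolding transpose_def by simp
  then have "transpose X s X' X t \<cdot> adj C (runit C X) = transpose X s X' X (hscale C k r) \<cdot> adj C
      (runit C X)"
    using k r by simp
  then have "transpose X s X' X t = transpose X s X' X (hscale C k r)"
    by (rule cancel_right[rotated -1]) simp_all
  then have "t = hscale C k r"
    by (rule transpose_inj[OF dual_pair_sym[OF dp], rotated -1]) simp_all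
  then show ?thesis ..
qed

text \<open>The mirrored argument would land in the endomorphisms of X', which are not yet known to
  be scalars: \<open>simple_dual\<close> is derived from this lemma. The braiding moves the problem
  to X' \<otimes> X instead.\<close>

lemma hom_unit_dual_right:
  assumes X: "simple C X" and dp: "dual_pair C X X' r s"
    and t: "arr t" "dm t = tunit C" "cd t = X \<otimes> X'"
  shows "\<exists>k. t = hscale C k s"
proof -
  note d = dual_pairD[OF dp]
  note [simp] = d(1-8) t
  let ?b = "braid C X X'"
  obtain k where "?b \<cdot> t = hscale C k r" using hom_unit_dual_left[OF X dp, of "?b \<cdot> t"] by auto
  then have "adj C ?b \<cdot> ?b \<cdot> t = hscale C k (adj C ?b \<cdot> r)" by (simp del: braid_arr(6))
  then have k: "t = hscale C k (adj C ?b \<cdot> r)" by simp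
  obtain l where "?b \<cdot> s = hscale C l r" using hom_unit_dual_left[OF X dp, of "?b \<cdot> s"] by auto
  then have "adj C ?b \<cdot> ?b \<cdot> s = hscale C l (adj C ?b \<cdot> r)" by (simp del: braid_arr(6))
  then have l: "s = hscale C l (adj C ?b \<cdot> r)" by simp
  have "l \<noteq> 0" using l dual_pair_nonzero(2)[OF X dp] by (auto simp: scale_0)
  have "hscale C (k / l) s = t" by (subst l, subst k) (simp add: \<open>l \<noteq> 0\<close>)
  then show ?thesis by metis
qed

text \<open>The name of an endomorphism of X' is an arrow from the unit to X \<otimes> X', hence a
  multiple of s, the name of the identity; names are injective.\<close>

lemma simple_dual:
  assumes X: "simple C X" and dp: "dual_pair C X X' r s"
  shows "simple C X'"
proof -
  note d = dual_pairD[OF dp]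
  note [simp] = d(1-8)
  show ?thesis
  proof (rule simpleI)
    show "ident C X' \<noteq> hzero C X' X'"
    proof
      assume "ident C X' = hzero C X' X'"
      then have "(ident C X \<odot> ident C X') \<cdot> s = hzero C (tunit C) (X \<otimes> X')" by (simp del:
          tens_ident)
      then show False using dual_pair_nonzero(2)[OF X dp] by simp
    qed
    fix f assume f: "arr f" "dm f = X'" "cd f = X'"
    obtain k where "(ident C X \<odot> f) \<cdot> s = hscale C k s"
      using hom_unit_dual_right[OF X dp, of "(ident C X \<odot> f) \<cdot> s"] f by auto
    then have "(ident C X \<odot> f) \<cdot> s = (ident C X \<odot> hscale C k (ident C X')) \<cdot> s" by simp
    then have "f = hscale C k (ident C X')"
      by (rule naming_inj[OF dp, rotated -1]) (use f in simp_all)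
    then show "\<exists>k. f = hscale C k (ident C X')" ..
  qed simp
qed

lemma unit_nonzero: "ident C (tunit C) \<noteq> hzero C (tunit C) (tunit C)"
  using simpleD(2)[OF tunit_simple] .

lemma unit_scale_inj: "hscale C k (ident C (tunit C)) = hscale C l (ident C (tunit C)) \<Longrightarrow> k = l"
  using scale_inj[of "ident C (tunit C)"] unit_nonzero by simp

lemma dual_pair_norms:
  assumes "simple C X" "dual_pair C X X' r s"
  obtains a b where "a > 0" "b > 0" "adj C r \<cdot> r = hscale C (complex_of_real a) (ident C (tunit C))"
    "adj C s \<cdot> s = hscale C (complex_of_real b) (ident C (tunit C))"
  using simple_norm[OF tunit_simple, of r] simple_norm[OF tunit_simple, of s]
    dual_pairD[OF assms(2)] dual_pair_nonzero[OF assms] by metis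

text \<open>A nonzero vector of X \<otimes> Y transposes to a nonzero arrow from X' to Y, and X' is
  simple. This compares a dual of X with any other candidate Y, be it a second dual or an
  inverse.\<close>

lemma dual_hom_nonzero:
  assumes X: "simple C X" and dp: "dual_pair C X X' r s"
    and t: "arr t" "dm t = tunit C" "cd t = X \<otimes> Y" "Y \<in> Ob C" "t \<noteq> hzero C (tunit C) (X \<otimes> Y)"
  obtains f x where "arr f" "dm f = X'" "cd f = Y" "x > 0"
    "adj C f \<cdot> f = hscale C (complex_of_real x) (ident C X')"
proof -
  note d = dual_pairD[OF dp]
  note [simp] = d(1-8) t(1-4)
  let ?f = "transpose X' r X Y t \<cdot> adj C (runit C X')"
  have "?f \<noteq> hzero C X' Y"
  proof
    assume "?f = hzero C X' Y"
    then have "?f = hzero C (X' \<otimes> tunit C) Y \<cdot> adj C (runit C X')" by simp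
    then have "transpose X' r X Y t = hzero C (X' \<otimes> tunit C) Y"
      by (rule cancel_right[rotated -1]) simp_all
    then show False using transpose_inverse[OF dp t(1,3,4)] t(5) by simp
  qed
  then show thesis using that[of ?f] simple_norm[OF simple_dual[OF X dp], of ?f] by auto
qed

text \<open>Two duals are related by a map \<open>f\<close> that carries \<open>s\<close> to a multiple \<open>k s\<^sub>2\<close> and \<open>r\<close> to a
  multiple \<open>l r\<^sub>2\<close>. The norms of these vectors give \<open>\<bar>k\<bar> = \<bar>l\<bar>\<close>, and the zigzag identities give
  \<open>k\<^sup>* l = f\<^sup>* f\<close>.\<close>

lemma standard_dim_unique:
  assumes X: "simple C X"
    and 1: "standard_dual C X X' r s" "adj C s \<cdot> s = hscale C d1 (ident C (tunit C))"
    and 2: "standard_dual C X X'' r2 s2" "adj C s2 \<cdot> s2 = hscale C d2 (ident C (tunit C))"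
  shows "d1 = d2"
proof -
  let ?I = "tunit C"
  have dp1: "dual_pair C X X' r s" and r1: "adj C r \<cdot> r = hscale C d1 (ident C ?I)"
    using 1 unfolding standard_dual_def by auto
  have dp2: "dual_pair C X X'' r2 s2" and r2: "adj C r2 \<cdot> r2 = hscale C d2 (ident C ?I)"
    using 2 unfolding standard_dual_def by auto
  note d = dual_pairD[OF dp1] and e = dual_pairD[OF dp2]
  note [simp] = d(1-8) e(2-8)
  obtain f x where f: "arr f" "dm f = X'" "cd f = X''" "x > 0"
    and ff: "adj C f \<cdot> f = hscale C (complex_of_real x) (ident C X')"
    using dual_hom_nonzero[OF X dp1 _ _ _ _ dual_pair_nonzero(2)[OF X dp2]] by auto
  note [simp] = f(1-3)
  obtain k where k: "(ident C X \<odot> f) \<cdot> s = hscale C k s2"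
    using hom_unit_dual_right[OF X dp2, of "(ident C X \<odot> f) \<cdot> s"] by auto
  obtain l where l: "(f \<odot> ident C X) \<cdot> r = hscale C l r2"
    using hom_unit_dual_left[OF X dp2, of "(f \<odot> ident C X) \<cdot> r"] by auto
  have "adj C ((ident C X \<odot> f) \<cdot> s) \<cdot> ((ident C X \<odot> f) \<cdot> s) = adj C s \<cdot> (ident C X \<odot> (adj C f \<cdot>
      f)) \<cdot> s" by simp
  also have "\<dots> = hscale C (x * d1) (ident C ?I)" unfolding ff by (simp add: 1(2))
  finally have "hscale C (cnj k * k * d2) (ident C ?I) = hscale C (x * d1) (ident C ?I)"
    unfolding k by (simp add: 2(2) mult_ac)
  then have kd: "cnj k * k * d2 = x * d1" by (rule unit_scale_inj)
  have "adj C ((f \<odot> ident C X) \<cdot> r) \<cdot> ((f \<odot> ident C X) \<cdot> r) = adj C r \<cdot> ((adj C f \<cdot> f) \<odot> ident C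
      X) \<cdot> r" by simp
  also have "\<dots> = hscale C (x * d1) (ident C ?I)" unfolding ff by (simp add: r1)
  finally have "hscale C (cnj l * l * d2) (ident C ?I) = hscale C (x * d1) (ident C ?I)"
    unfolding l by (simp add: r2 mult_ac)
  then have ld: "cnj l * l * d2 = x * d1" by (rule unit_scale_inj)
  have nat: "adj C (assoc C X X'' X) \<cdot> (ident C X \<odot> (f \<odot> ident C X)) = ((ident C X \<odot> f) \<odot> ident C
      X) \<cdot> adj C (assoc C X X' X)"
  proof -
    have "adj C (assoc C X X'' X) \<cdot> (ident C X \<odot> (f \<odot> ident C X)) =
      adj C (assoc C X X'' X) \<cdot> ((ident C X \<odot> (f \<odot> ident C X)) \<cdot> assoc C X X' X) \<cdot> adj C (assoc C
          X X' X)" by simp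
    also have "\<dots> = adj C (assoc C X X'' X) \<cdot> (assoc C X X'' X \<cdot> ((ident C X \<odot> f) \<odot> ident C X)) \<cdot>
        adj C (assoc C X X' X)"
      using assoc_nat[of "ident C X" f "ident C X"] by simp
    finally show ?thesis by simp
  qed
  have "hscale C (cnj k * l) (ident C X) = lunit C X \<cdot> (adj C (hscale C k s2) \<odot> ident C X) \<cdot> adj C
      (assoc C X X'' X) \<cdot>
       (ident C X \<odot> hscale C l r2) \<cdot> adj C (runit C X)"
    by (simp add: e(9) mult.commute)
  also have "\<dots> = lunit C X \<cdot> ((adj C s \<cdot> (ident C X \<odot> adj C f)) \<odot> ident C X) \<cdot> (adj C (assoc C X
      X'' X) \<cdot>
       (ident C X \<odot> (f \<odot> ident C X))) \<cdot> (ident C X \<odot> r) \<cdot> adj C (runit C X)"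
    unfolding k[symmetric] l[symmetric] by simp
  also have "\<dots> = lunit C X \<cdot> ((adj C s \<cdot> (ident C X \<odot> (adj C f \<cdot> f))) \<odot> ident C X) \<cdot> adj C (assoc
      C X X' X) \<cdot>
      (ident C X \<odot> r) \<cdot> adj C (runit C X)"
    unfolding nat by simp
  also have "\<dots> = hscale C x (ident C X)" unfolding ff by (simp add: d(9))
  finally have kl: "cnj k * l = x" using scale_inj[of "ident C X"] simpleD(2)[OF X] by simp
  obtain b where b: "b > 0" "d2 = complex_of_real b"
    using dual_pair_norms[OF X dp2] unit_scale_inj 2(2) by metis
  have "(cnj k * k) * d2 = (cnj l * l) * d2" using kd ld by simp
  then have "cnj k * k = cnj l * l" using b by (simp only: mult_cancel_right) simp
  then have "norm k = norm l" by (metis complex_mod_sqrt_Re_mult_cnj mult.commute)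
  moreover have "norm k * norm l = x" using arg_cong[OF kl, of norm] f(4) by (simp add: norm_mult)
  ultimately have "norm k ^ 2 = x" by (simp add: power2_eq_square)
  then have "cnj k * k = x" by (metis complex_norm_square mult.commute of_real_power)
  then show "d1 = d2" using kd f(4) by simp
qed

lemma standard_dual_ex:
  assumes X: "simple C X"
  obtains X' r s d where "standard_dual C X X' r s" "d > 0"
    "adj C s \<cdot> s = hscale C (complex_of_real d) (ident C (tunit C))"
proof -
  have XOb: "X \<in> Ob C" using simpleD(1)[OF X] .
  obtain X' r s where dp: "dual_pair C X X' r s" using rigid[OF XOb] by blast
  note d = dual_pairD[OF dp]
  note [simp] = d(1-8)
  obtain a b where ab: "a > 0" "b > 0" "adj C r \<cdot> r = hscale C (complex_of_real a) (ident C (tunit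
      C))"
    "adj C s \<cdot> s = hscale C (complex_of_real b) (ident C (tunit C))"
    using dual_pair_norms[OF X dp] by blast
  \<comment> \<open>Scaling r by t and s by 1/t preserves the zigzags and changes the two norms to
    t^2 a and b / t^2. They agree exactly for t^4 = b / a.\<close>
  define t where "t = root 4 (b / a)"
  have t: "t > 0" "t ^ 4 = b / a" unfolding t_def using ab by auto
  then have ta: "t\<^sup>2 * a = b / t\<^sup>2" using ab by (simp add: field_simps power_numeral_reduce)
  define T where "T = complex_of_real t"
  have T: "cnj T = T" "T \<noteq> 0" "cnj (1 / T) = 1 / T" using t unfolding T_def by auto
  have r: "hscale C T r \<in> Hom C (tunit C) (X' \<otimes> X)" "hscale C (1 / T) s \<in> Hom C (tunit C) (X \<otimes> X')"
    using homD(1)[OF homI2] by auto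
  have "dual_pair C X X' (hscale C T r) (hscale C (1 / T) s)"
    unfolding dual_pair_def using r T(2) d(9,10) by (simp add: T(1))
  moreover have "adj C (hscale C T r) \<cdot> hscale C T r = hscale C (complex_of_real (b / t\<^sup>2)) (ident
      C (tunit C))"
    using ta by (simp add: ab T T_def power2_eq_square mult.assoc flip: of_real_mult of_real_divide)
  moreover have 2: "adj C (hscale C (1 / T) s) \<cdot> hscale C (1 / T) s = hscale C (complex_of_real (b
      / t\<^sup>2)) (ident C (tunit C))"
    by (simp add: ab T T_def power2_eq_square)
  ultimately have "standard_dual C X X' (hscale C T r) (hscale C (1 / T) s)"
    unfolding standard_dual_def by simp
  from that[OF this _ 2] show thesis using ab t by simp
qed

lemma obj_dim_eq:
  assumes "simple C X" "standard_dual C X X' r s"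
    "adj C s \<cdot> s = hscale C (complex_of_real d) (ident C (tunit C))"
  shows "obj_dim C X = d"
  unfolding obj_dim_def
proof (rule the_equality)
  show "\<exists>X' r s. standard_dual C X X' r s \<and> adj C s \<cdot> s = hscale C (complex_of_real d) (ident C
      (tunit C))"
    using assms by blast
  show "e = d" if "\<exists>X' r s. standard_dual C X X' r s \<and> adj C s \<cdot> s = hscale C (complex_of_real e)
      (ident C (tunit C))" for e
    using that standard_dim_unique[OF assms(1) _ _ assms(2,3)] by (metis of_real_eq_iff)
qed

lemma obj_dim_ex:
  assumes X: "simple C X"
  obtains X' r s where "standard_dual C X X' r s"
    "adj C s \<cdot> s = hscale C (complex_of_real (obj_dim C X)) (ident C (tunit C))"
  using standard_dual_ex[OF X] obj_dim_eq[OF X] by metis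

lemma obj_dim_pos: "simple C X \<Longrightarrow> obj_dim C X > 0"
  using standard_dual_ex obj_dim_eq by metis

text \<open>For \<open>d = 1\<close> the vectors \<open>G\<close> and \<open>P G\<close>, with \<open>P\<close> the projection given by \<open>s s\<^sup>*\<close>, have the same
  Gram matrix. So they agree, and undoing the transposition yields \<open>s s\<^sup>* = 1\<close>.\<close>

lemma invertible_if_dim_1:
  assumes X: "simple C X" and 1: "obj_dim C X = 1"
  shows "invertible X"
proof -
  let ?I = "tunit C"
  obtain X' r s where sd: "standard_dual C X X' r s" and s: "adj C s \<cdot> s = ident C ?I"
    using obj_dim_ex[OF X] 1 by (metis ident_typed(1) of_real_1 scale_one tunit_Ob)
  then have dp: "dual_pair C X X' r s" and r: "adj C r \<cdot> r = ident C ?I"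
    unfolding standard_dual_def by auto
  note d = dual_pairD[OF dp]
  note [simp] = d(1-8)
  let ?G = "assoc C X' X X' \<cdot> (r \<odot> ident C X') \<cdot> adj C (lunit C X')"
  let ?P = "ident C X' \<odot> (s \<cdot> adj C s)"
  have ss: "s \<cdot> adj C s \<cdot> s \<cdot> adj C s = s \<cdot> adj C s"
    using assoc_comp[of "adj C s" s "adj C s"] by (simp add: s del: assoc_comp)
  have GG: "adj C ?G \<cdot> ?G = ident C X'" by (simp add: r)
  \<comment> \<open>The zigzag identity of X' with the right unitor cancelled; with its adjoint it
    gives P G the same inner products as G.\<close>
  have W: "adj C ?G \<cdot> (ident C X' \<odot> s) = runit C X'"
  proof (rule cancel_right[of _ _ "adj C (runit C X')"])
    show "(adj C ?G \<cdot> (ident C X' \<odot> s)) \<cdot> adj C (runit C X') = runit C X' \<cdot> adj C (runit C X')"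
      using d(10) by simp
  qed simp_all
  have W': "(ident C X' \<odot> adj C s) \<cdot> ?G = adj C (runit C X')"
    using arg_cong[OF W, of "adj C"] by simp
  have P: "?P = (ident C X' \<odot> s) \<cdot> (ident C X' \<odot> adj C s)" by simp
  have GP: "adj C ?G \<cdot> ?P \<cdot> ?G = ident C X'"
  proof -
    have "adj C ?G \<cdot> ?P \<cdot> ?G = (adj C ?G \<cdot> (ident C X' \<odot> s)) \<cdot> ((ident C X' \<odot> adj C s) \<cdot> ?G)"
      unfolding P by (simp del: interchange)
    then show ?thesis unfolding W W' by simp
  qed
  have "?G = ?P \<cdot> ?G"
  proof (rule eq_by_gram[where h = "ident C X'"])
    show "adj C (?P \<cdot> ?G) \<cdot> ?G = ident C X'" using GP by simp
    show "adj C (?P \<cdot> ?G) \<cdot> ?P \<cdot> ?G = ident C X'" using GP by (simp add: ss)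
  qed (use GG GP in simp_all)
  then have "adj C ?G = adj C (?P \<cdot> ?G)" by (rule arg_cong)
  then have "transpose X' r X X' (ident C (X \<otimes> X')) = transpose X' r X X' (s \<cdot> adj C s)"
    unfolding transpose_def by simp
  then have "ident C (X \<otimes> X') = s \<cdot> adj C s"
    by (rule transpose_inj[OF dp, rotated -1]) simp_all
  then have "iso (X \<otimes> X') ?I"
    by (intro isoI[of "adj C s" _ _ s]) (simp_all add: s)
  then show ?thesis unfolding invertible_def using d(1,2) by blast
qed

text \<open>The isomorphism of X \<otimes> Y with the unit provides a nonzero vector, hence an arrow
  f from X' to Y with \<open>adj C f \<cdot> f\<close> a positive scalar x. Since Y is simple too,
  the product in the other order is a scalar k, and associativity of f, \<open>adj C f\<close>, f
  forces k = x. So f is invertible up to scaling.\<close>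

lemma dual_of_invertible:
  assumes X: "X \<in> Ob C" "Y \<in> Ob C" "iso (X \<otimes> Y) (tunit C)" and dp: "dual_pair C X X' r s"
  shows "iso (X \<otimes> X') (tunit C)"
proof -
  let ?I = "tunit C"
  have simp: "simple C X" "simple C Y"
    using X invertible_inverse[OF X] invertible_simple unfolding invertible_def by blast+
  obtain u v where uv: "arr u" "dm u = X \<otimes> Y" "cd u = ?I" "arr v" "dm v = ?I" "cd v = X \<otimes> Y"
    "v \<cdot> u = ident C (X \<otimes> Y)" "u \<cdot> v = ident C ?I" by (rule isoE[OF X(3)])
  have "v \<noteq> hzero C ?I (X \<otimes> Y)"
  proof
    assume v: "v = hzero C ?I (X \<otimes> Y)"
    have "u \<cdot> hzero C ?I (X \<otimes> Y) = hzero C ?I ?I" using uv(1-3) X by simp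
    then show False using uv(8) unit_nonzero unfolding v by simp
  qed
  then obtain f x where f: "arr f" "dm f = X'" "cd f = Y" "x > 0"
    "adj C f \<cdot> f = hscale C (complex_of_real x) (ident C X')"
    using dual_hom_nonzero[OF simp(1) dp uv(4,5,6) X(2)] by blast
  obtain k where k: "f \<cdot> adj C f = hscale C k (ident C Y)"
    using simpleD(3)[OF simp(2), of "f \<cdot> adj C f"] f by auto
  have X'Ob: "X' \<in> Ob C" using dual_pairD[OF dp] by simp
  have "f \<cdot> (adj C f \<cdot> f) = (f \<cdot> adj C f) \<cdot> f" using f by simp
  then have "hscale C (complex_of_real x) f = hscale C k f"
    unfolding k f(5) using f(1-3) X X'Ob by simp
  moreover have "f \<noteq> hzero C (dm f) (cd f)"
  proof
    assume "f = hzero C (dm f) (cd f)"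
    then have "hscale C (complex_of_real x) (ident C X') = hzero C X' X'"
      using f(1-3) X X'Ob f(5) by (metis adj_typed(1,2,3) zero_comp(2))
    then show False using scale_eq_zero[of "ident C X'" "complex_of_real x"] f(4) simpleD(2)[OF
        simple_dual[OF simp(1) dp]] X'Ob
      by auto
  qed
  ultimately have "k = complex_of_real x" using scale_inj[OF f(1)] by metis
  then have "iso X' Y"
    using f(1-4) X'Ob X
    by (intro isoI[of f _ _ "hscale C (1 / complex_of_real x) (adj C f)"]) (simp_all add: f(5) k)
  then show ?thesis using iso_trans[OF iso_tens[OF iso_refl[OF X(1)]] X(3)] by blast
qed

text \<open>X \<otimes> X' is simple, so \<open>s \<cdot> adj C s\<close> is a scalar, necessarily
  the dimension d. The zigzag composite is the identity, but multiplying it by its adjoint produces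
  one factor d from this scalar and another from the norm of r. Hence d^2 = 1, and d is
  positive.\<close>

lemma dim_1_if_invertible:
  assumes "invertible X"
  shows "obj_dim C X = 1"
proof -
  let ?I = "tunit C"
  have X: "simple C X" using invertible_simple assms .
  obtain X' r s where sd: "standard_dual C X X' r s"
    and s: "adj C s \<cdot> s = hscale C (complex_of_real (obj_dim C X)) (ident C ?I)"
    using obj_dim_ex[OF X] by blast
  then have dp: "dual_pair C X X' r s" and r: "adj C r \<cdot> r = hscale C (complex_of_real (obj_dim C
      X)) (ident C ?I)"
    unfolding standard_dual_def by auto
  note d = dual_pairD[OF dp]
  note [simp] = d(1-8)
  let ?d = "complex_of_real (obj_dim C X)"
  have iso: "iso (X \<otimes> X') ?I" using assms dual_of_invertible[OF _ _ _ dp] unfolding invertible_def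
      by blast
  have S: "simple C (X \<otimes> X')" using simple_iso[OF tunit_simple iso_sym[OF iso]] .
  obtain k where k: "s \<cdot> adj C s = hscale C k (ident C (X \<otimes> X'))"
    using simpleD(3)[OF S, of "s \<cdot> adj C s"] by auto
  have "s \<cdot> (adj C s \<cdot> s) = (s \<cdot> adj C s) \<cdot> s" by simp
  then have "hscale C ?d s = hscale C k s" unfolding k s by simp
  then have kd: "k = ?d" using scale_inj[of s] dual_pair_nonzero(2)[OF X dp] by simp
  let ?Z = "lunit C X \<cdot> (adj C s \<odot> ident C X) \<cdot> adj C (assoc C X X' X) \<cdot> (ident C X \<odot> r) \<cdot> adj C
      (runit C X)"
  have "adj C ?Z \<cdot> ?Z = runit C X \<cdot> (ident C X \<odot> adj C r) \<cdot> assoc C X X' X \<cdot> ((s \<cdot> adj C s) \<odot>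
      ident C X) \<cdot> adj C (assoc C X X' X) \<cdot> (ident C X \<odot> r) \<cdot> adj C (runit C X)"
    by simp
  also have "\<dots> = hscale C (?d * ?d) (ident C X)" unfolding k by (simp add: r kd)
  finally have "hscale C (?d * ?d) (ident C X) = hscale C 1 (ident C X)" unfolding d(9) by simp
  then have "?d * ?d = 1" using scale_inj[of "ident C X"] simpleD(2)[OF X] by simp
  then have "obj_dim C X * obj_dim C X = 1" by (metis of_real_1 of_real_eq_iff of_real_mult)
  then show ?thesis using obj_dim_pos[OF X] by (smt (verit) mult_less_cancel_left1
      mult_less_cancel_left2)
qed

text \<open>The partial trace of a scalar t is t times the norm of s, and that norm is 1 for every
  standard dual. Thus all choices of dual give the same value, as the definite description in
  \<open>obj_twist\<close> needs.\<close>

lemma obj_twist_eq: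
  assumes X: "simple C X" "obj_dim C X = 1" and t: "braid C X X = hscale C t (ident C (X \<otimes> X))"
  shows "obj_twist C X = t"
proof -
  let ?I = "tunit C"
  have XOb [simp]: "X \<in> Ob C" using simpleD(1)[OF X(1)] .
  have *: "runit C X \<cdot> (ident C X \<odot> adj C s) \<cdot> assoc C X X X' \<cdot> (braid C X X \<odot> ident C X') \<cdot>
       adj C (assoc C X X X') \<cdot> (ident C X \<odot> s) \<cdot> adj C (runit C X) = hscale C t (ident C X)"
    if sd: "standard_dual C X X' r s" for X' r s
  proof -
    have dp: "dual_pair C X X' r s" using sd unfolding standard_dual_def by blast
    note d = dual_pairD[OF dp]
    note [simp] = d(1-8)
    obtain b where "adj C s \<cdot> s = hscale C (complex_of_real b) (ident C ?I)"
      using dual_pair_norms[OF X(1) dp] by blast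
    with obj_dim_eq[OF X(1) sd this] X(2) have "adj C s \<cdot> s = ident C ?I" by simp
    then show ?thesis unfolding t by simp
  qed
  obtain X' r s where sd: "standard_dual C X X' r s" using standard_dual_ex[OF X(1)] by blast
  show ?thesis unfolding obj_twist_def
  proof (rule the_equality)
    show "\<exists>X' r s. standard_dual C X X' r s \<and>
     runit C X \<cdot> (ident C X \<odot> adj C s) \<cdot> assoc C X X X' \<cdot> (braid C X X \<odot> ident C X') \<cdot>
       adj C (assoc C X X X') \<cdot> (ident C X \<odot> s) \<cdot> adj C (runit C X) = hscale C t (ident C X)"
      using *[OF sd] sd by blast
    show "t' = t" if "\<exists>X' r s. standard_dual C X X' r s \<and>
     runit C X \<cdot> (ident C X \<odot> adj C s) \<cdot> assoc C X X X' \<cdot> (braid C X X \<odot> ident C X') \<cdot>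
       adj C (assoc C X X X') \<cdot> (ident C X \<odot> s) \<cdot> adj C (runit C X) = hscale C t' (ident C X)" for
           t'
      using that * scale_inj[of "ident C X" t' t] simpleD(2)[OF X(1)] by auto
  qed
qed

end

section \<open>The lower bound\<close>

text \<open>A congruence of charges modulo 2, multiplied by q: k and l stand for powers of the
  background anyon, while m = q stands for the charge 1 of the fermion and m = 0 for its absence.
  The bounds on k and l leave only n = 0 and n = -1.\<close>

lemma int_cong_cases:
  fixes k l q :: nat and n :: int
  assumes "int l = int k + int m + 2 * int q * n" "k < 2 * q" "l < 2 * q" "m = 0 \<or> m = q"
  shows "(m = 0 \<and> k = l) \<or> (m = q \<and> (l = k + q \<or> k = l + q))"
proof -
  have "n = 0 \<or> n = -1"
  proof (rule ccontr)
    assume "\<not> (n = 0 \<or> n = -1)"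
    then have "n \<ge> 1 \<or> n \<le> -2" by linarith
    then show False
    proof
      assume "n \<ge> 1"
      then have "2 * int q * 1 \<le> 2 * int q * n" by (intro mult_left_mono) auto
      then show False using assms by linarith
    next
      assume "n \<le> -2"
      then have "2 * int q * n \<le> 2 * int q * (-2)" by (intro mult_left_mono) auto
      then show False using assms by linarith
    qed
  qed
  then show ?thesis using assms by auto
qed

section \<open>Scalar braidings and tensor powers\<close>

context unitary_braided_category
begin

lemma braid_scalar_iso:
  assumes "iso X X'" and t: "braid C X X = hscale C t (ident C (X \<otimes> X))"
  shows "braid C X' X' = hscale C t (ident C (X' \<otimes> X'))"
proof -
  obtain u v where uv: "arr u" "dm u = X" "cd u = X'" "arr v" "dm v = X'" "cd v = X"
    "v \<cdot> u = ident C X" "u \<cdot> v = ident C X'" "X \<in> Ob C" "X' \<in> Ob C" by (rule isoE[OF assms(1)])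
  note [simp] = uv(1-6,9,10)
  have "braid C X' X' = braid C X' X' \<cdot> ((u \<cdot> v) \<odot> (u \<cdot> v))" unfolding uv(8) by simp
  also have "\<dots> = (braid C X' X' \<cdot> (u \<odot> u)) \<cdot> (v \<odot> v)" by simp
  also have "\<dots> = ((u \<odot> u) \<cdot> braid C X X) \<cdot> (v \<odot> v)" using braid_nat[of u u] by simp
  also have "\<dots> = hscale C t ((u \<cdot> v) \<odot> (u \<cdot> v))" unfolding t by simp
  finally show ?thesis unfolding uv(8) by simp
qed

lemma monodromy_iso:
  assumes "iso X X'" "iso Y Y'"
    and w: "braid C Y X \<cdot> braid C X Y = hscale C w (ident C (X \<otimes> Y))"
  shows "braid C Y' X' \<cdot> braid C X' Y' = hscale C w (ident C (X' \<otimes> Y'))"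
proof -
  obtain u v where uv: "arr u" "dm u = X" "cd u = X'" "arr v" "dm v = X'" "cd v = X"
    "v \<cdot> u = ident C X" "u \<cdot> v = ident C X'" "X \<in> Ob C" "X' \<in> Ob C" by (rule isoE[OF assms(1)])
  obtain f g where fg: "arr f" "dm f = Y" "cd f = Y'" "arr g" "dm g = Y'" "cd g = Y"
    "g \<cdot> f = ident C Y" "f \<cdot> g = ident C Y'" "Y \<in> Ob C" "Y' \<in> Ob C" by (rule isoE[OF assms(2)])
  note [simp] = uv(1-6,9,10) fg(1-6,9,10)
  have "braid C Y' X' \<cdot> braid C X' Y' = braid C Y' X' \<cdot> braid C X' Y' \<cdot> ((u \<cdot> v) \<odot> (f \<cdot> g))"
    unfolding uv(8) fg(8) by simp
  also have "\<dots> = braid C Y' X' \<cdot> (braid C X' Y' \<cdot> (u \<odot> f)) \<cdot> (v \<odot> g)" by simp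
  also have "\<dots> = (braid C Y' X' \<cdot> (f \<odot> u)) \<cdot> braid C X Y \<cdot> (v \<odot> g)" using braid_nat[of u f] by simp
  also have "\<dots> = (u \<odot> f) \<cdot> (braid C Y X \<cdot> braid C X Y) \<cdot> (v \<odot> g)" using braid_nat[of f u] by simp
  also have "\<dots> = hscale C w ((u \<cdot> v) \<odot> (f \<cdot> g))" unfolding w by simp
  finally show ?thesis unfolding uv(8) fg(8) by simp
qed

text \<open>Each hexagon writes a braiding of X with X \<otimes> X as t^2 times an associator or its
  inverse, which gives the full braiding t^4. A further hexagon braids X \<otimes> X with itself
  through two such factors, and the pentagon cancels the remaining associators.\<close>

lemma braid_square:
  assumes X [simp]: "X \<in> Ob C" and t: "braid C X X = hscale C t (ident C (X \<otimes> X))"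
  shows "braid C X (X \<otimes> X) \<cdot> braid C (X \<otimes> X) X = hscale C (t ^ 4) (ident C ((X \<otimes> X) \<otimes> X))"
    and "braid C (X \<otimes> X) (X \<otimes> X) = hscale C (t ^ 4) (ident C ((X \<otimes> X) \<otimes> (X \<otimes> X)))"
proof -
  let ?B = "X \<otimes> X" and ?a = "assoc C X X X"
  have "?a \<cdot> braid C X ?B \<cdot> ?a = hscale C (t * t) ?a"
    using hexagon[OF X X X] by (simp add: t)
  then have "adj C ?a \<cdot> (?a \<cdot> braid C X ?B \<cdot> ?a) \<cdot> adj C ?a = hscale C (t * t) (adj C ?a)"
    by (simp del: assoc_arr(7))
  then have 1: "braid C X ?B = hscale C (t * t) (adj C ?a)" by simp
  have "adj C ?a \<cdot> braid C ?B X \<cdot> adj C ?a = hscale C (t * t) (adj C ?a)"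
    using hexagon_inv[OF X X X] by (simp add: t)
  then have "?a \<cdot> (adj C ?a \<cdot> braid C ?B X \<cdot> adj C ?a) \<cdot> ?a = hscale C (t * t) ?a"
    by (simp del: assoc_arr(6))
  then have 2: "braid C ?B X = hscale C (t * t) ?a" by simp
  show "braid C X ?B \<cdot> braid C ?B X = hscale C (t ^ 4) (ident C (?B \<otimes> X))"
    unfolding 1 2 by (simp add: power_numeral_reduce mult.assoc)
  let ?l = "assoc C X X ?B" and ?r = "assoc C ?B X X"
  have "?l \<cdot> braid C ?B ?B \<cdot> ?r = hscale C (t * t * (t * t)) ((ident C X \<odot> ?a) \<cdot> assoc C X ?B X \<cdot>
      (?a \<odot> ident C X))"
    using hexagon[of ?B X X] by (simp add: 2)
  also have "\<dots> = hscale C (t ^ 4) (?l \<cdot> ?r)"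
    unfolding pentagon[OF X X X X] by (simp add: power_numeral_reduce mult.assoc)
  finally have "adj C ?l \<cdot> (?l \<cdot> braid C ?B ?B \<cdot> ?r) \<cdot> adj C ?r = adj C ?l \<cdot> hscale C (t ^ 4) (?l
      \<cdot> ?r) \<cdot> adj C ?r"
    by simp
  then show "braid C ?B ?B = hscale C (t ^ 4) (ident C (?B \<otimes> ?B))" by simp
qed

primrec tens_pow where
  "tens_pow X 0 = tunit C"
| "tens_pow X (Suc n) = tens_pow X n \<otimes> X"

lemma invertible_Ob: "invertible X \<Longrightarrow> X \<in> Ob C"
  by (simp add: invertible_def)

lemma invertible_tens_pow: "invertible X \<Longrightarrow> invertible (tens_pow X n)"
  by (induction n) (auto intro: invertible_unit invertible_tens)

lemma tens_pow_Ob [simp]: "X \<in> Ob C \<Longrightarrow> tens_pow X n \<in> Ob C"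
  by (induction n) auto

lemma tens_pow_add:
  assumes "X \<in> Ob C"
  shows "iso (tens_pow X (m + n)) (tens_pow X m \<otimes> tens_pow X n)"
proof (induction n)
  case 0
  then show ?case using iso_sym[OF iso_runit] assms by simp
next
  case (Suc n)
  have "iso (tens_pow X (m + Suc n)) ((tens_pow X m \<otimes> tens_pow X n) \<otimes> X)"
    using iso_tens[OF Suc iso_refl[OF assms]] by simp
  also have "iso \<dots> (tens_pow X m \<otimes> (tens_pow X n \<otimes> X))" using iso_assoc assms by simp
  finally show ?case by simp
qed

end

section \<open>From objects to anyons\<close>

context unitary_braided_fusion_category
begin

abbreviation anyon_of where "anyon_of X \<equiv> anyon_rel C `` {X}"

lemma anyon_of_iff: "simple C X \<Longrightarrow> Y \<in> anyon_of X \<longleftrightarrow> simple C Y \<and> iso X Y"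
  using simpleD(1) unfolding anyon_rel_def iso_def by auto

lemma anyon_of_in [simp]: "simple C X \<Longrightarrow> anyon_of X \<in> anyons C"
  unfolding anyons_def by (auto intro: quotientI)

lemma rep_anyon_of:
  assumes "simple C X" shows "simple C (rep (anyon_of X))" "iso X (rep (anyon_of X))"
proof -
  have "X \<in> anyon_of X" using anyon_of_iff[OF assms] assms iso_refl simpleD(1) by blast
  then have "rep (anyon_of X) \<in> anyon_of X" unfolding rep_def by (rule someI)
  then show "simple C (rep (anyon_of X))" "iso X (rep (anyon_of X))" using anyon_of_iff[OF assms]
      by auto
qed

lemma anyon_of_eq_iff:
  assumes "simple C X" "simple C Y" shows "anyon_of X = anyon_of Y \<longleftrightarrow> iso X Y"
proof
  assume "anyon_of X = anyon_of Y"
  then show "iso X Y" using rep_anyon_of(2)[OF assms(1)] rep_anyon_of(2)[OF assms(2)] iso_sym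
      iso_trans by metis
next
  assume i: "iso X Y"
  have "Z \<in> anyon_of X \<longleftrightarrow> Z \<in> anyon_of Y" for Z
    unfolding anyon_of_iff[OF assms(1)] anyon_of_iff[OF assms(2)]
    using i iso_sym[OF i] iso_trans by blast
  then show "anyon_of X = anyon_of Y" by blast
qed

lemma anyon_rep:
  assumes "x \<in> anyons C" shows "simple C (rep x)" "anyon_of (rep x) = x"
proof -
  obtain X where X: "simple C X" "x = anyon_of X"
    using assms unfolding anyons_def by (auto elim: quotientE)
  show "simple C (rep x)" using rep_anyon_of(1)[OF X(1)] X(2) by simp
  then show "anyon_of (rep x) = x"
    using anyon_of_eq_iff[of "rep x" X] iso_sym[OF rep_anyon_of(2)[OF X(1)]] X by simp
qed

lemma abelian_anyon_iff: "abelian_anyon C x \<longleftrightarrow> x \<in> anyons C \<and> invertible (rep x)"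
  unfolding abelian_anyon_def qdim_def
  using anyon_rep(1) dim_1_if_invertible invertible_if_dim_1 by blast

lemma abelian_anyon_of: "invertible X \<Longrightarrow> abelian_anyon C (anyon_of X)"
  unfolding abelian_anyon_iff
  using invertible_iso rep_anyon_of(2) invertible_simple anyon_of_in by blast

lemma braid_self_scalar:
  assumes "invertible X"
  shows "\<exists>t. braid C X X = hscale C t (ident C (X \<otimes> X))"
  using simpleD(3)[OF invertible_simple[OF invertible_tens[OF assms assms]], of "braid C X X"]
    invertible_Ob[OF assms] by simp

lemma fermion_no_square_root:
  assumes F: "fermionic_TO C c" and b: "invertible b"
  shows "\<not> iso (b \<otimes> b) (rep c)"
proof
  assume i: "iso (b \<otimes> b) (rep c)"
  let ?y = "anyon_of b"
  note sb = invertible_simple[OF b]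
  have bOb [simp]: "b \<in> Ob C" using b by (rule invertible_Ob)
  obtain t where t: "braid C b b = hscale C t (ident C (b \<otimes> b))" using braid_self_scalar[OF b] by
      blast
  have "c \<in> {x \<in> anyons C. \<forall>y \<in> anyons C. full_braiding C x y 1}" and tw: "twist C c = cis pi"
    using F unfolding fermionic_TO_def by auto
  then have "full_braiding C c ?y 1" using sb by simp
  then have "braid C (rep ?y) (rep c) \<cdot> braid C (rep c) (rep ?y) = hscale C 1 (ident C (rep c \<otimes>
      rep ?y))"
    unfolding full_braiding_def by simp
  from monodromy_iso[OF iso_sym[OF i] iso_sym[OF rep_anyon_of(2)[OF sb]] this]
  have "hscale C (t ^ 4) (ident C ((b \<otimes> b) \<otimes> b)) = hscale C 1 (ident C ((b \<otimes> b) \<otimes> b))"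
    using braid_square(1)[OF bOb t] by simp
  then have t4: "t ^ 4 = 1"
    using scale_inj[of "ident C ((b \<otimes> b) \<otimes> b)"]
      simpleD(2)[OF invertible_simple[OF invertible_tens[OF invertible_tens[OF b b] b]]] by simp
  have ci: "invertible (rep c)" using invertible_iso[OF invertible_tens[OF b b] i] .
  have "obj_twist C (rep c) = t ^ 4"
    by (rule obj_twist_eq[OF invertible_simple[OF ci] dim_1_if_invertible[OF ci]
        braid_scalar_iso[OF i braid_square(2)[OF bOb t]]])
  then show False using tw t4 unfolding twist_def by simp
qed

lemma abelian_anyons_lower_bound:
  assumes q: "q > 0" and S: "S \<in> SET (1 / real q)" and C_def: "C = TO S"
  shows "card {x \<in> anyons C. abelian_anyon C x} \<ge> (if odd q then 2 * q else 4 * q)"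
proof -
  have F: "fermionic_TO C (fermion S)" and Q: "charge_assignment S" and B: "background_data (1 /
      real q) S"
    using S unfolding SET_def C_def by auto
  define A where "A = rep (background S)"
  define c where "c = rep (fermion S)"
  define Ab where "Ab = {x \<in> anyons C. abelian_anyon C x}"
  have fAb: "finite Ab" unfolding Ab_def using finite_anyons by simp
  have AbI: "invertible X \<Longrightarrow> anyon_of X \<in> Ab" for X
    unfolding Ab_def using abelian_anyon_of abelian_anyon_iff by blast
  have A: "invertible A" "anyon_of A = background S"
    using B anyon_rep(2) unfolding background_data_def A_def C_def[symmetric] abelian_anyon_iff by
        auto
  have c_any: "fermion S \<in> anyons C" using F unfolding fermionic_TO_def by blast
  note c_rep = anyon_rep[OF c_any, folded c_def]
  have cc: "iso (c \<otimes> c) (tunit C)"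
    using F simpleD(1)[OF c_rep(1)] unfolding fermionic_TO_def c_def iso_def by auto
  have c: "invertible c" using cc simpleD(1)[OF c_rep(1)] unfolding invertible_def by blast
  \<comment> \<open>The charge is moved to objects so that it can be evaluated on tensor products
    directly; on invertible objects it is additive modulo 2.\<close>
  define Q where "Q X = charge S (anyon_of X)" for X
  have Q_iso: "Q X = Q Y" if "invertible X" "iso X Y" for X Y
    using anyon_of_eq_iff[of X Y] invertible_simple[of X] simple_iso[of X Y] that unfolding Q_def
        by simp
  have Q_tens: "[Q (X \<otimes> Y) = Q X + Q Y] (rmod 2)" if X: "invertible X" and Y: "invertible Y" for X Y
  proof -
    let ?x = "anyon_of X" and ?y = "anyon_of Y" and ?z = "anyon_of (X \<otimes> Y)"
    note s = invertible_simple[OF X] invertible_simple[OF Y] invertible_simple[OF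
        invertible_tens[OF X Y]]
    have "iso (rep ?z) (rep ?x \<otimes> rep ?y)"
      using iso_trans[OF iso_sym[OF rep_anyon_of(2)[OF s(3)]] iso_tens[OF rep_anyon_of(2)[OF s(1)]
          rep_anyon_of(2)[OF s(2)]]] .
    then obtain u v where uv: "arr u" "dm u = rep ?z" "cd u = rep ?x \<otimes> rep ?y" "arr v" "dm v = rep
        ?x \<otimes> rep ?y" "cd v = rep ?z"
      "v \<cdot> u = ident C (rep ?z)" "rep ?z \<in> Ob C" "rep ?x \<otimes> rep ?y \<in> Ob C" by (rule isoE)
    have "u \<in> Hom C (rep ?z) (rep ?x \<otimes> rep ?y)" using homD(1)[OF homI2] uv by blast
    moreover have "u \<noteq> hzero C (rep ?z) (rep ?x \<otimes> rep ?y)"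
    proof
      assume "u = hzero C (rep ?z) (rep ?x \<otimes> rep ?y)"
      then have "v \<cdot> hzero C (rep ?z) (rep ?x \<otimes> rep ?y) = ident C (rep ?z)" using uv(7) by simp
      then show False using simpleD(2)[OF rep_anyon_of(1)[OF s(3)]] uv(4-6,8,9) by simp
    qed
    ultimately have "occurs C ?z ?x ?y" unfolding occurs_def by blast
    then show ?thesis using \<open>charge_assignment S\<close> s
      unfolding charge_assignment_def Q_def C_def[symmetric] by simp
  qed
  have Q_unit: "[Q (tunit C) = 0] (rmod 2)" and Q_c: "[Q c = 1] (rmod 2)"
    using \<open>charge_assignment S\<close> c_rep(2)
    unfolding charge_assignment_def Q_def C_def[symmetric] vacuum_def by simp_all
  have Q_A: "[Q A = 1 / real q] (rmod 2)"
    using B A(2) unfolding background_data_def Q_def by simp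
  define P where "P = tens_pow A"
  have P: "invertible (P n)" "P n \<in> Ob C" for n
    unfolding P_def using invertible_tens_pow[OF A(1)] invertible_Ob by auto
  have Q_P: "[Q (P n) = real n / real q] (rmod 2)" for n
  proof (induction n)
    case 0
    then show ?case using Q_unit by (simp add: P_def)
  next
    case (Suc n)
    have "[Q (P (Suc n)) = Q (P n) + Q A] (rmod 2)"
      using Q_tens[OF P(1)[of n] A(1)] by (simp add: P_def)
    also have "[Q (P n) + Q A = real n / real q + 1 / real q] (rmod 2)"
      using Suc Q_A by (rule rcong_add)
    finally show ?case by (simp add: add_divide_distrib add.commute)
  qed
  \<comment> \<open>The charge 1 of the fermion enters as q / q, so that all charges have
    denominator q.\<close>
  have key: "(m = 0 \<and> k = l) \<or> (m = q \<and> (l = k + q \<or> k = l + q))"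
    if H: "[real k / real q + real m / real q = real l / real q] (rmod 2)" "k < 2 * q" "l < 2 * q"
        "m = 0 \<or> m = q"
    for k l m
  proof -
    obtain n :: int where "real l / real q = real k / real q + real m / real q + of_int n * 2"
      using H(1) unfolding rcong_altdef by blast
    then have "real l = real k + real m + 2 * real q * of_int n" using q by (simp add: field_simps)
    then have "real_of_int (int l) = real_of_int (int k + int m + 2 * int q * n)" by simp
    then have "int l = int k + int m + 2 * int q * n" by (simp only: of_int_eq_iff)
    from int_cong_cases[OF this H(2-4)] show ?thesis .
  qed
  have P_inj: "k = l" if "iso (P k) (P l)" "k < 2 * q" "l < 2 * q" for k l
  proof -
    have "[real k / real q = real l / real q] (rmod 2)"
      using rcong_trans[OF rcong_sym[OF Q_P[of k]] Q_P[of l, folded Q_iso[OF P(1) that(1)]]] .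
    then show ?thesis using key[of k 0 l] that(2,3) q by auto
  qed
  let ?f = "\<lambda>k. anyon_of (P k)" and ?g = "\<lambda>k. anyon_of (c \<otimes> P k)"
  have f: "inj_on ?f {..<2 * q}" "?f ` {..<2 * q} \<subseteq> Ab"
    using P_inj P(1) AbI invertible_simple by (auto intro!: inj_onI simp: anyon_of_eq_iff)
  have cardf: "card (?f ` {..<2 * q}) = 2 * q" using card_image[OF f(1)] by simp
  show ?thesis
  proof (cases "odd q")
    case True
    then show ?thesis using card_mono[OF fAb f(2)] cardf unfolding Ab_def by simp
  next
    case False
    have cOb: "c \<in> Ob C" using c by (rule invertible_Ob)
    have not_Pq: "\<not> iso (P q) c"
    proof
      assume i: "iso (P q) c"
      \<comment> \<open>For even q the power a^q is the square of the invertible object a^(q/2),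
        which \<open>fermion_no_square_root\<close> forbids for the fermion.\<close>
      have half: "q div 2 + q div 2 = q" using False by presburger
      have "iso (P q) (P (q div 2) \<otimes> P (q div 2))"
        using tens_pow_add[OF invertible_Ob[OF A(1)], of "q div 2" "q div 2", unfolded half]
        unfolding P_def .
      from iso_trans[OF iso_sym[OF this] i] have "iso (P (q div 2) \<otimes> P (q div 2)) c" .
      then show False using fermion_no_square_root[OF F P(1)] unfolding c_def by blast
    qed
    have P_add: "iso (P (k + q)) (P q \<otimes> P k)" for k
      using tens_pow_add[OF invertible_Ob[OF A(1)], of q k] unfolding P_def by (simp add:
          add.commute)
    have cP: "invertible (c \<otimes> P k)" for k using invertible_tens[OF c P(1)] .
    have g_inj: "k = l" if "iso (c \<otimes> P k) (c \<otimes> P l)" "k < 2 * q" "l < 2 * q" for k l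
    proof (rule P_inj[OF _ that(2,3)])
      have "iso (P k \<otimes> c) (P l \<otimes> c)"
        using iso_trans[OF iso_trans[OF iso_braid[OF P(2) cOb] that(1)] iso_braid[OF cOb P(2)]] .
      then show "iso (P k) (P l)" using iso_cancel_right[OF c] P(2) by blast
    qed
    have g: "inj_on ?g {..<2 * q}" "?g ` {..<2 * q} \<subseteq> Ab"
      using g_inj cP AbI invertible_simple by (auto intro!: inj_onI simp: anyon_of_eq_iff)
    have cardg: "card (?g ` {..<2 * q}) = 2 * q" using card_image[OF g(1)] by simp
    \<comment> \<open>Comparing charges leaves l = k + q or k = l + q. In the first case cancelling
      a^k gives a^q = c; in the second, cancelling a^l gives c a^q = 1 = c c, hence again a^q =
      c.\<close>
    have disj: "\<not> iso (c \<otimes> P k) (P l)" if kl: "k < 2 * q" "l < 2 * q" for k l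
    proof
      assume i: "iso (c \<otimes> P k) (P l)"
      have "[Q (c \<otimes> P k) = 1 + real k / real q] (rmod 2)"
        using rcong_trans[OF Q_tens[OF c P(1)] rcong_add[OF Q_c Q_P]] .
      then have "[1 + real k / real q = real l / real q] (rmod 2)"
        using rcong_trans[OF rcong_sym] Q_P[of l, folded Q_iso[OF cP i]] by blast
      then have "l = k + q \<or> k = l + q" using key[of k q l] kl q by (auto simp: add.commute)
      then show False
      proof
        assume "l = k + q"
        then have "iso (P q \<otimes> P k) (c \<otimes> P k)" using iso_trans[OF iso_sym[OF P_add] iso_sym] i by
            simp
        then show False using iso_cancel_right[OF P(1)] P(2) cOb not_Pq by blast
      next
        assume k: "k = l + q"
        have "iso ((c \<otimes> P q) \<otimes> P l) (c \<otimes> (P q \<otimes> P l))" using iso_assoc cOb P(2) by blast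
        also have "iso \<dots> (c \<otimes> P k)" unfolding k by (rule iso_tens[OF iso_refl[OF cOb] iso_sym[OF
            P_add]])
        also note i
        also have "iso (P l) (tunit C \<otimes> P l)" using iso_sym[OF iso_lunit[OF P(2)]] .
        finally have "iso (c \<otimes> P q) (tunit C)"
          using iso_cancel_right[OF P(1)] P(2) cOb by simp
        from iso_trans[OF iso_trans[OF iso_braid[OF P(2) cOb] this] iso_sym[OF cc]]
        have "iso (P q) c" using iso_cancel_right[OF c] P(2) cOb by blast
        then show False using not_Pq by blast
      qed
    qed
    have "?f ` {..<2 * q} \<inter> ?g ` {..<2 * q} = {}"
    proof -
      have "?f l \<noteq> ?g k" if "k < 2 * q" "l < 2 * q" for k l
        using disj[OF that] iso_sym anyon_of_eq_iff[OF invertible_simple[OF P(1)]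
            invertible_simple[OF cP]] by blast
      then show ?thesis by auto
    qed
    then have "card (?f ` {..<2 * q} \<union> ?g ` {..<2 * q}) = 4 * q"
      using card_Un_disjoint[of "?f ` {..<2 * q}" "?g ` {..<2 * q}"] cardf cardg by simp
    then show ?thesis using card_mono[OF fAb, of "?f ` {..<2 * q} \<union> ?g ` {..<2 * q}"] f(2) g(2)
        False
      unfolding Ab_def by simp
  qed
qed

end

lemma SET_minimal_abelian:
  fixes S :: "('o, 'm) enriched_TO"
  assumes q: "q > 0" and S: "S \<in> SET (1 / real q)"
    and N: "N = (if odd q then 2 * q else 4 * q)"
    and min: "num_anyons (TO S) \<le> N \<or> total_qdim (TO S) \<le> sqrt (real N)"
  shows "abelian_cat (TO S) \<and> num_anyons (TO S) = N"
proof -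
  define C where "C = TO S"
  interpret unitary_braided_fusion_category C
    using S unfolding SET_def fermionic_TO_def C_def by auto
  define Ab where "Ab = {x \<in> anyons C. abelian_anyon C x}"
  have lb: "N \<le> card Ab" using abelian_anyons_lower_bound[OF q S C_def] unfolding N Ab_def .
  have sub: "Ab \<subseteq> anyons C" unfolding Ab_def by blast
  have le: "card Ab \<le> card (anyons C)" using card_mono[OF finite_anyons sub] .
  from min have "Ab = anyons C \<and> card (anyons C) = N"
  proof
    assume "num_anyons (TO S) \<le> N"
    then show ?thesis using lb le card_subset_eq[OF finite_anyons sub]
      unfolding num_anyons_def C_def[symmetric] by linarith
  next
    assume "total_qdim (TO S) \<le> sqrt (real N)"
    then have D: "(\<Sum>x\<in>anyons C. (qdim C x)\<^sup>2) \<le> real N"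
      unfolding total_qdim_def C_def[symmetric] by simp
    have "(\<Sum>x\<in>anyons C. (qdim C x)\<^sup>2) = (\<Sum>x\<in>anyons C - Ab. (qdim C x)\<^sup>2) + (\<Sum>x\<in>Ab. (qdim C x)\<^sup>2)"
      using sum.subset_diff[OF sub finite_anyons] .
    also have "(\<Sum>x\<in>Ab. (qdim C x)\<^sup>2) = real (card Ab)"
      by (simp add: Ab_def abelian_anyon_def)
    finally have D': "(\<Sum>x\<in>anyons C - Ab. (qdim C x)\<^sup>2) \<le> real N - real (card Ab)" using D by simp
    have pos: "(qdim C x)\<^sup>2 > 0" if "x \<in> anyons C" for x
      using obj_dim_pos[OF anyon_rep(1)[OF that]] unfolding qdim_def by simp
    have "anyons C - Ab = {}"
    proof (rule ccontr)
      assume "anyons C - Ab \<noteq> {}"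
      then have "(\<Sum>x\<in>anyons C - Ab. (qdim C x)\<^sup>2) > 0"
        using pos finite_anyons by (intro sum_pos) auto
      then show False using D' lb by linarith
    qed
    then have "Ab = anyons C" using sub by blast
    then show ?thesis using D' lb by simp
  qed
  then show ?thesis unfolding abelian_cat_def num_anyons_def C_def Ab_def by auto
qed

section \<open>The pointed category of a bicharacter\<close>

text \<open>Pairs (k, l) are coded row by row as k b + l. With this code a sum over the basis of a
  tensor product becomes a double sum.\<close>

lemma sum_div_mod:
  fixes F :: "nat \<Rightarrow> nat \<Rightarrow> 'a::comm_monoid_add"
  shows "(\<Sum>m<a * b. F (m div b) (m mod b)) = (\<Sum>k<a. \<Sum>l<b. F k l)"
proof -
  have "(\<Sum>k<a. \<Sum>l<b. F k l) = (\<Sum>(k, l)\<in>{..<a} \<times> {..<b}. F k l)"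
    by (simp add: sum.cartesian_product)
  also have "\<dots> = (\<Sum>m<a * b. F (m div b) (m mod b))"
  proof (rule sum.reindex_bij_witness[of _ "\<lambda>m. (m div b, m mod b)" "\<lambda>(k, l). k * b + l"])
    fix x assume "x \<in> {..<a} \<times> {..<b}"
    then obtain k l where x: "x = (k, l)" "k < a" "l < b" by auto
    have "k * b + l < (k + 1) * b" using x by simp
    also have "\<dots> \<le> a * b" using x by (intro mult_le_mono1) simp
    finally show "(case x of (k, l) \<Rightarrow> k * b + l) \<in> {..<a * b}" using x by simp
  next
    fix m assume "m \<in> {..<a * b}"
    then have "m < a * b" "b > 0" by (auto intro: gr0I)
    then show "(m div b, m mod b) \<in> {..<a} \<times> {..<b}" by (simp add: less_mult_imp_div_less)
  qed auto
  finally show ?thesis by simp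
qed

lemma sum_only:
  fixes A :: "nat \<Rightarrow> complex"
  shows "(\<Sum>k<n. A k * (if k = p then w else 0)) = (if p < n then A p * w else 0)"
    "(\<Sum>k<n. (if k = p then w else 0) * A k) = (if p < n then w * A p else 0)"
  by (simp_all add: if_distrib if_distribR sum.delta cong: if_cong)

lemma pair_index_less: "k < a \<Longrightarrow> l < b \<Longrightarrow> k * b + l < a * (b::nat)"
proof -
  assume "k < a" "l < b"
  then have "k * b + l < (k + 1) * b" by simp
  also have "\<dots> \<le> a * b" using \<open>k < a\<close> by (intro mult_le_mono1) simp
  finally show ?thesis .
qed

lemma pair_indexE:
  assumes "(i::nat) < a * b"
  obtains k l where "i = k * b + l" "k < a" "l < b"
proof
  show "i = (i div b) * b + i mod b" by simp
  show "i div b < a" using assms by (rule less_mult_imp_div_less)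
  show "i mod b < b" using assms by (cases "b = 0") auto
qed

lemma pair_index_div_mod [simp]:
  "l < b \<Longrightarrow> (k * b + l) div b = k" "l < b \<Longrightarrow> (k * b + l) mod b = (l::nat)"
  by auto

lemma pair_index_eq_iff: "l < b \<Longrightarrow> l' < b \<Longrightarrow> k * b + l = k' * b + l' \<longleftrightarrow> k = k' \<and> l = (l'::nat)"
  by (metis div_mult_self3 div_less mod_less mod_mult_self3 add_cancel_left_right
      less_nat_zero_code)

text \<open>Simple objects are labelled by a group \<open>'l\<close>, coded by natural numbers, and braided by the
  bicharacter \<open>R\<close>. Labels that agree modulo \<open>L\<close> are isomorphic: the elements of \<open>L\<close> are
  transparent bosons that have been condensed.\<close>

locale pointed_data =
  fixes enc :: "'l::ab_group_add \<Rightarrow> nat" and dec :: "nat \<Rightarrow> 'l"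
    and R :: "'l \<Rightarrow> 'l \<Rightarrow> complex" and L :: "'l set"
  assumes dec_enc [simp]: "dec (enc x) = x" and enc_dec [simp]: "enc (dec n) = n"
    and R_unit: "cnj (R x y) * R x y = 1"
    and R_add_left: "R (x + y) z = R x z * R y z"
    and R_add_right: "R x (y + z) = R x y * R x z"
    and L_zero [simp]: "0 \<in> L" and L_diff: "x \<in> L \<Longrightarrow> y \<in> L \<Longrightarrow> x - y \<in> L"
    and R_L: "x \<in> L \<Longrightarrow> y \<in> L \<Longrightarrow> R x y = 1"
    and R_L_sym: "x \<in> L \<Longrightarrow> R x y * R y x = 1"
    and L_index: "\<exists>T. finite T \<and> (\<forall>x. \<exists>t\<in>T. x - t \<in> L)"
begin

lemma L_uminus: "x \<in> L \<Longrightarrow> - x \<in> L"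
  using L_diff[of 0 x] by simp

lemma L_add: "x \<in> L \<Longrightarrow> y \<in> L \<Longrightarrow> x + y \<in> L"
  using L_diff[of x "- y"] L_uminus by simp

lemma R_nonzero: "R x y \<noteq> 0"
  using R_unit[of x y] by auto

lemma R_zero [simp]: "R 0 y = 1" "R x 0 = 1"
  using R_add_left[of 0 0 y] R_add_right[of x 0 0] R_nonzero by auto

lemma R_uminus_left: "R (- x) y = cnj (R x y)"
proof -
  have "R (- x) y * R x y = cnj (R x y) * R x y" using R_add_left[of "- x" x y] R_unit by simp
  then show ?thesis using R_nonzero by simp
qed

text \<open>R is trivial on L \<times> L, so a first argument in L sees the second one only modulo
  L. This lets phases be read at the source or at the target of a nonzero matrix entry.\<close>

lemma R_shift: "d \<in> L \<Longrightarrow> y - x \<in> L \<Longrightarrow> R d y = R d x"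
  using R_add_right[of d "y - x" x] R_L[of d "y - x"] by simp

section \<open>Matrices between lists of labels\<close>

definition lab :: "nat list \<Rightarrow> nat \<Rightarrow> 'l" where
  "lab X i = dec (X ! i)"

text \<open>Rows belong to the target Y and columns to the source X. Entries outside the block must
  be 0, because the category laws demand equality of total functions. Congruence modulo L in place
  of equality is what makes congruent labels isomorphic.\<close>

definition supp :: "nat list \<Rightarrow> nat list \<Rightarrow> (nat \<Rightarrow> nat \<Rightarrow> complex) \<Rightarrow> bool" where
  "supp X Y M \<longleftrightarrow> (\<forall>i j. M i j \<noteq> 0 \<longrightarrow> i < length Y \<and> j < length X \<and> lab Y i - lab X j \<in> L)"

text \<open>Keeping source and target in the triple makes the hom sets disjoint.\<close>

definition mhom :: "nat list \<Rightarrow> nat list \<Rightarrow> ref_arr set" where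
  "mhom X Y = {(X, M, Y) | M. supp X Y M}"

definition mid :: "nat list \<Rightarrow> ref_arr" where
  "mid X = (X, \<lambda>i j. if i = j \<and> j < length X then 1 else 0, X)"

definition mcomp :: "ref_arr \<Rightarrow> ref_arr \<Rightarrow> ref_arr" where
  "mcomp g f = (fst f, \<lambda>i j. \<Sum>k<length (snd (snd f)). fst (snd g) i k * fst (snd f) k j, snd (snd
      g))"

text \<open>The row-by-row code of index pairs makes this product strictly associative and
  unital.\<close>

definition mtens :: "nat list \<Rightarrow> nat list \<Rightarrow> nat list" where
  "mtens X Y = map (\<lambda>k. enc (lab X (k div length Y) + lab Y (k mod length Y))) [0..<length X *
      length Y]"

text \<open>The scalar \<open>R (\<dots>) (\<dots>)\<close> in the tensor product of arrows is forced by naturality of the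
  braiding. With it all coherence arrows except the braiding are identities, although the
  3-cocycle of the fusion group may be nontrivial.\<close>

definition mtensA :: "ref_arr \<Rightarrow> ref_arr \<Rightarrow> ref_arr" where
  "mtensA f g = (case (f, g) of ((X, M, Y), (X', M', Y')) \<Rightarrow>
     (mtens X X', \<lambda>i j. if i < length Y * length Y' \<and> j < length X * length X' then
        R (lab Y' (i mod length Y') - lab X' (j mod length X')) (lab X (j div length X')) *
        (M (i div length Y') (j div length X') * M' (i mod length Y') (j mod length X')) else 0,
      mtens Y Y'))"

text \<open>The permutation matrix exchanging the two indices of a pair, with each entry weighted by
  the phase of the two labels.\<close>

definition mbraid :: "nat list \<Rightarrow> nat list \<Rightarrow> ref_arr" where
  "mbraid X Y = (mtens X Y, \<lambda>i j. if j < length X * length Y \<and>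
       i = (j mod length Y) * length X + j div length Y then
       R (lab X (j div length Y)) (lab Y (j mod length Y)) else 0, mtens Y X)"

definition PC :: "(ref_obj, ref_arr) cat" where
  "PC = \<lparr> Ob = UNIV, Hom = mhom, ident = mid, comp = mcomp,
    hzero = \<lambda>X Y. (X, \<lambda>i j. 0, Y),
    hadd = \<lambda>f g. (fst f, \<lambda>i j. fst (snd f) i j + fst (snd g) i j, snd (snd f)),
    hscale = \<lambda>k f. (fst f, \<lambda>i j. k * fst (snd f) i j, snd (snd f)),
    adj = \<lambda>f. (snd (snd f), \<lambda>i j. cnj (fst (snd f) j i), fst f),
    tunit = [enc 0], tens = mtens, tensA = mtensA,
    assoc = \<lambda>X Y Z. mid (mtens (mtens X Y) Z), lunit = mid, runit = mid, braid = mbraid \<rparr>"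

lemma PC_simps [simp]: "Ob PC = UNIV" "Hom PC = mhom" "ident PC = mid" "comp PC = mcomp"
  "hzero PC X Y = (X, \<lambda>i j. 0, Y)"
  "hadd PC f g = (fst f, \<lambda>i j. fst (snd f) i j + fst (snd g) i j, snd (snd f))"
  "hscale PC k f = (fst f, \<lambda>i j. k * fst (snd f) i j, snd (snd f))"
  "adj PC f = (snd (snd f), \<lambda>i j. cnj (fst (snd f) j i), fst f)"
  "tunit PC = [enc 0]" "tens PC = mtens" "tensA PC = mtensA"
  "assoc PC X Y Z = mid (mtens (mtens X Y) Z)" "lunit PC = mid" "runit PC = mid" "braid PC = mbraid"
  by (simp_all add: PC_def)

lemma suppD: "supp X Y M \<Longrightarrow> M i j \<noteq> 0 \<Longrightarrow> i < length Y \<and> j < length X \<and> lab Y i - lab X j \<in> L"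
  by (auto simp: supp_def)

lemma supp_out: "supp X Y M \<Longrightarrow> \<not> (i < length Y \<and> j < length X) \<Longrightarrow> M i j = 0"
  by (auto simp: supp_def)

lemma mhomE:
  assumes "f \<in> mhom X Y" obtains M where "f = (X, M, Y)" "supp X Y M"
  using assms by (auto simp: mhom_def)

lemma mhomI: "supp X Y M \<Longrightarrow> (X, M, Y) \<in> mhom X Y"
  by (auto simp: mhom_def)

lemma mid_in [simp]: "mid X \<in> mhom X X"
  by (auto simp: mid_def mhom_def supp_def)

lemma supp_mult:
  assumes "supp X Y M" "supp Y Z N"
  shows "supp X Z (\<lambda>i j. \<Sum>k<length Y. N i k * M k j)"
  unfolding supp_def
proof (intro allI impI)
  fix i j assume "(\<Sum>k<length Y. N i k * M k j) \<noteq> 0"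
  then obtain k where "N i k * M k j \<noteq> 0" by (meson sum.neutral)
  then have "N i k \<noteq> 0" "M k j \<noteq> 0" by auto
  with suppD[OF assms(1) this(2)] suppD[OF assms(2) this(1)]
    L_add[of "lab Z i - lab Y k" "lab Y k - lab X j"]
  show "i < length Z \<and> j < length X \<and> lab Z i - lab X j \<in> L" by simp
qed

lemma mcomp_in: "f \<in> mhom X Y \<Longrightarrow> g \<in> mhom Y Z \<Longrightarrow> mcomp g f \<in> mhom X Z"
  by (auto elim!: mhomE intro!: mhomI supp_mult simp: mcomp_def)

lemma mid_right:
  assumes "f \<in> mhom X Y" shows "mcomp f (mid X) = f"
proof -
  from assms obtain M where M: "f = (X, M, Y)" "supp X Y M" by (rule mhomE)
  have "(\<Sum>k<length X. M i k * (if k = j \<and> j < length X then 1 else 0)) = M i j" for i j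
  proof -
    have "(\<Sum>k<length X. M i k * (if k = j \<and> j < length X then 1 else 0)) = (\<Sum>k<length X. M i k *
        (if k = j then 1 else 0))"
      by (rule sum.cong) auto
    also have "\<dots> = M i j" using supp_out[OF M(2), of i j] by (simp add: sum_only)
    finally show ?thesis .
  qed
  then show ?thesis using M by (simp add: mcomp_def mid_def)
qed

lemma mid_left:
  assumes "f \<in> mhom X Y" shows "mcomp (mid Y) f = f"
proof -
  from assms obtain M where M: "f = (X, M, Y)" "supp X Y M" by (rule mhomE)
  have "(\<Sum>k<length Y. (if i = k \<and> k < length Y then 1 else 0) * M k j) = M i j" for i j
  proof -
    have "(\<Sum>k<length Y. (if i = k \<and> k < length Y then 1 else 0) * M k j) = (\<Sum>k<length Y. (if k = i
        then 1 else 0) * M k j)"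
      by (rule sum.cong) auto
    also have "\<dots> = M i j" using supp_out[OF M(2), of i j] by (simp add: sum_only)
    finally show ?thesis .
  qed
  then show ?thesis using M by (simp add: mcomp_def mid_def)
qed

lemma mcomp_assoc:
  "mcomp (mcomp h g) f = mcomp h (mcomp g f)" if "f \<in> mhom W X" "g \<in> mhom X Y" "h \<in> mhom Y Z"
proof -
  from that obtain M N P where *: "f = (W, M, X)" "g = (X, N, Y)" "h = (Y, P, Z)" by (auto elim!:
      mhomE)
  have "(\<Sum>k<length X. (\<Sum>l<length Y. P i l * N l k) * M k j) = (\<Sum>l<length Y. P i l * (\<Sum>k<length X.
      N l k * M k j))" for i j
    by (simp add: sum_distrib_left sum_distrib_right mult.assoc) (rule sum.swap)
  then show ?thesis by (simp add: * mcomp_def)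
qed

lemma category_PC: "category PC"
  by unfold_locales (auto elim: mhomE intro: mcomp_in simp: mid_left mid_right mcomp_assoc)

lemma supp_zero: "supp X Y (\<lambda>i j. 0)"
  by (simp add: supp_def)

lemma supp_add: "supp X Y M \<Longrightarrow> supp X Y N \<Longrightarrow> supp X Y (\<lambda>i j. M i j + N i j)"
  unfolding supp_def by (metis add.right_neutral)

lemma supp_scale: "supp X Y M \<Longrightarrow> supp X Y (\<lambda>i j. k * M i j)"
  by (auto simp: supp_def)

lemma supp_adj: "supp X Y M \<Longrightarrow> supp Y X (\<lambda>i j. cnj (M j i))"
  unfolding supp_def using L_uminus by (metis complex_cnj_zero_iff minus_diff_eq)

lemma linear_category_PC: "linear_category PC"
  by (intro linear_category.intro category_PC linear_category_axioms.intro)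
    (auto elim!: mhomE intro!: mhomI supp_zero supp_add supp_scale
      simp: mcomp_def algebra_simps sum.distrib sum_distrib_left)

lemma star_category_PC: "star_category PC"
proof (intro star_category.intro linear_category_PC star_category_axioms.intro)
  fix X Y f assume f: "f \<in> Hom PC X Y" and z: "comp PC (adj PC f) f = hzero PC X X"
  from f obtain M where M: "f = (X, M, Y)" "supp X Y M" by (auto elim: mhomE)
  have "M i j = 0" for i j
  proof (rule ccontr)
    assume "M i j \<noteq> 0"
    then have i: "i < length Y" using suppD[OF M(2)] by blast
    have "(\<lambda>i j. \<Sum>k<length Y. cnj (M k i) * M k j) = (\<lambda>i j. 0)"
      using z by (simp add: M mcomp_def)
    \<comment> \<open>The diagonal entry at (j, j) is the sum of the squared moduli in column j of
      M.\<close>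
    then have "(\<Sum>k<length Y. cnj (M k j) * M k j) = 0" by metis
    moreover have "cnj (M k j) * M k j = complex_of_real ((cmod (M k j))\<^sup>2)" for k
      by (metis complex_norm_square mult.commute)
    ultimately have "complex_of_real (\<Sum>k<length Y. (cmod (M k j))\<^sup>2) = 0" by simp
    then have "(\<Sum>k<length Y. (cmod (M k j))\<^sup>2) = 0" by (simp only: of_real_eq_0_iff)
    then show False using i \<open>M i j \<noteq> 0\<close> by (subst (asm) sum_nonneg_eq_0_iff) auto
  qed
  then show "f = hzero PC X Y" using M by (auto simp: fun_eq_iff)
qed (auto elim!: mhomE intro!: mhomI supp_adj simp: mcomp_def mult.commute)

section \<open>The tensor product\<close>

lemma length_mtens [simp]: "length (mtens X Y) = length X * length Y"
  by (simp add: mtens_def)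

lemma lab_mtens:
  "k < length X * length Y \<Longrightarrow> lab (mtens X Y) k = lab X (k div length Y) + lab Y (k mod length Y)"
  by (simp add: mtens_def lab_def)

lemma list_eq_lab:
  assumes "length X = length Y" "\<And>k. k < length X \<Longrightarrow> lab X k = lab Y k" shows "X = Y"
  using assms unfolding lab_def by (metis enc_dec nth_equalityI)

lemma index_assoc:
  fixes k b c :: nat
  shows "k div (b * c) = k div c div b" "k mod (b * c) div c = k div c mod b" "k mod (b * c) mod c
      = k mod c"
proof -
  show "k div (b * c) = k div c div b" by (metis div_mult2_eq mult.commute)
  show "k mod (b * c) div c = k div c mod b"
    unfolding mult.commute[of b c] mod_mult2_eq by (cases "c = 0") simp_all
  show "k mod (b * c) mod c = k mod c" by (simp add: mod_mult_self2_is_0 mod_mod_cancel)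
qed

lemma mtens_assoc: "mtens (mtens X Y) Z = mtens X (mtens Y Z)"
proof (rule list_eq_lab)
  fix k assume "k < length (mtens (mtens X Y) Z)"
  then have k: "k < length X * length Y * length Z" by simp
  then have "k div length Z < length X * length Y" by (rule less_mult_imp_div_less)
  moreover have "k mod (length Y * length Z) < length Y * length Z" using k by (cases "length Y *
      length Z = 0") auto
  ultimately show "lab (mtens (mtens X Y) Z) k = lab (mtens X (mtens Y Z)) k"
    using k by (simp add: lab_mtens index_assoc mult.assoc add.assoc)
qed (simp add: mult.assoc)

lemma mtens_unit [simp]: "mtens [enc 0] X = X" "mtens X [enc 0] = X"
proof -
  show "mtens [enc 0] X = X" by (rule list_eq_lab) (simp_all add: lab_mtens, simp add: lab_def)
  show "mtens X [enc 0] = X" by (rule list_eq_lab) (simp_all add: lab_mtens, simp add: lab_def)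
qed

definition kron where
  "kron X Y X' Y' M M' i j = (if i < length Y * length Y' \<and> j < length X * length X' then
        R (lab Y' (i mod length Y') - lab X' (j mod length X')) (lab X (j div length X')) *
        (M (i div length Y') (j div length X') * M' (i mod length Y') (j mod length X')) else 0)"

lemma mtensA_simp: "mtensA (X, M, Y) (X', M', Y') = (mtens X X', kron X Y X' Y' M M', mtens Y Y')"
  by (simp add: mtensA_def kron_def fun_eq_iff)

lemma supp_kron:
  assumes "supp X Y M" "supp X' Y' M'"
  shows "supp (mtens X X') (mtens Y Y') (kron X Y X' Y' M M')"
  unfolding supp_def
proof (intro allI impI)
  fix i j assume nz: "kron X Y X' Y' M M' i j \<noteq> 0"
  then have r: "i < length Y * length Y'" "j < length X * length X'" by (auto simp: kron_def
      split: if_splits)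
  from nz r have "M (i div length Y') (j div length X') \<noteq> 0" "M' (i mod length Y') (j mod length
      X') \<noteq> 0"
    by (auto simp: kron_def)
  with suppD[OF assms(1) this(1)] suppD[OF assms(2) this(2)]
  have "(lab Y (i div length Y') - lab X (j div length X')) + (lab Y' (i mod length Y') - lab X'
      (j mod length X')) \<in> L"
    by (intro L_add) auto
  then show "i < length (mtens Y Y') \<and> j < length (mtens X X') \<and> lab (mtens Y Y') i - lab (mtens X
      X') j \<in> L"
    using r by (simp add: lab_mtens algebra_simps)
qed

lemma mtensA_in: "f \<in> mhom X Y \<Longrightarrow> g \<in> mhom X' Y' \<Longrightarrow> mtensA f g \<in> mhom (mtens X X') (mtens Y Y')"
  by (auto elim!: mhomE intro!: mhomI supp_kron simp: mtensA_simp)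

lemma mtensA_mid: "mtensA (mid X) (mid Y) = mid (mtens X Y)"
proof -
  have "kron X X Y Y (\<lambda>i j. if i = j \<and> j < length X then 1 else 0) (\<lambda>i j. if i = j \<and> j < length Y
      then 1 else 0) i j
    = (if i = j \<and> j < length X * length Y then 1 else 0)" for i j
  proof (cases "i < length X * length Y \<and> j < length X * length Y")
    case True
    then obtain a b c d where i: "i = a * length Y + b" "a < length X" "b < length Y"
      and j: "j = c * length Y + d" "c < length X" "d < length Y" by (metis pair_indexE)
    show ?thesis using True i(2,3) j(2,3) unfolding kron_def i(1) j(1)
      by (simp add: pair_index_eq_iff)
  qed (auto simp: kron_def)
  then show ?thesis by (simp add: mid_def mtensA_simp fun_eq_iff)
qed

text \<open>This is the mixed-product rule for Kronecker products, up to phases. Wherever the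
  product of entries is nonzero, the middle label of Y is congruent to the source label of X, so
  \<open>R_shift\<close> moves the first phase to X and additivity in the first argument merges the
  two.\<close>

lemma mtensA_comp:
  assumes "f \<in> mhom X Y" "g \<in> mhom Y Z" "f' \<in> mhom X' Y'" "g' \<in> mhom Y' Z'"
  shows "mtensA (mcomp g f) (mcomp g' f') = mcomp (mtensA g g') (mtensA f f')"
proof -
  from assms obtain M N M' N' where *: "f = (X, M, Y)" "g = (Y, N, Z)" "f' = (X', M', Y')" "g' =
      (Y', N', Z')"
    and s: "supp X Y M" "supp Y Z N" "supp X' Y' M'" "supp Y' Z' N'" by (metis mhomE)
  have "kron X Z X' Z' (\<lambda>i j. \<Sum>k<length Y. N i k * M k j) (\<lambda>i j. \<Sum>k<length Y'. N' i k * M' k j) i j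
    = (\<Sum>m<length Y * length Y'. kron Y Z Y' Z' N N' i m * kron X Y X' Y' M M' m j)" for i j
  proof (cases "i < length Z * length Z' \<and> j < length X * length X'")
    case True
    let ?a = "i div length Z'" and ?b = "i mod length Z'" and ?c = "j div length X'" and ?d = "j
        mod length X'"
    let ?r = "R (lab Z' ?b - lab X' ?d) (lab X ?c)"
    let ?G = "\<lambda>k l. (R (lab Z' ?b - lab Y' l) (lab Y k) * (N ?a k * N' ?b l)) * (R (lab Y' l - lab
        X' ?d) (lab X ?c) * (M k ?c * M' l ?d))"
    have G: "?G k l = ?r * (N ?a k * M k ?c * (N' ?b l * M' l ?d))" for k l
    proof (cases "N ?a k * M k ?c * (N' ?b l * M' l ?d) = 0")
      case True
      then show ?thesis by auto
    next
      case False
      then have "lab Y k - lab X ?c \<in> L" "lab Z' ?b - lab Y' l \<in> L"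
        using suppD[OF s(1)] suppD[OF s(4)] by auto
      then have "R (lab Z' ?b - lab Y' l) (lab Y k) = R (lab Z' ?b - lab Y' l) (lab X ?c)" by
          (rule R_shift[rotated])
      moreover have "?r = R (lab Z' ?b - lab Y' l) (lab X ?c) * R (lab Y' l - lab X' ?d) (lab X ?c)"
        by (simp flip: R_add_left)
      ultimately show ?thesis by simp
    qed
    have "(\<Sum>m<length Y * length Y'. kron Y Z Y' Z' N N' i m * kron X Y X' Y' M M' m j) =
      (\<Sum>m<length Y * length Y'. ?G (m div length Y') (m mod length Y'))"
      using True by (intro sum.cong) (auto simp: kron_def)
    also have "\<dots> = (\<Sum>k<length Y. \<Sum>l<length Y'. ?G k l)" by (rule sum_div_mod)
    also have "\<dots> = ?r * ((\<Sum>k<length Y. N ?a k * M k ?c) * (\<Sum>l<length Y'. N' ?b l * M' l ?d))"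
      unfolding G sum_product by (simp add: sum_distrib_left)
    finally show ?thesis using True by (simp add: kron_def)
  qed (auto simp: kron_def)
  then show ?thesis by (simp add: * mcomp_def mtensA_simp fun_eq_iff)
qed

text \<open>Writing x, y, z and y', z' for source and target labels, both bracketings carry the
  phase R(z' - z, x) R(z' - z, y) R(y' - y, x).\<close>

lemma mtensA_assoc:
  assumes "f \<in> mhom X X'" "g \<in> mhom Y Y'" "h \<in> mhom Z Z'"
  shows "mtensA (mtensA f g) h = mtensA f (mtensA g h)"
proof -
  from assms obtain M N P where *: "f = (X, M, X')" "g = (Y, N, Y')" "h = (Z, P, Z')" by (metis
      mhomE)
  let ?m = length
  have "kron (mtens X Y) (mtens X' Y') Z Z' (kron X X' Y Y' M N) P i j =
      kron X X' (mtens Y Z) (mtens Y' Z') M (kron Y Y' Z Z' N P) i j" for i j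
  proof (cases "i < ?m X' * ?m Y' * ?m Z' \<and> j < ?m X * ?m Y * ?m Z")
    case True
    then have ij: "i < ?m X' * (?m Y' * ?m Z')" "j < ?m X * (?m Y * ?m Z)" by (auto simp:
        mult.assoc)
    from True have d: "i div ?m Z' < ?m X' * ?m Y'" "j div ?m Z < ?m X * ?m Y"
      by (auto intro: less_mult_imp_div_less)
    from True have e: "i mod (?m Y' * ?m Z') < ?m Y' * ?m Z'" "j mod (?m Y * ?m Z) < ?m Y * ?m Z"
      by (auto intro!: mod_less_divisor gr0I)
    let ?i1 = "i div ?m Z' div ?m Y'" and ?i2 = "i div ?m Z' mod ?m Y'" and ?i3 = "i mod ?m Z'"
    let ?j1 = "j div ?m Z div ?m Y" and ?j2 = "j div ?m Z mod ?m Y" and ?j3 = "j mod ?m Z"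
    have "R (lab Z' ?i3 - lab Z ?j3) (lab X ?j1 + lab Y ?j2) * R (lab Y' ?i2 - lab Y ?j2) (lab X
        ?j1) =
      R (lab Y' ?i2 + lab Z' ?i3 - (lab Y ?j2 + lab Z ?j3)) (lab X ?j1) * R (lab Z' ?i3 - lab Z
          ?j3) (lab Y ?j2)"
      using R_add_left[of "lab Z' ?i3 - lab Z ?j3" "lab Y' ?i2 - lab Y ?j2" "lab X ?j1"]
      by (simp add: R_add_right algebra_simps)
    then show ?thesis
      using True ij d e unfolding kron_def length_mtens
      by (simp add: lab_mtens index_assoc mult.assoc)
  qed (auto simp: kron_def mult.assoc)
  then show ?thesis by (simp add: * mtensA_simp mtens_assoc fun_eq_iff)
qed

lemma mtensA_unit:
  assumes "f \<in> mhom X Y"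
  shows "mtensA (mid [enc 0]) f = f" "mtensA f (mid [enc 0]) = f"
proof -
  from assms obtain M where M: "f = (X, M, Y)" "supp X Y M" by (rule mhomE)
  show "mtensA (mid [enc 0]) f = f" "mtensA f (mid [enc 0]) = f"
    using supp_out[OF M(2)] by (auto simp: M mid_def mtensA_simp fun_eq_iff kron_def lab_def)
qed

text \<open>Conjugation negates the label difference, as it should, but the tensor product of the
  adjoints evaluates its phase at the label of Y instead of X. \<open>R_shift\<close> shows that
  this makes no difference on nonzero entries.\<close>

lemma mtensA_adj:
  assumes "f \<in> mhom X Y" "g \<in> mhom X' Y'"
  shows "adj PC (mtensA f g) = mtensA (adj PC f) (adj PC g)"
proof -
  from assms obtain M N where *: "f = (X, M, Y)" "g = (X', N, Y')" and s: "supp X Y M" "supp X' Y'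
      N"
    by (metis mhomE)
  have "cnj (kron X Y X' Y' M N j i) = kron Y X Y' X' (\<lambda>i j. cnj (M j i)) (\<lambda>i j. cnj (N j i)) i j"
      for i j
  proof -
    let ?a = "j div length Y'" and ?b = "j mod length Y'" and ?c = "i div length X'" and ?d = "i
        mod length X'"
    have "cnj (R (lab Y' ?b - lab X' ?d) (lab X ?c)) * (cnj (M ?a ?c) * cnj (N ?b ?d)) =
      R (lab X' ?d - lab Y' ?b) (lab Y ?a) * (cnj (M ?a ?c) * cnj (N ?b ?d))"
    proof (cases "M ?a ?c * N ?b ?d = 0")
      case False
      then have "lab Y ?a - lab X ?c \<in> L" "lab Y' ?b - lab X' ?d \<in> L"
        using suppD[OF s(1)] suppD[OF s(2)] by auto
      then have "R (lab Y' ?b - lab X' ?d) (lab Y ?a) = R (lab Y' ?b - lab X' ?d) (lab X ?c)" by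
          (rule R_shift[rotated])
      then show ?thesis using R_uminus_left[of "lab Y' ?b - lab X' ?d" "lab Y ?a"] by simp
    qed auto
    then show ?thesis by (simp add: kron_def)
  qed
  then show ?thesis by (simp add: * mtensA_simp fun_eq_iff)
qed

lemma adj_mid: "adj PC (mid X) = mid X"
  by (auto simp: mid_def fun_eq_iff)

lemma unitary_mid: "unitary PC X X (mid X)"
  unfolding unitary_def adj_mid using mid_left[OF mid_in] by simp

lemma unitary_monoidal_category_PC: "unitary_monoidal_category PC"
proof (intro unitary_monoidal_category.intro star_category_PC
    unitary_monoidal_category_axioms.intro)
  fix X Y X' Y' f g f' assume "f \<in> Hom PC X Y" "g \<in> Hom PC X Y" "f' \<in> Hom PC X' Y'"
  then obtain M N P where *: "f = (X, M, Y)" "g = (X, N, Y)" "f' = (X', P, Y')" by (metis mhomE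
      PC_simps(2))
  show "tensA PC (hadd PC f g) f' = hadd PC (tensA PC f f') (tensA PC g f')"
    by (simp add: * mtensA_simp kron_def fun_eq_iff algebra_simps)
next
  fix X Y X' Y' f g' f' assume "f \<in> Hom PC X Y" "f' \<in> Hom PC X' Y'" "g' \<in> Hom PC X' Y'"
  then obtain M N P where *: "f = (X, M, Y)" "g' = (X', N, Y')" "f' = (X', P, Y')" by (metis mhomE
      PC_simps(2))
  show "tensA PC f (hadd PC f' g') = hadd PC (tensA PC f f') (tensA PC f g')"
    by (simp add: * mtensA_simp kron_def fun_eq_iff algebra_simps)
next
  fix X Y X' Y' f f' k assume "f \<in> Hom PC X Y" "f' \<in> Hom PC X' Y'"
  then obtain M P where *: "f = (X, M, Y)" "f' = (X', P, Y')" by (metis mhomE PC_simps(2))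
  show "tensA PC (hscale PC k f) f' = hscale PC k (tensA PC f f') \<and>
    tensA PC f (hscale PC k f') = hscale PC k (tensA PC f f')"
    by (simp add: * mtensA_simp kron_def fun_eq_iff algebra_simps)
next
  fix X Y X' Y' f f' assume "f \<in> Hom PC X Y" "f' \<in> Hom PC X' Y'"
  then show "adj PC (tensA PC f f') = tensA PC (adj PC f) (adj PC f')"
    using mtensA_adj by (simp del: PC_simps(8))
next
  fix X Y Z show "unitary PC (tens PC (tens PC X Y) Z) (tens PC X (tens PC Y Z)) (assoc PC X Y Z)"
    using unitary_mid by (simp add: mtens_assoc)
next
  fix X Y Z X' Y' Z' f g h
  assume "f \<in> Hom PC X X'" "g \<in> Hom PC Y Y'" "h \<in> Hom PC Z Z'"
  then have *: "f \<in> mhom X X'" "g \<in> mhom Y Y'" "h \<in> mhom Z Z'" by simp_all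
  note i = mtensA_in[OF *(1) mtensA_in[OF *(2,3)]]
  show "comp PC (assoc PC X' Y' Z') (tensA PC (tensA PC f g) h) = comp PC (tensA PC f (tensA PC g
      h)) (assoc PC X Y Z)"
    by (simp add: mtensA_assoc[OF *] mtens_assoc mid_left[OF i] mid_right[OF i])
next
  fix W X Y Z
  show "comp PC (assoc PC W X (tens PC Y Z)) (assoc PC (tens PC W X) Y Z) =
    comp PC (tensA PC (ident PC W) (assoc PC X Y Z)) (comp PC (assoc PC W (tens PC X Y) Z) (tensA
        PC (assoc PC W X Y) (ident PC Z)))"
    by (simp add: mtens_assoc mtensA_mid mid_left[OF mid_in])
qed (use unitary_mid in \<open>simp_all add: mtensA_in mtensA_mid mtensA_comp mtensA_unit mid_left
    mid_right mtens_assoc mid_left[OF mid_in]\<close>)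

section \<open>The braiding and the hexagons\<close>

definition bmat where
  "bmat X Y i j = (if j < length X * length Y \<and> i = (j mod length Y) * length X + j div length Y
      then
       R (lab X (j div length Y)) (lab Y (j mod length Y)) else 0)"

lemma mbraid_simp: "mbraid X Y = (mtens X Y, bmat X Y, mtens Y X)"
  by (simp add: mbraid_def bmat_def fun_eq_iff)

text \<open>The matrix is monomial, with a single nonzero entry in each column and, by
  \<open>bmat_row\<close>, in each row; products with it therefore collapse by
  \<open>sum_column\<close>.\<close>

lemma bmat_col:
  assumes "jx < length X" "jy < length Y"
  shows "bmat X Y i (jx * length Y + jy) = (if i = jy * length X + jx then R (lab X jx) (lab Y jy)
      else 0)"
  using assms by (simp add: bmat_def pair_index_less)

lemma bmat_row:
  assumes "ix < length X" "iy < length Y"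
  shows "bmat X Y (iy * length X + ix) j = (if j = ix * length Y + iy then R (lab X ix) (lab Y iy)
      else 0)"
proof (cases "j < length X * length Y")
  case True
  then obtain jx jy where "j = jx * length Y + jy" "jx < length X" "jy < length Y" by (rule
      pair_indexE)
  then show ?thesis using assms by (auto simp: bmat_col pair_index_eq_iff)
next
  case False
  then show ?thesis using pair_index_less[OF assms] by (auto simp: bmat_def)
qed

lemma lab_mtens_pair:
  "k < length X \<Longrightarrow> l < length Y \<Longrightarrow> lab (mtens X Y) (k * length Y + l) = lab X k + lab Y l"
  by (simp add: lab_mtens pair_index_less)

lemma kron_pair:
  assumes "a < length Y" "b < length Y'" "c < length X" "d < length X'"
  shows "kron X Y X' Y' M M' (a * length Y' + b) (c * length X' + d) =
    R (lab Y' b - lab X' d) (lab X c) * (M a c * M' b d)"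
  using assms by (simp add: kron_def pair_index_less)

lemma supp_bmat: "supp (mtens X Y) (mtens Y X) (bmat X Y)"
  unfolding supp_def
proof (intro allI impI)
  fix i j assume nz: "bmat X Y i j \<noteq> 0"
  then have "j < length X * length Y" by (auto simp: bmat_def split: if_splits)
  then obtain jx jy where j: "j = jx * length Y + jy" "jx < length X" "jy < length Y" by (rule
      pair_indexE)
  then have "i = jy * length X + jx" using nz by (auto simp: bmat_col split: if_splits)
  then show "i < length (mtens Y X) \<and> j < length (mtens X Y) \<and> lab (mtens Y X) i - lab (mtens X Y)
      j \<in> L"
    using j by (simp add: lab_mtens_pair pair_index_less add.commute[of "lab X jx"])
qed

lemma mbraid_in: "mbraid X Y \<in> mhom (mtens X Y) (mtens Y X)"
  by (simp add: mbraid_simp mhomI supp_bmat)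

lemma mhom_eqI:
  assumes "(X, M, Y) \<in> mhom X Y" "(X, N, Y) \<in> mhom X Y"
    and "\<And>i j. i < length Y \<Longrightarrow> j < length X \<Longrightarrow> M i j = N i j"
  shows "(X, M, Y) = (X, N, Y)"
proof -
  have "supp X Y M" "supp X Y N" using assms(1,2) by (auto simp: mhom_def)
  then have "M i j = N i j" for i j using assms(3)[of i j] supp_out by metis
  then show ?thesis by (simp add: fun_eq_iff)
qed

lemma sum_column:
  fixes A B :: "nat \<Rightarrow> complex"
  assumes "p < n" "\<And>k. k < n \<Longrightarrow> B k = (if k = p then w else 0)"
  shows "(\<Sum>k<n. A k * B k) = A p * w"
proof -
  have "(\<Sum>k<n. A k * B k) = (\<Sum>k<n. A k * (if k = p then w else 0))"
    using assms(2) by (intro sum.cong) auto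
  then show ?thesis using assms(1) by (simp add: sum_only)
qed

lemma mbraid_unitary: "unitary PC (mtens X Y) (mtens Y X) (mbraid X Y)"
proof -
  let ?b = "mbraid X Y"
  have a: "adj PC ?b \<in> mhom (mtens Y X) (mtens X Y)"
    by (simp add: mbraid_simp mhomI supp_adj supp_bmat)
  have "mcomp (adj PC ?b) ?b = mid (mtens X Y)"
  proof -
    have 1: "mcomp (adj PC ?b) ?b \<in> mhom (mtens X Y) (mtens X Y)" by (rule mcomp_in[OF mbraid_in a])
    have "(\<Sum>k<length (mtens Y X). cnj (bmat X Y k i) * bmat X Y k j) = (if i = j \<and> j < length
        (mtens X Y) then 1 else 0)"
      if "i < length (mtens X Y)" "j < length (mtens X Y)" for i j
    proof -
      from that obtain jx jy where j: "j = jx * length Y + jy" "jx < length X" "jy < length Y"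
        by (metis length_mtens pair_indexE)
      have "(\<Sum>k<length (mtens Y X). cnj (bmat X Y k i) * bmat X Y k j) =
        cnj (bmat X Y (jy * length X + jx) i) * R (lab X jx) (lab Y jy)"
        by (rule sum_column) (use j in \<open>auto simp: bmat_col pair_index_less\<close>)
      then show ?thesis using j that R_unit by (auto simp: bmat_row)
    qed
    with mhom_eqI[OF 1[unfolded mcomp_def mbraid_simp, simplified] mid_in[unfolded mid_def]]
    show ?thesis by (simp add: mcomp_def mbraid_simp mid_def)
  qed
  moreover have "mcomp ?b (adj PC ?b) = mid (mtens Y X)"
  proof -
    have 1: "mcomp ?b (adj PC ?b) \<in> mhom (mtens Y X) (mtens Y X)" by (rule mcomp_in[OF a mbraid_in])
    have "(\<Sum>k<length (mtens X Y). bmat X Y i k * cnj (bmat X Y j k)) = (if i = j \<and> j < length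
        (mtens Y X) then 1 else 0)"
      if "i < length (mtens Y X)" "j < length (mtens Y X)" for i j
    proof -
      from that obtain jx jy where j: "j = jy * length X + jx" "jx < length X" "jy < length Y"
        by (metis length_mtens pair_indexE)
      have "(\<Sum>k<length (mtens X Y). bmat X Y i k * cnj (bmat X Y j k)) =
        bmat X Y i (jx * length Y + jy) * cnj (R (lab X jx) (lab Y jy))"
        by (rule sum_column) (use j in \<open>auto simp: bmat_row pair_index_less\<close>)
      then show ?thesis using j that R_unit by (auto simp: bmat_col mult.commute)
    qed
    with mhom_eqI[OF 1[unfolded mcomp_def mbraid_simp, simplified] mid_in[unfolded mid_def]]
    show ?thesis by (simp add: mcomp_def mbraid_simp mid_def)
  qed
  ultimately show ?thesis unfolding unitary_def using mbraid_in by simp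
qed

text \<open>With d = x' - x and e = y' - y in L, the phases agree if R(e, x) R(x + d, y + e) = R(d,
  y) R(x, y). Expanding the left side, R(d, e) = 1 by \<open>R_L\<close> and R(e, x) R(x, e) = 1 by
  \<open>R_L_sym\<close>.\<close>

lemma mbraid_natural:
  assumes "f \<in> mhom X X'" "g \<in> mhom Y Y'"
  shows "mcomp (mbraid X' Y') (mtensA f g) = mcomp (mtensA g f) (mbraid X Y)"
proof -
  from assms obtain M N where *: "f = (X, M, X')" "g = (Y, N, Y')" and s: "supp X X' M" "supp Y Y'
      N"
    by (metis mhomE)
  have l: "mcomp (mbraid X' Y') (mtensA f g) \<in> mhom (mtens X Y) (mtens Y' X')"
    and r: "mcomp (mtensA g f) (mbraid X Y) \<in> mhom (mtens X Y) (mtens Y' X')"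
    using assms mcomp_in mtensA_in mbraid_in by blast+
  have "(\<Sum>k<length (mtens X' Y'). bmat X' Y' i k * kron X X' Y Y' M N k j) =
    (\<Sum>k<length (mtens Y X). kron Y Y' X X' N M i k * bmat X Y k j)"
    if "i < length (mtens Y' X')" "j < length (mtens X Y)" for i j
  proof -
    from that obtain ix iy jx jy where
      i: "i = iy * length X' + ix" "ix < length X'" "iy < length Y'" and
      j: "j = jx * length Y + jy" "jx < length X" "jy < length Y"
      by (metis length_mtens pair_indexE)
    have 1: "(\<Sum>k<length (mtens Y X). kron Y Y' X X' N M i k * bmat X Y k j) =
        kron Y Y' X X' N M i (jy * length X + jx) * R (lab X jx) (lab Y jy)"
      by (rule sum_column) (use j in \<open>auto simp: bmat_col pair_index_less\<close>)
    have "(\<Sum>k<length (mtens X' Y'). kron X X' Y Y' M N k j * bmat X' Y' i k) =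
        kron X X' Y Y' M N (ix * length Y' + iy) j * R (lab X' ix) (lab Y' iy)"
      by (rule sum_column) (use i in \<open>auto simp: bmat_row pair_index_less\<close>)
    then have 2: "(\<Sum>k<length (mtens X' Y'). bmat X' Y' i k * kron X X' Y Y' M N k j) =
        R (lab Y' iy - lab Y jy) (lab X jx) * (M ix jx * N iy jy) * R (lab X' ix) (lab Y' iy)"
      using i j by (simp add: kron_pair mult.commute)
    have 3: "kron Y Y' X X' N M i (jy * length X + jx) = R (lab X' ix - lab X jx) (lab Y jy) * (N
        iy jy * M ix jx)"
      using i j by (simp add: kron_pair)
    have "R (lab Y' iy - lab Y jy) (lab X jx) * R (lab X' ix) (lab Y' iy) * (M ix jx * N iy jy) =
      R (lab X' ix - lab X jx) (lab Y jy) * R (lab X jx) (lab Y jy) * (M ix jx * N iy jy)"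
    proof (cases "M ix jx * N iy jy = 0")
      case False
      let ?d = "lab X' ix - lab X jx" and ?e = "lab Y' iy - lab Y jy"
      from False have d: "?d \<in> L" and e: "?e \<in> L" using suppD[OF s(1)] suppD[OF s(2)] by auto
      have "R (lab X' ix) (lab Y' iy) = R (?d + lab X jx) (?e + lab Y jy)" by simp
      also have "\<dots> = R ?d ?e * R ?d (lab Y jy) * (R (lab X jx) ?e * R (lab X jx) (lab Y jy))"
        by (simp only: R_add_left R_add_right mult_ac)
      finally have "R ?e (lab X jx) * R (lab X' ix) (lab Y' iy) =
        (R ?e (lab X jx) * R (lab X jx) ?e) * (R ?d (lab Y jy) * R (lab X jx) (lab Y jy))"
        using R_L[OF d e] by simp
      then show ?thesis using R_L_sym[OF e] by simp
    qed simp
    then show ?thesis unfolding 1 2 3 by (simp add: mult_ac)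
  qed
  with mhom_eqI[OF l[unfolded * mcomp_def mbraid_simp mtensA_simp, simplified] r[unfolded *
      mcomp_def mbraid_simp mtensA_simp, simplified]]
  show ?thesis by (simp add: * mcomp_def mbraid_simp mtensA_simp)
qed

text \<open>The associators are identities, so the hexagon is an equation between two matrices.
  Identities and braidings only connect equal labels, so the extra phase of \<open>mtensA\<close> is
  1 on nonzero entries, and R(x, y) R(x, z) = R(x, y + z) remains.\<close>

lemma mbraid_hexagon:
  "mbraid X (mtens Y Z) = mcomp (mtensA (mid Y) (mbraid X Z)) (mtensA (mbraid X Y) (mid Z))"
proof -
  let ?x = "length X" and ?y = "length Y" and ?z = "length Z"
  let ?one = "\<lambda>X i j. if i = j \<and> j < length X then 1 else 0 :: complex"
  have "mtensA (mid Y) (mbraid X Z) \<in> mhom (mtens (mtens Y X) Z) (mtens (mtens Y Z) X)"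
    using mtensA_in[OF mid_in mbraid_in] by (simp add: mtens_assoc)
  moreover have "mtensA (mbraid X Y) (mid Z) \<in> mhom (mtens X (mtens Y Z)) (mtens (mtens Y X) Z)"
    using mtensA_in[OF mbraid_in mid_in] by (simp flip: mtens_assoc)
  ultimately have r: "mcomp (mtensA (mid Y) (mbraid X Z)) (mtensA (mbraid X Y) (mid Z)) \<in> mhom
      (mtens X (mtens Y Z)) (mtens (mtens Y Z) X)"
    by (rule mcomp_in[rotated])
  have e: "mcomp (mtensA (mid Y) (mbraid X Z)) (mtensA (mbraid X Y) (mid Z)) =
    (mtens X (mtens Y Z), \<lambda>i j. \<Sum>k<?y * ?x * ?z. kron Y Y (mtens X Z) (mtens Z X) (?one Y) (bmat X
        Z) i k *
      kron (mtens X Y) (mtens Y X) Z Z (bmat X Y) (?one Z) k j, mtens (mtens Y Z) X)"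
    by (simp add: mcomp_def mbraid_simp mid_def mtensA_simp mtens_assoc mult.assoc)
  have "bmat X (mtens Y Z) i j = (\<Sum>k<?y * ?x * ?z. kron Y Y (mtens X Z) (mtens Z X) (?one Y) (bmat
      X Z) i k *
      kron (mtens X Y) (mtens Y X) Z Z (bmat X Y) (?one Z) k j)"
    if "i < length (mtens (mtens Y Z) X)" "j < length (mtens X (mtens Y Z))" for i j
  proof -
    from that obtain i' ix j' jx where i': "i = i' * ?x + ix" "ix < ?x" "i' < ?y * ?z"
      and j': "j = jx * length (mtens Y Z) + j'" "jx < ?x" "j' < ?y * ?z" by (metis length_mtens
          pair_indexE)
    obtain iy iz where i: "i' = iy * ?z + iz" "iy < ?y" "iz < ?z" using i'(3) by (rule pair_indexE)
    obtain jy jz where j: "j' = jy * ?z + jz" "jy < ?y" "jz < ?z" using j'(3) by (rule pair_indexE)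
    have i2: "i = iy * length (mtens Z X) + (iz * ?x + ix)" using i i' by (simp add: algebra_simps)
    have j2: "j = (jx * ?y + jy) * ?z + jz" using j j' by (simp add: algebra_simps)
    \<comment> \<open>The code of (jy, jx, jz) in Y \<otimes> X \<otimes> Z, the only intermediate
      index reached from column j.\<close>
    let ?p = "(jy * ?x + jx) * ?z + jz"
    have p2: "?p = jy * length (mtens X Z) + (jx * ?z + jz)" by (simp add: algebra_simps)
    have "(\<Sum>k<?y * ?x * ?z. kron Y Y (mtens X Z) (mtens Z X) (?one Y) (bmat X Z) i k *
      kron (mtens X Y) (mtens Y X) Z Z (bmat X Y) (?one Z) k j) =
      kron Y Y (mtens X Z) (mtens Z X) (?one Y) (bmat X Z) i ?p * R (lab X jx) (lab Y jy)"
    proof (rule sum_column)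
      show "?p < ?y * ?x * ?z" using j j'(2) by (simp add: pair_index_less)
      fix k assume "k < ?y * ?x * ?z"
      then obtain k' kz where k: "k = k' * ?z + kz" "k' < ?y * ?x" "kz < ?z" by (rule pair_indexE)
      have "kron (mtens X Y) (mtens Y X) Z Z (bmat X Y) (?one Z) k j =
        R (lab Z kz - lab Z jz) (lab (mtens X Y) (jx * ?y + jy)) * (bmat X Y k' (jx * ?y + jy) *
            ?one Z kz jz)"
        unfolding k(1) j2 using k(2,3) j(2,3) j'(2) by (intro kron_pair) (auto simp:
            pair_index_less)
      then show "kron (mtens X Y) (mtens Y X) Z Z (bmat X Y) (?one Z) k j = (if k = ?p then R (lab
          X jx) (lab Y jy) else 0)"
        using k j(2,3) j'(2) by (auto simp: bmat_col pair_index_eq_iff)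
    qed
    also have "kron Y Y (mtens X Z) (mtens Z X) (?one Y) (bmat X Z) i ?p =
      R (lab (mtens Z X) (iz * ?x + ix) - lab (mtens X Z) (jx * ?z + jz)) (lab Y jy) *
      (?one Y iy jy * bmat X Z (iz * ?x + ix) (jx * ?z + jz))"
      unfolding i2 p2 using i(2,3) j(2,3) i'(2) j'(2) by (intro kron_pair) (auto simp:
          pair_index_less)
    also have "\<dots> * R (lab X jx) (lab Y jy) = (if iy = jy \<and> iz = jz \<and> ix = jx then R (lab X jx)
        (lab Y jy + lab Z jz) else 0)"
      using i(2,3) j(2,3) i'(2) j'(2)
      by (auto simp: bmat_col pair_index_eq_iff lab_mtens_pair R_add_right add.commute[of "lab Z
          jz"])
    also have "\<dots> = bmat X (mtens Y Z) i j"
      using i(2,3) j(2,3) i'(2,3) j'(2,3) unfolding i'(1) j'(1) i(1) j(1)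
      by (subst bmat_col) (auto simp: pair_index_eq_iff lab_mtens_pair)
    finally show ?thesis by simp
  qed
  with mhom_eqI[OF mbraid_in[of X "mtens Y Z", unfolded mbraid_simp] r[unfolded e]]
  show ?thesis unfolding e by (simp add: mbraid_simp)
qed

lemma mbraid_hexagon_inv:
  "mbraid (mtens X Y) Z = mcomp (mtensA (mbraid X Z) (mid Y)) (mtensA (mid X) (mbraid Y Z))"
proof -
  let ?x = "length X" and ?y = "length Y" and ?z = "length Z"
  let ?one = "\<lambda>X i j. if i = j \<and> j < length X then 1 else 0 :: complex"
  have "mtensA (mbraid X Z) (mid Y) \<in> mhom (mtens X (mtens Z Y)) (mtens Z (mtens X Y))"
    using mtensA_in[OF mbraid_in mid_in] by (simp flip: mtens_assoc)
  moreover have "mtensA (mid X) (mbraid Y Z) \<in> mhom (mtens (mtens X Y) Z) (mtens X (mtens Z Y))"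
    using mtensA_in[OF mid_in mbraid_in] by (simp add: mtens_assoc)
  ultimately have r: "mcomp (mtensA (mbraid X Z) (mid Y)) (mtensA (mid X) (mbraid Y Z)) \<in> mhom
      (mtens (mtens X Y) Z) (mtens Z (mtens X Y))"
    by (rule mcomp_in[rotated])
  have e: "mcomp (mtensA (mbraid X Z) (mid Y)) (mtensA (mid X) (mbraid Y Z)) =
    (mtens (mtens X Y) Z, \<lambda>i j. \<Sum>k<?x * (?z * ?y). kron (mtens X Z) (mtens Z X) Y Y (bmat X Z)
        (?one Y) i k *
      kron X X (mtens Y Z) (mtens Z Y) (?one X) (bmat Y Z) k j, mtens Z (mtens X Y))"
    by (simp add: mcomp_def mbraid_simp mid_def mtensA_simp mtens_assoc)
  have "bmat (mtens X Y) Z i j = (\<Sum>k<?x * (?z * ?y). kron (mtens X Z) (mtens Z X) Y Y (bmat X Z)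
      (?one Y) i k *
      kron X X (mtens Y Z) (mtens Z Y) (?one X) (bmat Y Z) k j)"
    if "i < length (mtens Z (mtens X Y))" "j < length (mtens (mtens X Y) Z)" for i j
  proof -
    from that obtain i' iz j' jz where i': "i = iz * length (mtens X Y) + i'" "iz < ?z" "i' < ?x *
        ?y"
      and j': "j = j' * ?z + jz" "jz < ?z" "j' < ?x * ?y" by (metis length_mtens pair_indexE)
    obtain ix iy where i: "i' = ix * ?y + iy" "ix < ?x" "iy < ?y" using i'(3) by (rule pair_indexE)
    obtain jx jy where j: "j' = jx * ?y + jy" "jx < ?x" "jy < ?y" using j'(3) by (rule pair_indexE)
    have i2: "i = (iz * ?x + ix) * ?y + iy" using i i' by (simp add: algebra_simps)
    have j2: "j = jx * length (mtens Y Z) + (jy * ?z + jz)" using j j' by (simp add: algebra_simps)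
    \<comment> \<open>The code of (jx, jz, jy) in X \<otimes> Z \<otimes> Y; the second hexagon uses
      additivity of R in its first argument.\<close>
    let ?p = "jx * length (mtens Z Y) + (jz * ?y + jy)"
    have p2: "?p = (jx * ?z + jz) * ?y + jy" by (simp add: algebra_simps)
    have "(\<Sum>k<?x * (?z * ?y). kron (mtens X Z) (mtens Z X) Y Y (bmat X Z) (?one Y) i k *
      kron X X (mtens Y Z) (mtens Z Y) (?one X) (bmat Y Z) k j) =
      kron (mtens X Z) (mtens Z X) Y Y (bmat X Z) (?one Y) i ?p * R (lab Y jy) (lab Z jz)"
    proof (rule sum_column)
      have "jz * ?y + jy < ?z * ?y" using j j' by (simp add: pair_index_less)
      then show "?p < ?x * (?z * ?y)" using j(2) pair_index_less[of jx ?x _ "?z * ?y"] by simp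
      fix k assume "k < ?x * (?z * ?y)"
      then obtain kx k' where k: "k = kx * (?z * ?y) + k'" "kx < ?x" "k' < ?z * ?y" by (rule
          pair_indexE)
      have k2: "k = kx * length (mtens Z Y) + k'" using k(1) by simp
      have "kron X X (mtens Y Z) (mtens Z Y) (?one X) (bmat Y Z) k j =
        R (lab (mtens Z Y) k' - lab (mtens Y Z) (jy * ?z + jz)) (lab X jx) * (?one X kx jx * bmat
            Y Z k' (jy * ?z + jz))"
        unfolding k2 j2 using k(2,3) j(2,3) j'(2) by (intro kron_pair) (auto simp: pair_index_less)
      then show "kron X X (mtens Y Z) (mtens Z Y) (?one X) (bmat Y Z) k j = (if k = ?p then R (lab
          Y jy) (lab Z jz) else 0)"
        using k(2,3) j(2,3) j'(2) unfolding k2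
        by (auto simp: bmat_col pair_index_eq_iff lab_mtens_pair add.commute[of "lab Z jz"]
            pair_index_less)
    qed
    also have "kron (mtens X Z) (mtens Z X) Y Y (bmat X Z) (?one Y) i ?p =
      R (lab Y iy - lab Y jy) (lab (mtens X Z) (jx * ?z + jz)) *
      (bmat X Z (iz * ?x + ix) (jx * ?z + jz) * ?one Y iy jy)"
      unfolding i2 p2 using i(2,3) j(2,3) i'(2) j'(2) by (intro kron_pair) (auto simp:
          pair_index_less)
    also have "\<dots> * R (lab Y jy) (lab Z jz) = (if iy = jy \<and> iz = jz \<and> ix = jx then R (lab X jx +
        lab Y jy) (lab Z jz) else 0)"
      using i(2,3) j(2,3) i'(2) j'(2)
      by (auto simp: bmat_col pair_index_eq_iff R_add_left)
    also have "\<dots> = bmat (mtens X Y) Z i j"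
      using i(2,3) j(2,3) i'(2,3) j'(2,3) unfolding i'(1) j'(1) i(1) j(1)
      by (subst bmat_col) (auto simp: pair_index_eq_iff lab_mtens_pair)
    finally show ?thesis by simp
  qed
  with mhom_eqI[OF mbraid_in[of "mtens X Y" Z, unfolded mbraid_simp] r[unfolded e]]
  show ?thesis unfolding e by (simp add: mbraid_simp)
qed

lemma unitary_braided_category_PC: "unitary_braided_category PC"
proof (intro unitary_braided_category.intro unitary_monoidal_category_PC
    unitary_braided_category_axioms.intro)
  fix X Y Z
  have b: "mbraid X (mtens Y Z) \<in> mhom (mtens X (mtens Y Z)) (mtens Y (mtens Z X))"
    using mbraid_in[of X "mtens Y Z"] by (simp add: mtens_assoc)
  have c: "mtensA (mbraid X Y) (mid Z) \<in> mhom (mtens X (mtens Y Z)) (mtens Y (mtens X Z))"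
    using mtensA_in[OF mbraid_in[of X Y] mid_in[of Z]] unfolding mtens_assoc .
  show "comp PC (assoc PC Y Z X) (comp PC (braid PC X (tens PC Y Z)) (assoc PC X Y Z)) =
    comp PC (tensA PC (ident PC Y) (braid PC X Z)) (comp PC (assoc PC Y X Z) (tensA PC (braid PC X
        Y) (ident PC Z)))"
    using mid_left[OF b] mid_right[OF b] mid_left[OF c] mbraid_hexagon[of X Y Z] by (simp add:
        mtens_assoc)
  have b: "mbraid (mtens X Y) Z \<in> mhom (mtens X (mtens Y Z)) (mtens Z (mtens X Y))"
    using mbraid_in[of "mtens X Y" Z] by (simp add: mtens_assoc)
  have c: "mtensA (mid X) (mbraid Y Z) \<in> mhom (mtens X (mtens Y Z)) (mtens X (mtens Z Y))"
    using mtensA_in[OF mid_in mbraid_in] by (simp add: mtens_assoc)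
  show "comp PC (adj PC (assoc PC Z X Y)) (comp PC (braid PC (tens PC X Y) Z) (adj PC (assoc PC X
      Y Z))) =
    comp PC (tensA PC (braid PC X Z) (ident PC Y)) (comp PC (adj PC (assoc PC X Z Y)) (tensA PC
        (ident PC X) (braid PC Y Z)))"
    using mid_left[OF b] mid_right[OF b] mid_left[OF c] mbraid_hexagon_inv[of X Y Z]
    by (simp add: mtens_assoc adj_mid del: PC_simps(8))
qed (use mbraid_unitary mbraid_natural in simp_all)

section \<open>Direct sums and simple objects\<close>

lemma hsum_PC: "hsum PC X Y f n = (X, \<lambda>i j. \<Sum>k<n. fst (snd (f k)) i j, Y)"
  by (induction n) (simp_all add: fun_eq_iff)

lemma zero_object_PC: "\<exists>Z S p. direct_sum PC 0 S p Z"
proof -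
  have "direct_sum PC 0 (\<lambda>_. []) (\<lambda>_. mid []) []"
    unfolding direct_sum_def hsum_PC by (simp add: mid_def)
  then show ?thesis by blast
qed

text \<open>Concatenation of lists is the direct sum; P and Q are the inclusions of the two
  blocks.\<close>

lemma binary_sum_PC: "\<exists>Z S p. S 0 = X \<and> S 1 = Y \<and> direct_sum PC 2 S p Z"
proof -
  let ?Z = "X @ Y" and ?n = "length X + length Y"
  define P where "P = (\<lambda>i j. if i = j \<and> j < length X then 1 else 0 :: complex)"
  define Q where "Q = (\<lambda>i j. if i = length X + j \<and> j < length Y then 1 else 0 :: complex)"
  let ?S = "\<lambda>i::nat. if i = 0 then X else Y"
  let ?p = "\<lambda>i::nat. if i = 0 then (X, P, ?Z) else (Y, Q, ?Z)"
  have lab: "j < length X \<Longrightarrow> lab ?Z j = lab X j" "lab ?Z (length X + j) = lab Y j" for j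
    by (simp_all add: lab_def nth_append)
  have s: "supp X ?Z P" "supp Y ?Z Q" by (auto simp: supp_def lab P_def Q_def)
  have 1: "(\<Sum>k<?n. cnj (P k i) * P k j) = (if i = j \<and> j < length X then 1 else 0)" for i j
  proof (cases "j < length X")
    case True
    have "(\<Sum>k<?n. cnj (P k i) * P k j) = cnj (P j i) * 1"
      by (rule sum_column) (use True in \<open>auto simp: P_def\<close>)
    then show ?thesis using True by (auto simp: P_def)
  qed (simp add: P_def)
  have 2: "(\<Sum>k<?n. cnj (Q k i) * Q k j) = (if i = j \<and> j < length Y then 1 else 0)" for i j
  proof (cases "j < length Y")
    case True
    have "(\<Sum>k<?n. cnj (Q k i) * Q k j) = cnj (Q (length X + j) i) * 1"
      by (rule sum_column) (use True in \<open>auto simp: Q_def\<close>)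
    then show ?thesis using True by (auto simp: Q_def)
  qed (simp add: Q_def)
  have 3: "(\<Sum>k<?n. cnj (P k i) * Q k j) = 0" "(\<Sum>k<?n. cnj (Q k i) * P k j) = 0" for i j
    by (auto intro!: sum.neutral simp: P_def Q_def)
  have 4: "(\<Sum>k<length X. P i k * cnj (P j k)) + (\<Sum>k<length Y. Q i k * cnj (Q j k))
     = (if i = j \<and> j < ?n then 1 else 0)" for i j
  proof -
    have a: "(\<Sum>k<length X. P i k * cnj (P j k)) = (if j < length X then P i j else 0)"
    proof (cases "j < length X")
      case True
      have "(\<Sum>k<length X. P i k * cnj (P j k)) = P i j * 1"
        by (rule sum_column) (use True in \<open>auto simp: P_def\<close>)
      then show ?thesis using True by simp
    qed (auto intro!: sum.neutral simp: P_def)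
    have b: "(\<Sum>k<length Y. Q i k * cnj (Q j k)) = (if length X \<le> j \<and> j < ?n then Q i (j - length
        X) else 0)"
    proof (cases "length X \<le> j \<and> j < ?n")
      case True
      have "(\<Sum>k<length Y. Q i k * cnj (Q j k)) = Q i (j - length X) * 1"
        by (rule sum_column) (use True in \<open>auto simp: Q_def\<close>)
      then show ?thesis using True by simp
    qed (auto intro!: sum.neutral simp: Q_def)
    show ?thesis unfolding a b by (auto simp: P_def Q_def)
  qed
  have "comp PC (adj PC (?p i)) (?p j) = (if i = j then mid (?S i) else hzero PC (?S j) (?S i))"
    if "i < 2" "j < 2" for i j
    using that by (auto simp: less_2_cases_iff mcomp_def mid_def fun_eq_iff 1 2 3)
  moreover have "hsum PC ?Z ?Z (\<lambda>i. comp PC (?p i) (adj PC (?p i))) 2 = mid ?Z"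
    unfolding hsum_PC by (simp add: numeral_2_eq_2 mcomp_def mid_def fun_eq_iff 4)
  moreover have "?p i \<in> mhom (?S i) ?Z" for i using s mhomI by simp
  ultimately have "direct_sum PC 2 ?S ?p ?Z"
    unfolding direct_sum_def by simp
  then show ?thesis by (intro exI[of _ ?Z] exI[of _ ?S] exI[of _ ?p]) simp
qed

lemma simple_PC_iff: "simple PC X \<longleftrightarrow> length X = 1"
proof
  assume X: "simple PC X"
  then have nz: "mid X \<noteq> (X, \<lambda>i j. 0, X)" and sc: "\<And>f. f \<in> mhom X X \<Longrightarrow> \<exists>k. f = hscale PC k (mid X)"
    by (auto simp: simple_def)
  have "length X \<noteq> 0" using nz by (auto simp: mid_def)
  moreover have "\<not> length X \<ge> 2"
  proof
    assume "length X \<ge> 2"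
    \<comment> \<open>A diagonal matrix unit is always admissible. It is not a multiple of the
      identity, as its entries at (0, 0) and (1, 1) differ.\<close>
    let ?E = "\<lambda>i j. if i = 0 \<and> j = 0 then 1 else 0 :: complex"
    have "supp X X ?E" using \<open>length X \<ge> 2\<close> by (auto simp: supp_def)
    then obtain k where "(X, ?E, X) = hscale PC k (mid X)" using sc mhomI by blast
    then have "?E i j = k * (if i = j \<and> j < length X then 1 else 0)" for i j
      by (simp add: mid_def fun_eq_iff)
    from this[of 0 0] this[of 1 1] show False using \<open>length X \<ge> 2\<close> by auto
  qed
  ultimately show "length X = 1" by linarith
next
  assume l: "length X = 1"
  have "\<exists>k. f = hscale PC k (mid X)" if "f \<in> mhom X X" for f
  proof -
    from that obtain M where M: "f = (X, M, X)" "supp X X M" by (rule mhomE)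
    define c where "c = M 0 0"
    have "M i j = c * (if i = j \<and> j < length X then 1 else 0)" for i j
      using supp_out[OF M(2), of i j] l by (auto simp: c_def)
    then have "M = (\<lambda>i j. c * (if i = j \<and> j < length X then 1 else 0))" by (intro ext)
    then show ?thesis unfolding M(1) by (intro exI[of _ c]) (simp add: mid_def)
  qed
  moreover have "hscale PC k (mid X) \<in> mhom X X" for k
    by (auto simp: mid_def mhom_def supp_def)
  moreover have "mid X \<noteq> hzero PC X X"
    using l by (auto simp: mid_def fun_eq_iff)
  ultimately show "simple PC X" unfolding simple_def by auto
qed

lemma semisimple_PC: "\<exists>n S p. (\<forall>i<n. simple PC (S i)) \<and> direct_sum PC n S p X"
proof -
  let ?n = "length X"
  let ?S = "\<lambda>i. [X ! i]"
  define M where "M = (\<lambda>i r j. if r = i \<and> j = (0::nat) \<and> i < ?n then 1 else 0 :: complex)"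
  let ?p = "\<lambda>i. (?S i, M i, X)"
  have s: "supp (?S i) X (M i)" for i by (auto simp: supp_def lab_def M_def)
  have 1: "(\<Sum>r<?n. cnj (M i r a) * M j r b) = (if i = j \<and> a = 0 \<and> b = 0 then 1 else 0)"
    if "i < ?n" "j < ?n" for i j a b
  proof (cases "b = 0")
    case True
    have "(\<Sum>r<?n. cnj (M i r a) * M j r b) = cnj (M i j a) * 1"
      by (rule sum_column) (use that True in \<open>auto simp: M_def\<close>)
    then show ?thesis using that True by (auto simp: M_def)
  qed (simp add: M_def)
  have 2: "(\<Sum>k<?n. M k i 0 * cnj (M k j 0)) = (if i = j \<and> j < ?n then 1 else 0)" for i j
  proof (cases "j < ?n")
    case True
    have "(\<Sum>k<?n. M k i 0 * cnj (M k j 0)) = M j i 0 * 1"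
      by (rule sum_column) (use True in \<open>auto simp: M_def\<close>)
    then show ?thesis using True by (auto simp: M_def)
  qed (auto intro!: sum.neutral simp: M_def)
  have "comp PC (adj PC (?p i)) (?p j) = (if i = j then mid (?S i) else hzero PC (?S j) (?S i))"
    if "i < ?n" "j < ?n" for i j
    using that by (auto simp: mcomp_def mid_def fun_eq_iff 1)
  moreover have "hsum PC X X (\<lambda>i. comp PC (?p i) (adj PC (?p i))) ?n = mid X"
    unfolding hsum_PC by (simp add: mcomp_def mid_def fun_eq_iff 2)
  ultimately have "direct_sum PC ?n ?S ?p X"
    unfolding direct_sum_def using s mhomI by simp
  then show ?thesis using simple_PC_iff by (intro exI[of _ ?n] exI[of _ ?S] exI[of _ ?p]) simp
qed

section \<open>Duals\<close>

definition cap :: "nat \<Rightarrow> nat \<Rightarrow> nat \<Rightarrow> complex" where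
  "cap n i j = (if j = 0 \<and> i < n * n \<and> i div n = i mod n then 1 else 0)"

text \<open>\<open>cap\<close> is the column vector of the sum of e_k \<otimes> e_k. On these
  diagonal pairs the labels x and -x add up to 0, so the vector is an admissible arrow from the
  unit, and the extra phases of \<open>mtensA\<close> are trivial. Exchanging X and X' yields the
  other zigzag.\<close>

lemma cap_zigzag:
  assumes l: "length X' = length X" and neg: "\<And>k. k < length X \<Longrightarrow> lab X' k = - lab X k"
  defines "s \<equiv> ([enc 0], cap (length X), mtens X X')" and "r \<equiv> ([enc 0], cap (length X), mtens X'
      X)"
  shows "s \<in> mhom [enc 0] (mtens X X')" "r \<in> mhom [enc 0] (mtens X' X)"
    "mcomp (mtensA (adj PC s) (mid X)) (mtensA (mid X) r) = mid X"
proof -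
  let ?n = "length X" and ?I = "[enc 0]"
  let ?one = "\<lambda>i j. if i = j \<and> j < ?n then 1 else 0 :: complex"
  have lab0: "lab ?I 0 = 0" by (simp add: lab_def)
  have diag: "lab (mtens X X') (k * ?n + k) = 0" "lab (mtens X' X) (k * ?n + k) = 0" if "k < ?n"
      for k
    using lab_mtens_pair[of k X k X'] lab_mtens_pair[of k X' k X] that l neg by simp_all
  have cap: "cap ?n (a * ?n + b) j = (if j = 0 \<and> a = b then 1 else 0)" if "a < ?n" "b < ?n" for a
      b j
    using that by (auto simp: cap_def pair_index_less)
  have sup: "i < ?n * ?n \<and> j < 1 \<and> lab (mtens X X') i - lab ?I j \<in> L \<and> lab (mtens X' X) i - lab ?I
      j \<in> L"
    if "cap ?n i j \<noteq> 0" for i j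
  proof -
    have i: "i < ?n * ?n" "j = 0" using that by (auto simp: cap_def split: if_splits)
    then obtain a b where ab: "i = a * ?n + b" "a < ?n" "b < ?n" by (metis pair_indexE)
    then have "a = b" using that cap[of a b j] by (auto split: if_splits)
    then show ?thesis using i ab diag lab0 by simp
  qed
  then have ss: "supp ?I (mtens X X') (cap ?n)" and sr: "supp ?I (mtens X' X) (cap ?n)"
    by (auto simp: supp_def l)
  show s: "s \<in> mhom [enc 0] (mtens X X')" and r: "r \<in> mhom [enc 0] (mtens X' X)"
    unfolding s_def r_def using ss sr by (simp_all add: mhomI)
  have "mtensA (adj PC s) (mid X) \<in> mhom (mtens (mtens X X') X) (mtens ?I X)"
    using ss by (intro mtensA_in mid_in) (simp add: s_def mhomI supp_adj)
  then have A: "mtensA (adj PC s) (mid X) \<in> mhom (mtens X (mtens X' X)) X" by (simp add: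
      mtens_assoc)
  have "mtensA (mid X) r \<in> mhom (mtens X ?I) (mtens X (mtens X' X))" by (rule mtensA_in[OF mid_in
      r])
  then have B: "mtensA (mid X) r \<in> mhom X (mtens X (mtens X' X))" by simp
  have e: "mcomp (mtensA (adj PC s) (mid X)) (mtensA (mid X) r) =
    (X, \<lambda>i j. \<Sum>k<?n * ?n * ?n. kron (mtens X X') ?I X X (\<lambda>i j. cnj (cap ?n j i)) ?one i k *
      kron X X ?I (mtens X' X) ?one (cap ?n) k j, X)"
    by (simp add: mcomp_def s_def r_def mid_def mtensA_simp l mult.assoc)
  have "(\<Sum>k<?n * ?n * ?n. kron (mtens X X') ?I X X (\<lambda>i j. cnj (cap ?n j i)) ?one i k *
      kron X X ?I (mtens X' X) ?one (cap ?n) k j) = ?one i j" if ij: "i < ?n" "j < ?n" for i j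
  proof -
    \<comment> \<open>For an intermediate index (a, b, c) the left factor requires a = b and c = i,
      the right one a = j and b = c. Only (j, i, i) can survive, and only if i = j.\<close>
    let ?p = "(j * ?n + i) * ?n + i"
    have "kron (mtens X X') ?I X X (\<lambda>i j. cnj (cap ?n j i)) ?one i k * kron X X ?I (mtens X' X)
        ?one (cap ?n) k j
      = 1 * (if k = ?p then ?one i j else 0)" if k: "k < ?n * ?n * ?n" for k
    proof -
      obtain ab c where k1: "k = ab * ?n + c" "ab < ?n * ?n" "c < ?n" using k by (rule pair_indexE)
      obtain a b where k2: "ab = a * ?n + b" "a < ?n" "b < ?n" using k1(2) by (rule pair_indexE)
      have k3: "k = a * length (mtens X' X) + (b * ?n + c)" using k1 k2 l by (simp add:
          algebra_simps)
      have bc: "b * ?n + c < length (mtens X' X)" using k1 k2 l by (simp add: pair_index_less)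
      have "kron (mtens X X') ?I X X (\<lambda>i j. cnj (cap ?n j i)) ?one (0 * ?n + i) (ab * ?n + c) =
        R (lab X i - lab X c) (lab (mtens X X') ab) * (cnj (cap ?n ab 0) * ?one i c)"
        using k1 k2 ij l by (intro kron_pair) auto
      then have 1: "kron (mtens X X') ?I X X (\<lambda>i j. cnj (cap ?n j i)) ?one i k = (if a = b \<and> i = c
          then 1 else 0)"
        using k1 k2 ij cap by auto
      have "kron X X ?I (mtens X' X) ?one (cap ?n) (a * length (mtens X' X) + (b * ?n + c)) (j *
          length ?I + 0) =
        R (lab (mtens X' X) (b * ?n + c) - lab ?I 0) (lab X j) * (?one a j * cap ?n (b * ?n + c) 0)"
        using k1 k2 ij bc by (intro kron_pair) auto
      then have "kron X X ?I (mtens X' X) ?one (cap ?n) k j =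
        R (lab (mtens X' X) (b * ?n + c)) (lab X j) * (?one a j * (if b = c then 1 else 0))"
        using k1 k2 cap lab0 by (simp add: k3)
      then have 2: "kron X X ?I (mtens X' X) ?one (cap ?n) k j = (if a = j \<and> b = c then 1 else 0)"
        using diag(2) ij k2 by auto
      show ?thesis unfolding 1 2 unfolding k1(1) k2(1) using k1(3) k2(3) ij
        by (auto simp: pair_index_eq_iff)
    qed
    then have "(\<Sum>k<?n * ?n * ?n. kron (mtens X X') ?I X X (\<lambda>i j. cnj (cap ?n j i)) ?one i k *
      kron X X ?I (mtens X' X) ?one (cap ?n) k j) = (\<Sum>k<?n * ?n * ?n. 1 * (if k = ?p then ?one i j
          else 0))"
      by (intro sum.cong) auto
    also have "\<dots> = ?one i j"
      unfolding sum_only using ij by (simp add: pair_index_less)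
    finally show ?thesis .
  qed
  with mhom_eqI[OF mcomp_in[OF B A, unfolded e] mid_in[of X, unfolded mid_def]]
  show "mcomp (mtensA (adj PC s) (mid X)) (mtensA (mid X) r) = mid X"
    unfolding e by (simp add: mid_def)
qed

lemma rigid_PC: "\<exists>X' r s. dual_pair PC X X' r s"
proof -
  define X' where "X' = map (\<lambda>k. enc (- dec k)) X"
  have l: "length X' = length X" by (simp add: X'_def)
  have neg: "lab X' k = - lab X k" if "k < length X" for k using that by (simp add: X'_def lab_def)
  define s where "s = ([enc 0], cap (length X), mtens X X')"
  define r where "r = ([enc 0], cap (length X), mtens X' X)"
  note z1 = cap_zigzag[OF l neg, folded s_def r_def]
  have neg': "lab X k = - lab X' k" if "k < length X'" for k using that neg l by simp
  note z2 = cap_zigzag(3)[OF l[symmetric] neg', unfolded l, folded s_def r_def]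
  have "dual_pair PC X X' r s"
  proof -
    have a: "mtensA (mid Y) t \<in> mhom Y (mtens Y Z)" if "t \<in> mhom [enc 0] Z" for Y Z t
      using mtensA_in[OF mid_in[of Y] that] by simp
    have mids: "mcomp (mid Y) (mcomp f (mcomp (mid Z) (mcomp g (mid W)))) = mcomp f g"
      if "f \<in> mhom Z Y" "g \<in> mhom W Z" for Y Z W f g
      using mid_left[OF mcomp_in[OF that(2,1)]] mid_left[OF that(2)] mid_right[OF that(2)] by simp
    have adj: "adj PC t \<in> mhom Z [enc 0]" if "t \<in> mhom [enc 0] Z" for Z t
      using that by (auto elim!: mhomE intro!: mhomI supp_adj)
    have b: "mtensA (adj PC t) (mid Y) \<in> mhom (mtens Z Y) Y" if "t \<in> mhom [enc 0] Z" for Y Z t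
      using mtensA_in[OF adj[OF that] mid_in[of Y]] by simp
    have 1: "mcomp (mid X) (mcomp (mtensA (adj PC s) (mid X)) (mcomp (mid (mtens (mtens X X') X))
       (mcomp (mtensA (mid X) r) (mid X)))) = mid X"
      using mids[OF b[OF z1(1)], of "mtensA (mid X) r" X X] a[OF z1(2), of X] z1(3) by (simp add:
          mtens_assoc)
    have 2: "mcomp (mid X') (mcomp (mtensA (adj PC r) (mid X')) (mcomp (mid (mtens (mtens X' X) X'))
       (mcomp (mtensA (mid X') s) (mid X')))) = mid X'"
      using mids[OF b[OF z1(2)], of "mtensA (mid X') s" X' X'] a[OF z1(1), of X'] z2 by (simp add:
          mtens_assoc)
    show ?thesis unfolding dual_pair_def
      using 1 2 z1(1,2) by (simp add: adj_mid del: PC_simps(8))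
  qed
  then show ?thesis by blast
qed

section \<open>Anyons, twists and braidings of the pointed category\<close>

lemma isomorphic_PC: "isomorphic PC [m] [n] \<longleftrightarrow> dec n - dec m \<in> L"
proof
  assume "isomorphic PC [m] [n]"
  then obtain f g where f: "f \<in> mhom [m] [n]" and g: "g \<in> mhom [n] [m]" and gf: "mcomp g f = mid
      [m]"
    by (auto simp: isomorphic_def)
  obtain M where M: "f = ([m], M, [n])" "supp [m] [n] M" using f by (rule mhomE)
  obtain N where N: "g = ([n], N, [m])" using g by (rule mhomE)
  have "(\<lambda>i j. \<Sum>k<1. N i k * M k j) = (\<lambda>i j. if i = j \<and> j < 1 then 1 else 0)"
    using gf by (simp add: M N mcomp_def mid_def)
  from fun_cong[OF fun_cong[OF this], of 0 0] have "M 0 0 \<noteq> 0" by auto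
  then show "dec n - dec m \<in> L" using suppD[OF M(2), of 0 0] by (simp add: lab_def)
next
  assume d: "dec n - dec m \<in> L"
  let ?M = "\<lambda>i j. if i = 0 \<and> j = 0 then 1 else 0 :: complex"
  have "supp [m] [n] ?M" "supp [n] [m] ?M" using d L_uminus[OF d] by (auto simp: supp_def lab_def)
  moreover have "mcomp ([n], ?M, [m]) ([m], ?M, [n]) = mid [m]" "mcomp ([m], ?M, [n]) ([n], ?M,
      [m]) = mid [n]"
    by (auto simp: mcomp_def mid_def fun_eq_iff)
  ultimately show "isomorphic PC [m] [n]" unfolding isomorphic_def using mhomI by fastforce
qed

definition cls :: "'l \<Rightarrow> nat list set" where
  "cls x = {[m] | m. dec m - x \<in> L}"

lemma cls_eq_iff: "cls x = cls y \<longleftrightarrow> x - y \<in> L"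
proof
  assume "cls x = cls y"
  moreover have "[enc x] \<in> cls x" by (simp add: cls_def)
  ultimately show "x - y \<in> L" by (simp add: cls_def)
next
  assume d: "x - y \<in> L"
  have "dec m - x \<in> L \<longleftrightarrow> dec m - y \<in> L" for m
    using L_add[OF _ d, of "dec m - x"] L_diff[OF _ d, of "dec m - y"] by auto
  then show "cls x = cls y" by (simp add: cls_def)
qed

lemma anyon_rel_PC: "anyon_rel PC `` {[n]} = cls (dec n)"
  unfolding anyon_rel_def cls_def
  by (auto simp: simple_PC_iff isomorphic_PC length_Suc_conv)

lemma anyons_PC: "anyons PC = range cls"
proof -
  have "anyons PC = (\<lambda>n. anyon_rel PC `` {[n]}) ` UNIV"
  proof -
    have "{X. simple PC X} = range (\<lambda>n. [n])" by (auto simp: simple_PC_iff length_Suc_conv)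
    then show ?thesis unfolding anyons_def quotient_def by auto
  qed
  also have "\<dots> = range cls" unfolding anyon_rel_PC by (metis dec_enc surj_def image_image)
  finally show ?thesis .
qed

lemma unitary_braided_fusion_category_PC: "unitary_braided_fusion_category PC"
proof (intro unitary_braided_fusion_category.intro unitary_braided_category_PC
    unitary_braided_fusion_category_axioms.intro zero_object_PC binary_sum_PC semisimple_PC
        rigid_PC)
  obtain T where T: "finite T" "\<forall>x. \<exists>t\<in>T. x - t \<in> L" using L_index by blast
  have "range cls \<subseteq> cls ` T"
  proof
    fix c assume "c \<in> range cls"
    then obtain x where x: "c = cls x" by blast
    obtain t where "t \<in> T" "x - t \<in> L" using T(2) by blast
    then show "c \<in> cls ` T" unfolding x cls_eq_iff[symmetric] by blast
  qed
  then show "finite (anyons PC)" unfolding anyons_PC using T(1) finite_surj by blast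
  show "simple PC (tunit PC)" by (simp add: simple_PC_iff)
qed

lemma rep_cls: "\<exists>m. rep (cls x) = [m] \<and> dec m - x \<in> L"
proof -
  have "[enc x] \<in> cls x" by (simp add: cls_def)
  then have "rep (cls x) \<in> cls x" unfolding rep_def by (rule someI)
  then show ?thesis by (auto simp: cls_def)
qed

lemma mtens_singleton: "mtens [m] [n] = [enc (dec m + dec n)]"
  by (simp add: mtens_def lab_def)

lemma mbraid_singleton: "mbraid [m] [n] = hscale PC (R (dec m) (dec n)) (mid (mtens [m] [n]))"
  by (auto simp: mbraid_def mid_def mtens_singleton fun_eq_iff lab_def add.commute)

lemma invertible_singleton: "unitary_monoidal_category.invertible PC [n]"
proof -
  have "isomorphic PC (mtens [n] [enc (- dec n)]) [enc 0]"
    by (simp add: mtens_singleton isomorphic_PC)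
  then show ?thesis
    unfolding unitary_monoidal_category.invertible_def[OF unitary_monoidal_category_PC]
      unitary_monoidal_category.iso_def[OF unitary_monoidal_category_PC] by auto
qed

lemma abelian_cls: "abelian_anyon PC (cls x)"
  using unitary_braided_fusion_category.abelian_anyon_iff[OF unitary_braided_fusion_category_PC]
    rep_cls[of x] invertible_singleton anyons_PC by auto

text \<open>The twist is evaluated at the label chosen by \<open>rep\<close>, of which only the
  class modulo L is known.\<close>

lemma twist_cls: "\<exists>y. y - x \<in> L \<and> twist PC (cls x) = R y y"
proof -
  obtain m where m: "rep (cls x) = [m]" "dec m - x \<in> L" using rep_cls by blast
  have "obj_twist PC [m] = R (dec m) (dec m)"
    using unitary_braided_fusion_category.obj_twist_eq[OF unitary_braided_fusion_category_PC _
        unitary_braided_fusion_category.dim_1_if_invertible[OF unitary_braided_fusion_category_PC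
          invertible_singleton[of m]]] mbraid_singleton[of m m]
    by (simp add: simple_PC_iff)
  then show ?thesis using m unfolding twist_def by metis
qed

text \<open>The product R(x, y) R(y, x) does not change when x or y is shifted by L, by
  \<open>R_L\<close> and \<open>R_L_sym\<close>; hence the unknown representatives do not
  matter.\<close>

lemma full_braiding_cls: "full_braiding PC (cls x) (cls y) w \<longleftrightarrow> w = R x y * R y x"
proof -
  obtain m n where m: "rep (cls x) = [m]" "dec m - x \<in> L" and n: "rep (cls y) = [n]" "dec n - y \<in> L"
    using rep_cls by meson
  have "R (u + x) (v + y) * R (v + y) (u + x) = R x y * R y x" if "u \<in> L" "v \<in> L" for u v
  proof -
    have "R (u + x) (v + y) * R (v + y) (u + x) =
      (R u v * R v u) * (R u y * R y u) * (R v x * R x v) * (R x y * R y x)"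
      by (simp add: R_add_left R_add_right mult_ac)
    then show ?thesis using that by (simp add: R_L R_L_sym)
  qed
  from this[OF m(2) n(2)] have e: "R (dec m) (dec n) * R (dec n) (dec m) = R x y * R y x" by simp
  have c: "mtens [m] [n] = mtens [n] [m]" by (simp add: mtens_singleton add.commute)
  have "mcomp (mbraid [n] [m]) (mbraid [m] [n]) = hscale PC (R x y * R y x) (mid (mtens [m] [n]))"
    unfolding e[symmetric] mbraid_singleton c by (auto simp: mid_def mcomp_def mtens_singleton
        fun_eq_iff)
  then have "full_braiding PC (cls x) (cls y) w \<longleftrightarrow>
      hscale PC (R x y * R y x) (mid (mtens [m] [n])) = hscale PC w (mid (mtens [m] [n]))"
    unfolding full_braiding_def m n by simp
  also have "\<dots> \<longleftrightarrow> w = R x y * R y x"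
    by (auto simp: mid_def mtens_singleton fun_eq_iff)
  finally show ?thesis .
qed

lemma occurs_cls:
  assumes "occurs PC (cls z) (cls x) (cls y)" shows "z - (x + y) \<in> L"
proof -
  obtain k where k: "rep (cls x) = [k]" "dec k - x \<in> L" using rep_cls by blast
  obtain l where l: "rep (cls y) = [l]" "dec l - y \<in> L" using rep_cls by blast
  obtain m where m: "rep (cls z) = [m]" "dec m - z \<in> L" using rep_cls by blast
  obtain f where f: "f \<in> mhom [m] (mtens [k] [l])" "f \<noteq> ([m], \<lambda>i j. 0, mtens [k] [l])"
    using assms unfolding occurs_def k l m by auto
  obtain M where M: "f = ([m], M, mtens [k] [l])" "supp [m] (mtens [k] [l]) M" using f(1) by (rule
      mhomE)
  then obtain i j where "M i j \<noteq> 0" using f(2) by (auto simp: fun_eq_iff)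
  note * = suppD[OF M(2) this]
  have "i = 0" "j = 0" using * by (simp_all add: mtens_singleton)
  then have d: "dec k + dec l - dec m \<in> L" using * by (simp add: mtens_singleton lab_def)
  have "(dec k - x) + (dec l - y) - ((dec k + dec l - dec m) + (dec m - z)) \<in> L"
    using L_diff[OF L_add[OF k(2) l(2)] L_add[OF d m(2)]] .
  then show ?thesis by (simp add: algebra_simps)
qed

end

section \<open>Minimal examples\<close>

definition pair_enc :: "int \<times> int \<Rightarrow> nat" where
  "pair_enc x = prod_encode (int_encode (fst x), int_encode (snd x))"

definition pair_dec :: "nat \<Rightarrow> int \<times> int" where
  "pair_dec n = (int_decode (fst (prod_decode n)), int_decode (snd (prod_decode n)))"

lemma cis_pi_even: "even n \<Longrightarrow> cis (pi * real_of_int n) = 1"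
  by (auto elim!: evenE simp: cis_eq_1_iff)

lemma cis_pi_shift_even:
  assumes "x = y + real_of_int n" "even n" shows "cis (pi * x) = cis (pi * y)"
  using assms cis_pi_even[of n] by (simp add: distrib_left flip: cis_mult)

text \<open>The fusion group is \<open>\<int>\<^sub>N \<times> \<int>\<^sub>2\<close>, the second factor being generated by the fermion, and the
  twist of \<open>(k, j)\<close> is \<open>exp (\<i> \<pi> (p k\<^sup>2 / N + j\<^sup>2))\<close>. The vison is \<open>(v, 0)\<close>, and its full
  braiding with \<open>(k, j)\<close> is \<open>exp (2 \<pi> \<i> p v k / N)\<close>; hence the charges \<open>2 k / N + j\<close>, which are
  well defined modulo 2.\<close>

locale lattice_data =
  fixes N p v :: int
  assumes N: "N > 0" and pN: "even (p * N)" "coprime p N" and pv: "p * v = 2"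
begin

text \<open>\<open>form x x\<close> is the spin angle divided by pi, and twice
  \<open>form x y\<close> is the full braiding angle divided by pi. For p = 1 the value modulo 2 is
  not invariant under shifts by N in the first coordinate, so \<open>braiding\<close> lives on pairs
  of integers and not on the quotient.\<close>

definition form :: "int \<times> int \<Rightarrow> int \<times> int \<Rightarrow> real" where
  "form x y = real_of_int (p * fst x * fst y) / real_of_int N + real_of_int (snd x * snd y)"

definition braiding :: "int \<times> int \<Rightarrow> int \<times> int \<Rightarrow> complex" where
  "braiding x y = cis (pi * form x y)"

definition lattice :: "(int \<times> int) set" where
  "lattice = {x. N dvd fst x \<and> 2 dvd snd x}"

lemma latticeE:
  assumes "x \<in> lattice" obtains a b where "x = (N * a, 2 * b)"
  using assms by (cases x) (auto simp: lattice_def elim!: dvdE)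

text \<open>Lattice vectors pair integrally with everything; doubling gives even integers, so they
  are transparent.\<close>

lemma form_lattice: "form (N * a, 2 * b) (l, i) = real_of_int (p * a * l + 2 * b * i)"
  "form (l, i) (N * a, 2 * b) = real_of_int (p * a * l + 2 * b * i)"
  using N by (simp_all add: form_def)

lemma lattice_index: "x - (fst x mod N, snd x mod 2) \<in> lattice"
  by (simp add: lattice_def fst_diff snd_diff mod_eq_dvd_iff[symmetric])

sublocale pointed_data pair_enc pair_dec braiding lattice
proof
  show "pair_dec (pair_enc x) = x" for x by (simp add: pair_dec_def pair_enc_def)
  show "pair_enc (pair_dec n) = n" for n by (simp add: pair_dec_def pair_enc_def)
  show "cnj (braiding x y) * braiding x y = 1" for x y
    by (simp add: braiding_def cis_cnj cis_mult)
  show "braiding (x + y) z = braiding x z * braiding y z" for x y z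
    by (simp add: braiding_def cis_mult form_def algebra_simps add_divide_distrib)
  show "braiding x (y + z) = braiding x y * braiding x z" for x y z
    by (simp add: braiding_def cis_mult form_def algebra_simps add_divide_distrib)
  show "0 \<in> lattice" by (simp add: lattice_def)
  show "x - y \<in> lattice" if "x \<in> lattice" "y \<in> lattice" for x y
    using that by (auto simp: lattice_def)
  show "braiding x y = 1" if h: "x \<in> lattice" "y \<in> lattice" for x y
  proof -
    obtain a b where x: "x = (N * a, 2 * b)" using latticeE[OF h(1)] .
    obtain c d where y: "y = (N * c, 2 * d)" using latticeE[OF h(2)] .
    have "form x y = real_of_int (p * N * (a * c) + 2 * b * (2 * d))"
      unfolding x y form_lattice(1) by (simp add: mult_ac)
    \<comment> \<open>The evenness of p N makes the lattice vectors bosons that braid trivially with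
      one another.\<close>
    moreover have "even (p * N * (a * c) + 2 * b * (2 * d))" using pN(1) by auto
    ultimately show ?thesis unfolding braiding_def by (simp only: cis_pi_even)
  qed
  show "braiding x y * braiding y x = 1" if h: "x \<in> lattice" for x y
  proof -
    obtain a b where x: "x = (N * a, 2 * b)" using latticeE[OF h] .
    obtain l i where y: "y = (l, i)" by (cases y)
    have "braiding x y * braiding y x = cis (pi * real_of_int (2 * (p * a * l + 2 * b * i)))"
      unfolding x y braiding_def form_lattice cis_mult by (simp add: algebra_simps)
    then show ?thesis using cis_pi_even[of "2 * (p * a * l + 2 * b * i)"] by simp
  qed
  have "finite ({0..<N} \<times> {0..<2 :: int})" by simp
  moreover have "\<exists>t\<in>{0..<N} \<times> {0..<2}. x - t \<in> lattice" for x
    using lattice_index[of x] N by (intro bexI[of _ "(fst x mod N, snd x mod 2)"]) auto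
  ultimately show "\<exists>T. finite T \<and> (\<forall>x. \<exists>t\<in>T. x - t \<in> lattice)" by blast
qed

definition lattice_charge :: "int \<times> int \<Rightarrow> real" where
  "lattice_charge x = 2 * real_of_int (fst x) / real_of_int N + real_of_int (snd x)"

text \<open>The Hall conductance is the charge 2 v / N of the label (v, 0); because p v = 2 it also
  equals p v^2 / N, the spin angle divided by pi. Charges are read off a representative, which fixes
  them only modulo 2. Translations act trivially.\<close>

definition model :: "int \<times> int \<Rightarrow> (ref_obj, ref_arr) enriched_TO" where
  "model a = \<lparr> TO = PC, fermion = cls (0, 1), charge = \<lambda>x. lattice_charge (pair_dec (hd (rep x))),
     vison = cls (v, 0), hall = 2 * real_of_int v / real_of_int N, background = cls a,
     translation = \<lambda>g x. x \<rparr>"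

lemma lattice_charge_cong:
  assumes "x - y \<in> lattice" shows "[lattice_charge x = lattice_charge y] (rmod 2)"
proof -
  obtain a b where "x - y = (N * a, 2 * b)" using latticeE[OF assms] .
  then have "fst x = fst y + N * a" "snd x = snd y + 2 * b"
    by (metis add.commute diff_add_cancel fst_add fst_conv, metis add.commute diff_add_cancel
        snd_add snd_conv)
  then have "lattice_charge x = lattice_charge y + real_of_int (a + b) * 2"
    using N by (simp add: lattice_charge_def field_simps)
  then have "[lattice_charge y = lattice_charge x] (rmod 2)" unfolding rcong_altdef by blast
  then show ?thesis by (rule rcong_sym)
qed

lemma charge_model: "[charge (model a) (cls x) = lattice_charge x] (rmod 2)"
proof -
  obtain m where "rep (cls x) = [m]" "pair_dec m - x \<in> lattice" using rep_cls by blast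
  with lattice_charge_cong[OF this(2)] show ?thesis by (simp add: model_def)
qed

lemma lattice_charge_add: "lattice_charge (x + y) = lattice_charge x + lattice_charge y"
  by (simp add: lattice_charge_def field_simps add_divide_distrib)

lemma monodromy: "braiding x y * braiding y x = cis (pi * (2 * form x y))"
  by (simp add: braiding_def cis_mult form_def algebra_simps)

lemma transparent: "{x \<in> anyons PC. \<forall>y \<in> anyons PC. full_braiding PC x y 1} = {cls 0, cls (0, 1)}"
proof -
  have tr: "(\<forall>y. 1 = braiding x y * braiding y x) \<longleftrightarrow> N dvd fst x" for x
  proof
    assume "\<forall>y. 1 = braiding x y * braiding y x"
    \<comment> \<open>Braiding with (1, 0) detects the whole first coordinate, because p is coprime
      to N. The second coordinate contributes only integers to \<open>form\<close> and is never
      detected, which leaves the vacuum and the fermion.\<close>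
    then have "cis (pi * (2 * form x (1, 0))) = 1" unfolding monodromy by metis
    then obtain n where "pi * (2 * form x (1, 0)) = of_int n * (2 * pi)" unfolding cis_eq_1_iff by
        blast
    then have "form x (1, 0) = of_int n" by simp
    then have "real_of_int (p * fst x) = real_of_int (n * N)" using N by (simp add: form_def
        field_simps)
    then have "p * fst x = n * N" by (simp only: of_int_eq_iff)
    then have "N dvd p * fst x" by simp
    then show "N dvd fst x" using pN(2) by (simp add: coprime_commute coprime_dvd_mult_right_iff)
  next
    assume "N dvd fst x"
    then obtain a where a: "fst x = N * a" by blast
    have "2 * form x y = real_of_int (2 * (p * a * fst y + snd x * snd y))" for y
      using N by (simp add: form_def a)
    then have "braiding x y * braiding y x = cis (pi * real_of_int (2 * (p * a * fst y + snd x *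
        snd y)))" for y
      unfolding monodromy by (simp only:)
    then have "braiding x y * braiding y x = 1" for y
      using cis_pi_even[of "2 * (p * a * fst y + snd x * snd y)"] by simp
    then show "\<forall>y. 1 = braiding x y * braiding y x" by simp
  qed
  have "cls x \<in> {cls 0, cls (0, 1)} \<longleftrightarrow> N dvd fst x" for x
  proof -
    have "cls x \<in> {cls 0, cls (0, 1)} \<longleftrightarrow> x - 0 \<in> lattice \<or> x - (0, 1) \<in> lattice"
      by (simp only: insert_iff empty_iff cls_eq_iff) simp
    then show ?thesis by (cases x) (auto simp: lattice_def)
  qed
  then have "(\<forall>y \<in> range cls. full_braiding PC (cls x) y 1) \<longleftrightarrow> cls x \<in> {cls 0, cls (0, 1)}" for x
    using tr[of x] by (simp only: ball_simps(9) full_braiding_cls ball_UNIV)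
  then show ?thesis unfolding anyons_PC by blast
qed

text \<open>The representative behind the twist is unknown, so the spin is required modulo 2 for
  every label of the class.\<close>

lemma twist_int:
  assumes "\<And>y. y - x \<in> lattice \<Longrightarrow> \<exists>n. even n \<and> form y y = s + real_of_int n"
  shows "twist PC (cls x) = cis (pi * s)"
proof -
  obtain y where y: "y - x \<in> lattice" "twist PC (cls x) = braiding y y" using twist_cls by blast
  then show ?thesis using assms[OF y(1)] cis_pi_shift_even unfolding braiding_def by metis
qed

lemma model_in_SET:
  assumes a: "[lattice_charge a = \<nu>] (rmod 2)"
  shows "model a \<in> SET \<nu>"
proof -
  have any: "\<And>x. x \<in> anyons PC \<Longrightarrow> \<exists>y. x = cls y" "\<And>y. cls y \<in> anyons PC" unfolding anyons_PC by auto
  have vac: "vacuum PC = cls 0" unfolding vacuum_def using anyon_rel_PC[of "pair_enc 0"] by simp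
  have shift: "\<exists>c d. y = (fst x + N * c, snd x + 2 * d)" if yx: "y - x \<in> lattice" for x y
  proof -
    obtain c d where "y - x = (N * c, 2 * d)" using latticeE[OF yx] .
    then have "fst y - fst x = N * c" "snd y - snd x = 2 * d" by (metis fst_diff fst_conv, metis
        snd_diff snd_conv)
    then have "y = (fst x + N * c, snd x + 2 * d)" by (cases y) auto
    then show ?thesis by blast
  qed
  have twc: "twist PC (cls (0, 1)) = cis (pi * 1)"
  proof (rule twist_int)
    fix y assume "y - (0, 1) \<in> lattice"
    then obtain c d where y: "y = (N * c, 1 + 2 * d)" using shift by fastforce
    have "form y y = 1 + real_of_int (p * N * c\<^sup>2 + 4 * d + 4 * d\<^sup>2)"
      using N by (simp add: y form_def power2_eq_square field_simps)
    moreover have "even (p * N * c\<^sup>2 + 4 * d + 4 * d\<^sup>2)" using pN(1) by simp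
    ultimately show "\<exists>n. even n \<and> form y y = 1 + real_of_int n" by blast
  qed
  have twv: "twist PC (cls (v, 0)) = cis (pi * (2 * real_of_int v / real_of_int N))"
  proof (rule twist_int)
    fix y assume "y - (v, 0) \<in> lattice"
    then obtain c d where y: "y = (v + N * c, 2 * d)" using shift by fastforce
    \<comment> \<open>From p v = 2 come p v^2 = 2 v and the cross term 2 p v N c = 4 N c; after
      division by N every correction is an even integer.\<close>
    have "p * (v + N * c) * (v + N * c) = 2 * v + N * (4 * c + p * N * c\<^sup>2)"
      using pv by (simp add: power2_eq_square algebra_simps)
    then have "form y y = real_of_int (2 * v + N * (4 * c + p * N * c\<^sup>2)) / real_of_int N +
        real_of_int (4 * d\<^sup>2)"
      by (simp add: y form_def power2_eq_square)
    then have "form y y = 2 * real_of_int v / real_of_int N + real_of_int (4 * c + p * N * c\<^sup>2 + 4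
        * d\<^sup>2)"
      using N by (simp add: add_divide_distrib)
    moreover have "even (4 * c + p * N * c\<^sup>2 + 4 * d\<^sup>2)" using pN(1) by simp
    ultimately show "\<exists>n. even n \<and> form y y = 2 * real_of_int v / real_of_int N + real_of_int n" by
        blast
  qed
  have iso: "isomorphic PC (tens PC (rep (cls (0, 1))) (rep (cls (0, 1)))) (tunit PC)"
  proof -
    obtain m where m: "rep (cls (0, 1)) = [m]" "pair_dec m - (0, 1) \<in> lattice" using rep_cls by
        blast
    obtain c d where d: "pair_dec m = (N * c, 1 + 2 * d)" using shift[OF m(2)] by auto
    have "0 - (pair_dec m + pair_dec m) \<in> lattice"
      unfolding d by (simp add: lattice_def zero_prod_def)
    then show ?thesis unfolding m by (simp add: mtens_singleton isomorphic_PC)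
  qed
  have ferm: "fermionic_TO (TO (model a)) (fermion (model a))"
    using unitary_braided_fusion_category_PC transparent iso twc
    unfolding fermionic_TO_def by (simp add: model_def vac del: PC_simps)
  have charge: "charge_assignment (model a)"
  proof -
    have "[charge (model a) (cls z) = charge (model a) (cls x) + charge (model a) (cls y)] (rmod 2)"
      if "occurs PC (cls z) (cls x) (cls y)" for x y z
    proof -
      note charge_model[of a z]
      also have "[lattice_charge z = lattice_charge x + lattice_charge y] (rmod 2)"
        using lattice_charge_cong[OF occurs_cls[OF that]] by (simp add: lattice_charge_add)
      also have "[lattice_charge x + lattice_charge y = charge (model a) (cls x) + charge (model
          a) (cls y)] (rmod 2)"
        by (intro rcong_add rcong_sym[OF charge_model])
      finally show ?thesis .
    qed
    moreover have "[charge (model a) (cls 0) = 0] (rmod 2)"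
      using charge_model[of a 0] by (simp add: lattice_charge_def)
    moreover have "[charge (model a) (cls (0, 1)) = 1] (rmod 2)"
      using charge_model[of a "(0, 1)"] by (simp add: lattice_charge_def)
    moreover have "TO (model a) = PC" "fermion (model a) = cls (0, 1)" by (simp_all add: model_def)
    ultimately show ?thesis unfolding charge_assignment_def vac anyons_PC
      using anyons_PC vac by simp
  qed
  have vison: "vison_data (model a)"
  proof -
    have "full_braiding PC (cls (v, 0)) (cls x) (cis (2 * pi * charge (model a) (cls x)))" for x
    proof -
      obtain n where "lattice_charge x = charge (model a) (cls x) + of_int n * 2"
        using charge_model[of a x] unfolding rcong_altdef by blast
      then have "2 * lattice_charge x = 2 * charge (model a) (cls x) + real_of_int (4 * n)" by simp
      from cis_pi_shift_even[OF this]
      have 1: "cis (2 * pi * charge (model a) (cls x)) = cis (pi * (2 * lattice_charge x))" by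
          (simp add: mult_ac)
      \<comment> \<open>The doubled charge has the extra term \<open>2 * snd x\<close>, an even
        integer that does not affect the phase. By p v = 2 the rest is the braiding with (v,
        0).\<close>
      have "2 * form (v, 0) x = 4 * real_of_int (fst x) / real_of_int N"
        using pv by (simp add: form_def flip: of_int_mult)
      then have "2 * lattice_charge x = 2 * form (v, 0) x + real_of_int (2 * snd x)"
        by (simp add: lattice_charge_def)
      from cis_pi_shift_even[OF this] show ?thesis unfolding full_braiding_cls monodromy 1 by simp
    qed
    moreover have "[charge (model a) (cls (v, 0)) = hall (model a)] (rmod 2)"
      using charge_model[of a "(v, 0)"] by (simp add: lattice_charge_def model_def)
    ultimately show ?thesis unfolding vison_data_def
      using any(1) abelian_cls[of "(v, 0)"] twv by (fastforce simp: model_def)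
  qed
  have backgr: "background_data \<nu> (model a)"
    unfolding background_data_def
    using abelian_cls[of a] rcong_trans[OF charge_model[of a a] assms] by (simp add: model_def)
  have "translation_action (model a)"
    unfolding translation_action_def by (simp add: model_def bij_betw_def)
  then show ?thesis using ferm charge vison backgr unfolding SET_def by simp
qed

lemma model_size: "num_anyons (TO (model a)) = nat (2 * N)"
  "total_qdim (TO (model a)) = sqrt (real (nat (2 * N)))"
proof -
  let ?T = "{0..<N} \<times> {0..<2 :: int}"
  have "range cls = cls ` ?T"
  proof
    show "range cls \<subseteq> cls ` ?T"
    proof
      fix c assume "c \<in> range cls"
      then obtain x where x: "c = cls x" by blast
      have "c = cls (fst x mod N, snd x mod 2)" unfolding x cls_eq_iff by (rule lattice_index)
      moreover have "(fst x mod N, snd x mod 2) \<in> ?T" using N by simp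
      ultimately show "c \<in> cls ` ?T" by blast
    qed
  qed auto
  moreover have "inj_on cls ?T"
  proof (rule inj_onI)
    fix x y assume x: "x \<in> ?T" and y: "y \<in> ?T" and e: "cls x = cls y"
    then have "N dvd fst x - fst y" "2 dvd snd x - snd y"
      unfolding cls_eq_iff by (simp_all add: lattice_def)
    then have "fst x mod N = fst y mod N" "snd x mod 2 = snd y mod 2" by (simp_all add:
        mod_eq_dvd_iff)
    then show "x = y" using x y by (auto simp: prod_eq_iff)
  qed
  ultimately have card: "card (anyons PC) = nat (2 * N)"
    unfolding anyons_PC using N by (simp add: card_image card_cartesian_product nat_mult_distrib)
  then show "num_anyons (TO (model a)) = nat (2 * N)" by (simp add: num_anyons_def model_def)
  have "qdim PC x = 1" if "x \<in> anyons PC" for x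
    using that abelian_cls unfolding anyons_PC abelian_anyon_def by auto
  then show "total_qdim (TO (model a)) = sqrt (real (nat (2 * N)))"
    using card by (simp add: total_qdim_def model_def)
qed

end

lemma ex_small_SET:
  assumes q: "q > 0"
  shows "\<exists>S \<in> (SET (1 / real q) :: (ref_obj, ref_arr) enriched_TO set).
    num_anyons (TO S) = (if odd q then 2 * q else 4 * q) \<and>
    total_qdim (TO S) = sqrt (real (if odd q then 2 * q else 4 * q))"
proof (cases "odd q")
  case True
  \<comment> \<open>N = q is odd, so p N is even only if p is; with p v = 2 and p coprime to N this
    suggests p = 2 and v = 1.\<close>
  interpret lattice_data "int q" 2 1
    by unfold_locales (use q True in \<open>auto simp: coprime_left_2_iff_odd\<close>)
  obtain h where h: "q = 2 * h + 1" using True by (rule oddE)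
  \<comment> \<open>With q = 2 h + 1 the charge is 1 - 2 h / q = 1 / q: the fermion supplies the 1
    that multiples of 2 / q cannot reach.\<close>
  have "lattice_charge (- int h, 1) = 1 / real q"
  proof -
    have "real q = 2 * real h + 1" using h by simp
    then show ?thesis using q unfolding lattice_charge_def by (simp add: field_simps)
  qed
  then have m: "model (- int h, 1) \<in> SET (1 / real q)" by (intro model_in_SET) simp
  have "nat (2 * int q) = 2 * q" by simp
  then show ?thesis using True by (intro bexI[OF _ m]) (simp add: model_size)
next
  case False
  \<comment> \<open>N = 2 q is even, so p must be odd to be coprime to it; p v = 2 then suggests p =
    1 and v = 2. The generator (1, 0) has charge 2 / N = 1 / q.\<close>
  interpret lattice_data "2 * int q" 1 2
    by unfold_locales (use q in auto)
  have "lattice_charge (1, 0) = 1 / real q"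
    using q unfolding lattice_charge_def by (simp add: field_simps)
  then have m: "model (1, 0) \<in> SET (1 / real q)" by (intro model_in_SET) simp
  have "nat (2 * (2 * int q)) = 4 * q" by simp
  then show ?thesis using False by (intro bexI[OF _ m]) (simp add: model_size)
qed

theorem mainTheorem2:
  fixes q :: nat
  assumes "q > 0"
  shows "\<forall>S \<in> (mH_GSD (1 / real q) :: ('o, 'm) enriched_TO set) \<union> mH_D (1 / real q).
    abelian_cat (TO S) \<and> num_anyons (TO S) = (if odd q then 2 * q else 4 * q)"
proof
  fix S :: "('o, 'm) enriched_TO"
  assume S: "S \<in> mH_GSD (1 / real q) \<union> mH_D (1 / real q)"
  define N where "N = (if odd q then 2 * q else 4 * q)"
  obtain S' :: "(ref_obj, ref_arr) enriched_TO" where S': "S' \<in> SET (1 / real q)"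
    "num_anyons (TO S') = N" "total_qdim (TO S') = sqrt (real N)"
    using ex_small_SET[OF assms] unfolding N_def by blast
  \<comment> \<open>Minimality is used only against S', whose two sizes are both known; which of the
    two sets contains S decides the disjunct.\<close>
  have "S \<in> SET (1 / real q)" "num_anyons (TO S) \<le> N \<or> total_qdim (TO S) \<le> sqrt (real N)"
    using S S' unfolding mH_GSD_def mH_D_def by (auto simp flip: S'(2,3))
  from SET_minimal_abelian[OF assms this(1) N_def this(2)]
  show "abelian_cat (TO S) \<and> num_anyons (TO S) = (if odd q then 2 * q else 4 * q)"
    unfolding N_def .
qed

end
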